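(* Let $\tau\neq0$ and consider compact two-sided surfaces $\psi:\Sigma^2\to Nil_3(\tau)$ immersed with constant mean curvature $H$ into the Heisenberg group $Nil_3(\tau)$. (i) There exists no such surface that is strongly stable and has $H^2\geq\tau^2$. (ii) If $\Sigma^2$ is such a surface, of genus $g$, that is strongly stable and has $H^2<\tau^2$, then $$\mathrm{Area}(\Sigma)\,|H^2-\tau^2|>2\pi(g-1).$$
   Context: $Nil_3(\tau)$, $\tau\neq0$, is the Heisenberg group with its standard homogeneous metric: the simply connected homogeneous Riemannian 3-manifold with 4-dimensional isometry group admitting a Riemannian submersion $\Pi$ onto the Euclidean plane (constant curvature $\kappa=0$), with totally geodesic fibers and a unit Killing field $\xi$ vertical with respect to $\Pi$ satisfying $\overline{\nabla}_X\xi=\tau(X\wedge\xi)$ for all vector fields $X$, where $\overline{\nabla}$ is the Levi-Civita connection and $\wedge$ the vector product; the constant $\tau$ is the bundle curvature. Surfaces are connected, orientable and without boundary, with the metric induced by the immersion. Two-sided means there is a globally defined unit normal vector field $N$ along the immersion. $A$ is the shape operator with respect to $N$ and $H=\frac12\mathrm{tr}(A)$ is the mean curvature. The Jacobi (stability) operator is $J=\Delta+|A|^2+\overline{\mathrm{Ric}}(N,N)$, where $\Delta$ is the Laplacian of $\Sigma$ (with $\int_\Sigma f\Delta f=-\int_\Sigma|\nabla f|^2$) and $\overline{\mathrm{Ric}}$ is the Ricci curvature of the ambient space. A constant mean curvature surface $\Sigma$ is strongly stable if $-\int_\Sigma fJf\geq0$ for every $f\in\mathcal{C}^\infty(\Sigma)$.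 *)

theory Defs
  imports "HOL-Analysis.Analysis" "HOL-Homology.Homology"
begin

section \<open>Smooth functions and smooth surfaces\<close>

definition partial :: "'n::finite \<Rightarrow> (real^'n \<Rightarrow> 'b::real_normed_vector) \<Rightarrow> real^'n \<Rightarrow> 'b"
  where "partial i f x = frechet_derivative f (at x) (axis i 1)"

primrec Ck_on :: "nat \<Rightarrow> 'a::real_normed_vector set \<Rightarrow> ('a \<Rightarrow> 'b::real_normed_vector) \<Rightarrow> bool"
  where
    "Ck_on 0 S f \<longleftrightarrow> continuous_on S f"
  | "Ck_on (Suc k) S f \<longleftrightarrow>
       (\<forall>x\<in>S. f differentiable (at x)) \<and> (\<forall>v. Ck_on k S (\<lambda>x. frechet_derivative f (at x) v))"

text \<open>Smoothness is meant for open sets \<open>S\<close> only.\<close>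

definition smooth_on :: "'a::real_normed_vector set \<Rightarrow> ('a \<Rightarrow> 'b::real_normed_vector) \<Rightarrow> bool"
  where "smooth_on S f \<longleftrightarrow> (\<forall>k. Ck_on k S f)"

type_synonym 'a chart = "'a set \<times> ('a \<Rightarrow> real^2)"

definition chart_image :: "'a chart \<Rightarrow> (real^2) set"
  where "chart_image c = snd c ` fst c"

definition in_chart :: "'a chart \<Rightarrow> ('a \<Rightarrow> 'b) \<Rightarrow> real^2 \<Rightarrow> 'b"
  where "in_chart c f = f \<circ> inv_into (fst c) (snd c)"

definition is_chart :: "'a topology \<Rightarrow> 'a chart \<Rightarrow> bool"
  where "is_chart X c \<longleftrightarrow>
    openin X (fst c) \<and> open (chart_image c) \<and>
    homeomorphic_map (subtopology X (fst c)) (top_of_set (chart_image c)) (snd c)"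

definition smooth_atlas :: "'a topology \<Rightarrow> 'a chart set \<Rightarrow> bool"
  where "smooth_atlas X A \<longleftrightarrow>
    (\<forall>c\<in>A. is_chart X c) \<and> (\<Union>c\<in>A. fst c) = topspace X \<and>
    (\<forall>c\<in>A. \<forall>d\<in>A. smooth_on (snd c ` (fst c \<inter> fst d)) (in_chart c (snd d)))"

text \<open>Two atlases define the same smooth structure iff their union is again an atlas.\<close>

definition orientable :: "'a topology \<Rightarrow> 'a chart set \<Rightarrow> bool"
  where "orientable X A \<longleftrightarrow>
    (\<exists>B. smooth_atlas X B \<and> smooth_atlas X (A \<union> B) \<and>
      (\<forall>c\<in>B. \<forall>d\<in>B. \<forall>y\<in>snd c ` (fst c \<inter> fst d).
        det (matrix (frechet_derivative (in_chart c (snd d)) (at y))) > 0))"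

text \<open>The empty space counts as connected in the library, hence the explicit nonemptiness.\<close>

definition surface :: "'a topology \<Rightarrow> 'a chart set \<Rightarrow> bool"
  where "surface X A \<longleftrightarrow>
    topspace X \<noteq> {} \<and> Hausdorff_space X \<and> second_countable X \<and> connected_space X \<and>
    smooth_atlas X A \<and> orientable X A"

definition smooth_map :: "'a chart set \<Rightarrow> ('a \<Rightarrow> 'b::real_normed_vector) \<Rightarrow> bool"
  where "smooth_map A f \<longleftrightarrow> (\<forall>c\<in>A. smooth_on (chart_image c) (in_chart c f))"

text \<open>The genus of a compact connected orientable surface is half the rank of its first integral
  homology group, which is free.\<close>

definition has_genus :: "'a topology \<Rightarrow> nat \<Rightarrow> bool"
  where "has_genus X g \<longleftrightarrow> homology_group 1 X \<cong> free_Abelian_group {..<2 * g}"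


section \<open>Riemannian metrics on coordinate space\<close>

text \<open>A Riemannian metric on \<open>\<real>\<^sup>n\<close> is given by its matrix in the coordinate frame, and tangent
  vectors by their coordinate components. Below, \<open>christoffel G p i j $ k\<close> is
  \<open>\<Gamma>\<close> with upper index \<open>k\<close> and lower indices \<open>i\<close>, \<open>j\<close>; the Ricci tensor is the trace of
  \<open>X \<mapsto> R(X,Y)Z\<close> with \<open>R(X,Y) = [\<nabla>\<^sub>X,\<nabla>\<^sub>Y] - \<nabla>\<close> along \<open>[X,Y]\<close>, so that it is positive on spheres.\<close>

type_synonym 'n metric = "real^'n \<Rightarrow> real^'n^'n"

definition metric_inner :: "'n::finite metric \<Rightarrow> real^'n \<Rightarrow> real^'n \<Rightarrow> real^'n \<Rightarrow> real"
  where "metric_inner G p v w = v \<bullet> (G p *v w)"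

definition christoffel :: "'n::finite metric \<Rightarrow> real^'n \<Rightarrow> 'n \<Rightarrow> 'n \<Rightarrow> real^'n"
  where "christoffel G p i j =
    (\<chi> k. (\<Sum>l\<in>UNIV. matrix_inv (G p) $ k $ l *
      (partial i (\<lambda>q. G q $ j $ l) p + partial j (\<lambda>q. G q $ i $ l) p
        - partial l (\<lambda>q. G q $ i $ j) p)) / 2)"

definition ricci :: "'n::finite metric \<Rightarrow> real^'n \<Rightarrow> real^'n \<Rightarrow> real^'n \<Rightarrow> real"
  where "ricci G p v w =
    (\<Sum>j\<in>UNIV. \<Sum>k\<in>UNIV. v $ j * w $ k * (\<Sum>i\<in>UNIV.
        partial i (\<lambda>q. christoffel G q j k $ i) p
      - partial j (\<lambda>q. christoffel G q i k $ i) p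
      + (\<Sum>m\<in>UNIV. christoffel G p i m $ i * christoffel G p j k $ m
                  - christoffel G p j m $ i * christoffel G p i k $ m)))"


section \<open>The Heisenberg group\<close>

text \<open>The standard model of the Heisenberg group with bundle curvature \<open>\<tau>\<close>: the space \<open>\<real>\<^sup>3\<close> with
  the metric \<open>dx\<^sup>2 + dy\<^sup>2 + (\<tau> (y dx - x dy) + dz)\<^sup>2\<close>. The submersion is \<open>(x,y,z) \<mapsto> (x,y)\<close>, the
  unit Killing field \<open>\<xi>\<close> is \<open>\<partial>\<^sub>z\<close>, and \<open>\<partial>\<^sub>x - \<tau> y \<partial>\<^sub>z\<close>, \<open>\<partial>\<^sub>y + \<tau> x \<partial>\<^sub>z\<close>, \<open>\<partial>\<^sub>z\<close> is a positively
  oriented orthonormal frame, for which \<open>\<nabla>\<^sub>X \<xi> = \<tau> (X \<and> \<xi>)\<close>.\<close>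

definition nil3_contact :: "real \<Rightarrow> real^3 \<Rightarrow> real^3"
  where "nil3_contact \<tau> p = vector [\<tau> * p $ 2, - \<tau> * p $ 1, 1]"

definition nil3_metric :: "real \<Rightarrow> 3 metric"
  where "nil3_metric \<tau> p =
    (\<chi> i j. (if i = j \<and> i \<noteq> 3 then 1 else 0) + nil3_contact \<tau> p $ i * nil3_contact \<tau> p $ j)"


section \<open>Immersed surfaces\<close>

text \<open>Throughout, \<open>G\<close> is a metric on \<open>\<real>\<^sup>3\<close>, \<open>A\<close> the atlas of the surface, \<open>\<psi>\<close> the immersion and
  \<open>N\<close> a unit normal field along \<open>\<psi>\<close>.\<close>

definition immersion :: "'a chart set \<Rightarrow> ('a \<Rightarrow> real^3) \<Rightarrow> bool"
  where "immersion A \<psi> \<longleftrightarrow> smooth_map A \<psi> \<and>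
    (\<forall>c\<in>A. \<forall>y\<in>chart_image c. inj (frechet_derivative (in_chart c \<psi>) (at y)))"

definition unit_normal_field ::
    "3 metric \<Rightarrow> 'a chart set \<Rightarrow> ('a \<Rightarrow> real^3) \<Rightarrow> ('a \<Rightarrow> real^3) \<Rightarrow> bool"
  where "unit_normal_field G A \<psi> N \<longleftrightarrow> smooth_map A N \<and>
    (\<forall>c\<in>A. \<forall>y\<in>chart_image c.
      metric_inner G (in_chart c \<psi> y) (in_chart c N y) (in_chart c N y) = 1 \<and>
      (\<forall>i. metric_inner G (in_chart c \<psi> y) (in_chart c N y) (partial i (in_chart c \<psi>) y) = 0))"

definition induced_metric :: "3 metric \<Rightarrow> 'a chart \<Rightarrow> ('a \<Rightarrow> real^3) \<Rightarrow> 2 metric"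
  where "induced_metric G c \<psi> y =
    (\<chi> i j. metric_inner G (in_chart c \<psi> y)
       (partial i (in_chart c \<psi>) y) (partial j (in_chart c \<psi>) y))"

text \<open>The ambient covariant derivative of \<open>N\<close> along the \<open>i\<close>-th coordinate field of the chart.\<close>

definition normal_derivative ::
    "3 metric \<Rightarrow> 'a chart \<Rightarrow> ('a \<Rightarrow> real^3) \<Rightarrow> ('a \<Rightarrow> real^3) \<Rightarrow> 2 \<Rightarrow> real^2 \<Rightarrow> real^3"
  where "normal_derivative G c \<psi> N i y =
    partial i (in_chart c N) y +
    (\<Sum>a\<in>UNIV. \<Sum>b\<in>UNIV. (partial i (in_chart c \<psi>) y $ a * in_chart c N y $ b) *\<^sub>R
      christoffel G (in_chart c \<psi> y) a b)"

text \<open>The matrix, in the coordinate frame of the chart, of the shape operator \<open>v \<mapsto> - \<nabla>\<^sub>v N\<close>.\<close>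

definition shape_operator ::
    "3 metric \<Rightarrow> 'a chart \<Rightarrow> ('a \<Rightarrow> real^3) \<Rightarrow> ('a \<Rightarrow> real^3) \<Rightarrow> real^2 \<Rightarrow> real^2^2"
  where "shape_operator G c \<psi> N y =
    matrix_inv (induced_metric G c \<psi> y) **
    (\<chi> i j. metric_inner G (in_chart c \<psi> y)
       (partial i (in_chart c \<psi>) y) (- normal_derivative G c \<psi> N j y))"

text \<open>The quantities below do not depend on the chart in which they are computed.\<close>

definition chart_at :: "'a chart set \<Rightarrow> 'a \<Rightarrow> 'a chart"
  where "chart_at A p = (SOME c. c \<in> A \<and> p \<in> fst c)"

definition mean_curvature ::
    "3 metric \<Rightarrow> 'a chart set \<Rightarrow> ('a \<Rightarrow> real^3) \<Rightarrow> ('a \<Rightarrow> real^3) \<Rightarrow> 'a \<Rightarrow> real"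
  where "mean_curvature G A \<psi> N p =
    (let c = chart_at A p in trace (shape_operator G c \<psi> N (snd c p)) / 2)"

text \<open>Here \<open>|S|\<^sup>2\<close> is the trace of \<open>S\<^sup>* S\<close>, the adjoint being taken for the induced metric \<open>g\<close>, so that
  its matrix is \<open>g\<^sup>-\<^sup>1 S\<^sup>T g\<close>.\<close>

definition shape_norm2 ::
    "3 metric \<Rightarrow> 'a chart set \<Rightarrow> ('a \<Rightarrow> real^3) \<Rightarrow> ('a \<Rightarrow> real^3) \<Rightarrow> 'a \<Rightarrow> real"
  where "shape_norm2 G A \<psi> N p =
    (let c = chart_at A p; g = induced_metric G c \<psi> (snd c p);
         S = shape_operator G c \<psi> N (snd c p)
     in trace (matrix_inv g ** transpose S ** g ** S))"

definition laplacian ::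
    "3 metric \<Rightarrow> 'a chart set \<Rightarrow> ('a \<Rightarrow> real^3) \<Rightarrow> ('a \<Rightarrow> real) \<Rightarrow> 'a \<Rightarrow> real"
  where "laplacian G A \<psi> f p =
    (let c = chart_at A p; g = induced_metric G c \<psi>
     in (\<Sum>i\<in>UNIV. partial i (\<lambda>y. sqrt (det (g y)) *
           (\<Sum>j\<in>UNIV. matrix_inv (g y) $ i $ j * partial j (in_chart c f) y)) (snd c p))
        / sqrt (det (g (snd c p))))"

definition jacobi_operator ::
    "3 metric \<Rightarrow> 'a chart set \<Rightarrow> ('a \<Rightarrow> real^3) \<Rightarrow> ('a \<Rightarrow> real^3) \<Rightarrow> ('a \<Rightarrow> real) \<Rightarrow> 'a \<Rightarrow> real"
  where "jacobi_operator G A \<psi> N f p =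
    laplacian G A \<psi> f p + (shape_norm2 G A \<psi> N p + ricci G (\<psi> p) (N p) (N p)) * f p"

text \<open>The Riemannian area measure: the unique Borel measure given in every chart by the density
  \<open>sqrt (det g)\<close>.\<close>

definition is_area_measure ::
    "3 metric \<Rightarrow> 'a topology \<Rightarrow> 'a chart set \<Rightarrow> ('a \<Rightarrow> real^3) \<Rightarrow> 'a measure \<Rightarrow> bool"
  where "is_area_measure G X A \<psi> M \<longleftrightarrow>
    space M = topspace X \<and> sets M = sigma_sets (topspace X) {U. openin X U} \<and>
    (\<forall>c\<in>A. \<forall>B\<in>sets M. B \<subseteq> fst c \<longrightarrow>
      emeasure M B = (\<integral>\<^sup>+y\<in>snd c ` B. ennreal (sqrt (det (induced_metric G c \<psi> y))) \<partial>lborel))"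

definition area_measure ::
    "3 metric \<Rightarrow> 'a topology \<Rightarrow> 'a chart set \<Rightarrow> ('a \<Rightarrow> real^3) \<Rightarrow> 'a measure"
  where "area_measure G X A \<psi> = (THE M. is_area_measure G X A \<psi> M)"

definition area :: "3 metric \<Rightarrow> 'a topology \<Rightarrow> 'a chart set \<Rightarrow> ('a \<Rightarrow> real^3) \<Rightarrow> real"
  where "area G X A \<psi> = measure (area_measure G X A \<psi>) (topspace X)"

definition strongly_stable ::
    "3 metric \<Rightarrow> 'a topology \<Rightarrow> 'a chart set \<Rightarrow> ('a \<Rightarrow> real^3) \<Rightarrow> ('a \<Rightarrow> real^3) \<Rightarrow> bool"
  where "strongly_stable G X A \<psi> N \<longleftrightarrow>
    (\<forall>f::'a \<Rightarrow> real. smooth_map A f \<longrightarrow>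
      - (\<integral>p. f p * jacobi_operator G A \<psi> N f p \<partial>area_measure G X A \<psi>) \<ge> 0)"

definition compact_two_sided_cmc_surface ::
    "3 metric \<Rightarrow> 'a topology \<Rightarrow> 'a chart set \<Rightarrow> ('a \<Rightarrow> real^3) \<Rightarrow> ('a \<Rightarrow> real^3) \<Rightarrow> real \<Rightarrow> bool"
  where "compact_two_sided_cmc_surface G X A \<psi> N H \<longleftrightarrow>
    surface X A \<and> compact_space X \<and> immersion A \<psi> \<and> unit_normal_field G A \<psi> N \<and>
    (\<forall>p\<in>topspace X. mean_curvature G A \<psi> N p = H)"

end

theory Submission
  imports Defs
begin

text \<open>No compact constant mean curvature surface in \<open>Nil\<^sub>3\<close> is strongly stable, so (ii) holds
  vacuously. Pairing the unit normal with the three Killing fields generating the left translations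
  gives Jacobi functions \<open>u\<^sub>1, u\<^sub>2, u\<^sub>3\<close> without common zero. For \<open>f = sqrt (u\<^sub>1\<^sup>2 + u\<^sub>2\<^sup>2 + u\<^sub>3\<^sup>2)\<close> one finds
  pointwise \<open>f J f = \<Sum>\<^sub>k |\<nabla>u\<^sub>k - (u\<^sub>k / f) \<nabla>f|\<^sup>2 \<ge> 0\<close>, so stability forces this to vanish and \<open>u\<^sub>3 / f\<close>
  to be constant. This constant is \<open>0\<close>, because \<open>u\<^sub>3 = \<langle>N, \<partial>\<^sub>z\<rangle>\<close> vanishes where the coordinate \<open>x\<close> is
  maximal on the surface. Hence \<open>\<partial>\<^sub>z\<close> is tangent everywhere, which is impossible where \<open>z\<close> is
  maximal.\<close>

section \<open>Calculus of smooth functions\<close>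

text \<open>The \<open>u_k\<close> are Jacobi functions because left translations are isometries:
  they carry the surface through surfaces of the same mean curvature, and \<open>u_k\<close> is the
  normal speed. Instead of deforming the surface, the equation is checked as an algebraic identity
  between first derivatives of the immersion and of the normal. The obstacle is that the Laplacian
  of \<open>u_k\<close> involves second derivatives of the normal. Its gradient flux is therefore
  rewritten by Cayley-Hamilton for the shape operator, so that the divergence contains only an
  antisymmetrised derivative of that operator, which commuting partial derivatives (Codazzi) reduce
  to lower order; a polynomial identity in an adapted frame remains. In f J f the curvature terms
  cancel because f^2 is the sum of the u_k^2; what is left has a sign by Cauchy-Schwarz, whatever
  the values of H and the curvature. Passing from a vanishing integral to a pointwise statement
  needs an area measure that exists, is unique and finite, and charges every nonempty open
  set.\<close>

lemma Ck_on_cong: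
  assumes "open S" "\<And>x. x \<in> S \<Longrightarrow> f x = g x" "Ck_on k S f"
  shows "Ck_on k S g"
  using assms(2,3)
proof (induction k arbitrary: f g)
  case 0
  then show ?case by (simp cong: continuous_on_cong)
next
  case (Suc k)
  have "(g has_derivative frechet_derivative f (at x)) (at x)" if "x \<in> S" for x
    using that Suc.prems assms(1)
    by (auto intro: has_derivative_transform_within_open simp: frechet_derivative_works)
  then have "g differentiable (at x)" "frechet_derivative f (at x) = frechet_derivative g (at x)" if "x \<in> S" for x
    using that by (auto simp: differentiable_def frechet_derivative_at)
  with Suc.prems Suc.IH[of "\<lambda>x. frechet_derivative f (at x) v" "\<lambda>x. frechet_derivative g (at x) v" for v]
  show ?case by simp
qed

text \<open>Allows any explicit derivative in place of the one chosen by
  \<open>frechet_derivative\<close>, so that closure properties follow from the usual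
  differentiation rules.\<close>

lemma Ck_on_SucI:
  assumes "open S" "\<And>x. x \<in> S \<Longrightarrow> (f has_derivative f' x) (at x)" "\<And>v. Ck_on k S (\<lambda>x. f' x v)"
  shows "Ck_on (Suc k) S f"
proof -
  have "f' x = frechet_derivative f (at x)" if "x \<in> S" for x
    using assms(2)[OF that] by (rule frechet_derivative_at)
  then have "Ck_on k S (\<lambda>x. frechet_derivative f (at x) v)" for v
    by (intro Ck_on_cong[OF assms(1) _ assms(3)]) auto
  then show ?thesis using assms(2) by (auto simp: differentiable_def)
qed

text \<open>Not immediate, since the recursion constrains only the derivatives at higher orders: the
  loss of one order is pushed down to level 0, where differentiability gives continuity.\<close>

lemma Ck_on_SucD: "Ck_on (Suc k) S f \<Longrightarrow> Ck_on k S f"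
proof (induction k arbitrary: f)
  case 0
  then show ?case
    by (auto intro!: continuous_at_imp_continuous_on differentiable_imp_continuous_within)
next
  case (Suc k)
  then show ?case by simp
qed

lemma Ck_on_has_derivative:
  "Ck_on (Suc k) S f \<Longrightarrow> x \<in> S \<Longrightarrow> (f has_derivative frechet_derivative f (at x)) (at x)"
  by (simp add: frechet_derivative_works)

lemma Ck_on_const: "open S \<Longrightarrow> Ck_on k S (\<lambda>x. c)"
proof (induction k arbitrary: c)
  case (Suc k)
  show ?case by (rule Ck_on_SucI[OF Suc.prems has_derivative_const]) (use Suc in auto)
qed simp

lemma Ck_on_add: "open S \<Longrightarrow> Ck_on k S f \<Longrightarrow> Ck_on k S g \<Longrightarrow> Ck_on k S (\<lambda>x. f x + g x)"
proof (induction k arbitrary: f g)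
  case (Suc k)
  show ?case
    by (rule Ck_on_SucI[OF Suc.prems(1) has_derivative_add[OF Suc.prems(2,3)[THEN Ck_on_has_derivative]]])
      (use Suc in auto)
qed (simp add: continuous_on_add)

text \<open>The product rule leaves one factor undifferentiated in each summand;
  \<open>Ck_on_SucD\<close> supplies its order \<open>k\<close>.\<close>

lemma Ck_on_bilinear:
  assumes "bounded_bilinear h" "open S"
  shows "Ck_on k S f \<Longrightarrow> Ck_on k S g \<Longrightarrow> Ck_on k S (\<lambda>x. h (f x) (g x))"
proof (induction k arbitrary: f g)
  case 0
  then show ?case by (simp add: bounded_bilinear.continuous_on[OF assms(1)])
next
  case (Suc k)
  note p = Suc.prems
  show ?case
    by (rule Ck_on_SucI[OF assms(2) bounded_bilinear.FDERIV[OF assms(1) p[THEN Ck_on_has_derivative]]])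
      (use p Suc.IH p[THEN Ck_on_SucD] assms(2) in \<open>auto intro!: Ck_on_add\<close>)
qed

lemmas Ck_on_mult = Ck_on_bilinear[OF bounded_bilinear_mult]

lemma Ck_on_bounded_linear:
  "bounded_linear h \<Longrightarrow> open S \<Longrightarrow> Ck_on k S f \<Longrightarrow> Ck_on k S (\<lambda>x. h (f x))"
proof (induction k arbitrary: f)
  case (Suc k)
  show ?case
    by (rule Ck_on_SucI[OF Suc.prems(2)
          bounded_linear.has_derivative[OF Suc.prems(1) Ck_on_has_derivative[OF Suc.prems(3)]]])
      (use Suc in auto)
qed (simp add: bounded_linear.continuous_on)

text \<open>The derivative contains \<open>inverse (f x)\<close> again, so the induction is on the
  order for a fixed \<open>f\<close>.\<close>

lemma Ck_on_inverse:
  fixes f :: "_ \<Rightarrow> real"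
  assumes "open S" "\<And>x. x \<in> S \<Longrightarrow> f x \<noteq> 0"
  shows "Ck_on k S f \<Longrightarrow> Ck_on k S (\<lambda>x. inverse (f x))"
proof (induction k)
  case (Suc k)
  note d = Ck_on_has_derivative[OF Suc.prems]
  have i: "Ck_on k S (\<lambda>x. inverse (f x))" by (rule Suc.IH[OF Ck_on_SucD[OF Suc.prems]])
  show ?case
  proof (rule Ck_on_SucI[OF assms(1) Deriv.has_derivative_inverse[OF assms(2) d]])
    have "Ck_on k S (\<lambda>x. (- 1) * (inverse (f x) * frechet_derivative f (at x) v * inverse (f x)))" for v
      using Suc.prems by (intro Ck_on_mult Ck_on_const i assms) auto
    then show "Ck_on k S (\<lambda>x. - (inverse (f x) * frechet_derivative f (at x) v * inverse (f x)))" for v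
      by simp
  qed
qed (use assms in \<open>simp add: continuous_on_inverse\<close>)

lemma Ck_on_sqrt:
  fixes f :: "_ \<Rightarrow> real"
  assumes "open S" "\<And>x. x \<in> S \<Longrightarrow> f x > 0"
  shows "Ck_on k S f \<Longrightarrow> Ck_on k S (\<lambda>x. sqrt (f x))"
proof (induction k)
  case (Suc k)
  note d = Ck_on_has_derivative[OF Suc.prems]
  have i: "Ck_on k S (\<lambda>x. inverse (sqrt (f x)))"
    using assms by (intro Ck_on_inverse Suc.IH[OF Ck_on_SucD[OF Suc.prems]]) force+
  have d': "((\<lambda>x. sqrt (f x)) has_derivative (\<lambda>v. frechet_derivative f (at x) v * (inverse (sqrt (f x)) * (1/2)))) (at x)"
    if "x \<in> S" for x
    using that assms(2)[OF that] by (auto intro!: derivative_eq_intros d simp: field_simps)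
  show ?case
  proof (rule Ck_on_SucI[OF assms(1) d'])
    show "Ck_on k S (\<lambda>x. frechet_derivative f (at x) v * (inverse (sqrt (f x)) * (1/2)))" for v
      using Suc.prems by (intro Ck_on_mult Ck_on_const i assms(1)) auto
  qed
qed (simp add: continuous_on_real_sqrt)

lemma smooth_on_differentiable: "smooth_on S f \<Longrightarrow> x \<in> S \<Longrightarrow> f differentiable (at x)"
  unfolding smooth_on_def by (metis Ck_on.simps(2))

lemma smooth_on_continuous: "smooth_on S f \<Longrightarrow> continuous_on S f"
  unfolding smooth_on_def by (metis Ck_on.simps(1))

lemma smooth_on_frechet_derivative: "smooth_on S f \<Longrightarrow> smooth_on S (\<lambda>x. frechet_derivative f (at x) v)"
  unfolding smooth_on_def by (metis Ck_on.simps(2))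

lemma smooth_on_partial: "smooth_on S f \<Longrightarrow> smooth_on S (partial i f)"
  unfolding partial_def[abs_def] by (rule smooth_on_frechet_derivative)

lemma smooth_on_cong:
  "open S \<Longrightarrow> (\<And>x. x \<in> S \<Longrightarrow> f x = g x) \<Longrightarrow> smooth_on S f \<Longrightarrow> smooth_on S g"
  unfolding smooth_on_def using Ck_on_cong by blast

lemma smooth_on_bounded_linear:
  "bounded_linear h \<Longrightarrow> open S \<Longrightarrow> smooth_on S f \<Longrightarrow> smooth_on S (\<lambda>x. h (f x))"
  unfolding smooth_on_def using Ck_on_bounded_linear by blast

lemma smooth_on_vec_nth: "open S \<Longrightarrow> smooth_on S f \<Longrightarrow> smooth_on S (\<lambda>x. f x $ i)"
  by (rule smooth_on_bounded_linear[OF bounded_linear_vec_nth])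

lemma smooth_on_const: "open S \<Longrightarrow> smooth_on S (\<lambda>x. c)"
  unfolding smooth_on_def by (simp add: Ck_on_const)

lemma smooth_on_add: "open S \<Longrightarrow> smooth_on S f \<Longrightarrow> smooth_on S g \<Longrightarrow> smooth_on S (\<lambda>x. f x + g x)"
  unfolding smooth_on_def by (simp add: Ck_on_add)

lemma smooth_on_bilinear:
  "bounded_bilinear h \<Longrightarrow> open S \<Longrightarrow> smooth_on S f \<Longrightarrow> smooth_on S g \<Longrightarrow> smooth_on S (\<lambda>x. h (f x) (g x))"
  unfolding smooth_on_def by (simp add: Ck_on_bilinear)

lemmas smooth_on_mult = smooth_on_bilinear[OF bounded_bilinear_mult]
lemmas smooth_on_inner = smooth_on_bilinear[OF bounded_bilinear_inner]
lemmas smooth_on_uminus = smooth_on_bounded_linear[OF bounded_linear_minus[OF bounded_linear_ident]]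

lemma smooth_on_inverse:
  fixes f :: "_ \<Rightarrow> real"
  shows "open S \<Longrightarrow> smooth_on S f \<Longrightarrow> (\<And>x. x \<in> S \<Longrightarrow> f x \<noteq> 0) \<Longrightarrow> smooth_on S (\<lambda>x. inverse (f x))"
  unfolding smooth_on_def using Ck_on_inverse by blast

lemma smooth_on_diff:
  "open S \<Longrightarrow> smooth_on S f \<Longrightarrow> smooth_on S g \<Longrightarrow> smooth_on S (\<lambda>x. f x - g x)"
  using smooth_on_add[OF _ _ smooth_on_uminus] by fastforce

lemma smooth_on_sqrt:
  fixes f :: "_ \<Rightarrow> real"
  shows "open S \<Longrightarrow> smooth_on S f \<Longrightarrow> (\<And>x. x \<in> S \<Longrightarrow> f x > 0) \<Longrightarrow> smooth_on S (\<lambda>x. sqrt (f x))"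
  unfolding smooth_on_def using Ck_on_sqrt by blast

section \<open>Symmetry of second derivatives\<close>

text \<open>The mean value theorem is applied along \<open>u\<close> to the increment of
  \<open>f\<close> over the step \<open>h\<close> times \<open>v\<close>, then along
  \<open>v\<close> to the derivative in direction \<open>u\<close>.\<close>

lemma second_difference_mean_value:
  fixes f :: "'a::real_normed_vector \<Rightarrow> real"
  assumes S: "ball x d \<subseteq> S" and f: "\<And>y. y \<in> S \<Longrightarrow> f differentiable (at y)"
    and f2: "\<And>y. y \<in> S \<Longrightarrow> (\<lambda>y. frechet_derivative f (at y) u) differentiable (at y)"
    and h: "h > 0" "h * (norm u + norm v) < d"
  obtains y where "y \<in> ball x d"
    "f (x + h *\<^sub>R u + h *\<^sub>R v) - f (x + h *\<^sub>R u) - f (x + h *\<^sub>R v) + f x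
      = h\<^sup>2 * frechet_derivative (\<lambda>y. frechet_derivative f (at y) u) (at y) v"
proof -
  let ?D = "\<lambda>y. frechet_derivative f (at y) u"
  let ?p = "\<lambda>a b. x + a *\<^sub>R u + b *\<^sub>R v"
  have in_ball: "?p a b \<in> ball x d" if "0 \<le> a" "a \<le> h" "0 \<le> b" "b \<le> h" for a b
  proof -
    have "norm (a *\<^sub>R u + b *\<^sub>R v) \<le> norm (a *\<^sub>R u) + norm (b *\<^sub>R v)" by (rule norm_triangle_ineq)
    also have "\<dots> \<le> h * norm u + h * norm v"
      using that by (auto intro!: add_mono mult_right_mono)
    finally have n: "norm (a *\<^sub>R u + b *\<^sub>R v) < d" using h(2) by (simp add: ring_distribs)
    have "dist x (?p a b) = norm (a *\<^sub>R u + b *\<^sub>R v)"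
      unfolding dist_norm by (metis add.assoc add_diff_cancel_left' norm_minus_commute)
    with n show ?thesis by simp
  qed
  then have in_S: "?p a b \<in> S" if "0 \<le> a" "a \<le> h" "0 \<le> b" "b \<le> h" for a b
    using that S by blast
  have d1: "((\<lambda>a. f (?p a b)) has_real_derivative ?D (?p a b)) (at a)"
    if "0 \<le> a" "a \<le> h" "0 \<le> b" "b \<le> h" for a b
  proof -
    have F: "(f has_derivative frechet_derivative f (at (?p a b))) (at (?p a b))"
      using f[OF in_S[OF that]] by (simp add: frechet_derivative_works)
    have "((\<lambda>a. ?p a b) has_derivative (\<lambda>s. s *\<^sub>R u)) (at a)"
      by (auto intro!: derivative_eq_intros)
    note C = has_derivative_compose[OF this F]
    have "(\<lambda>s. frechet_derivative f (at (?p a b)) (s *\<^sub>R u)) = (*) (frechet_derivative f (at (?p a b)) u)"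
      using linear_frechet_derivative[OF f[OF in_S[OF that]]] by (simp add: fun_eq_iff linear_cmul)
    with C show ?thesis unfolding has_field_derivative_def by simp
  qed
  have d2: "((\<lambda>b. ?D (?p a b)) has_real_derivative frechet_derivative ?D (at (?p a b)) v) (at b)"
    if "0 \<le> a" "a \<le> h" "0 \<le> b" "b \<le> h" for a b
  proof -
    have F: "(?D has_derivative frechet_derivative ?D (at (?p a b))) (at (?p a b))"
      using f2[OF in_S[OF that]] by (simp add: frechet_derivative_works)
    have "((\<lambda>b. ?p a b) has_derivative (\<lambda>s. s *\<^sub>R v)) (at b)"
      by (auto intro!: derivative_eq_intros)
    note C = has_derivative_compose[OF this F]
    have "(\<lambda>s. frechet_derivative ?D (at (?p a b)) (s *\<^sub>R v)) = (*) (frechet_derivative ?D (at (?p a b)) v)"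
      using linear_frechet_derivative[OF f2[OF in_S[OF that]]] by (simp add: fun_eq_iff linear_cmul)
    with C show ?thesis unfolding has_field_derivative_def by simp
  qed
  have "\<exists>a>0. a < h \<and> (f (?p h h) - f (?p h 0)) - (f (?p 0 h) - f (?p 0 0)) = (h - 0) * (?D (?p a h) - ?D (?p a 0))"
    by (rule MVT2) (use h in \<open>auto intro!: DERIV_diff d1 d1[of _ 0, simplified]\<close>)
  then obtain a where a: "a > 0" "a < h"
    "(f (?p h h) - f (?p h 0)) - (f (?p 0 h) - f (?p 0 0)) = h * (?D (?p a h) - ?D (?p a 0))" by auto
  have "\<exists>b>0. b < h \<and> ?D (?p a h) - ?D (?p a 0) = (h - 0) * frechet_derivative ?D (at (?p a b)) v"
    by (rule MVT2) (use h a d2 in auto)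
  then obtain b where b: "b > 0" "b < h"
    "?D (?p a h) - ?D (?p a 0) = h * frechet_derivative ?D (at (?p a b)) v" by auto
  show ?thesis
    by (rule that[of "?p a b"]) (use in_ball a b in \<open>auto simp: power2_eq_square algebra_simps\<close>)
qed

text \<open>The second difference is symmetric in \<open>u\<close> and \<open>v\<close>, so the two
  mixed derivatives take a common value at two points arbitrarily close to \<open>x\<close>; their
  continuity carries this over to \<open>x\<close>.\<close>

lemma smooth_on_mixed_derivatives:
  fixes f :: "'a::real_normed_vector \<Rightarrow> real"
  assumes S: "open S" "x \<in> S" and f: "smooth_on S f"
  shows "frechet_derivative (\<lambda>y. frechet_derivative f (at y) u) (at x) v
    = frechet_derivative (\<lambda>y. frechet_derivative f (at y) v) (at x) u"
proof -
  let ?A = "\<lambda>u v x. frechet_derivative (\<lambda>y. frechet_derivative f (at y) u) (at x) v"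
  note f1 = smooth_on_frechet_derivative[OF f]
  have cont: "isCont (?A u v) x" for u v
    using smooth_on_continuous[OF smooth_on_frechet_derivative[OF f1], of u v] S
    by (simp add: continuous_on_eq_continuous_at)
  have le: "dist (?A u v x) (?A v u x) \<le> e" if e: "e > 0" for e
  proof -
    obtain d0 where d0: "d0 > 0" "ball x d0 \<subseteq> S" using openE[OF S] .
    obtain d1 where d1: "d1 > 0" "\<And>y. dist y x < d1 \<Longrightarrow> dist (?A u v y) (?A u v x) < e/2"
      using cont[of u v, unfolded continuous_at_eps_delta, rule_format, OF half_gt_zero[OF e]] by blast
    obtain d2 where d2: "d2 > 0" "\<And>y. dist y x < d2 \<Longrightarrow> dist (?A v u y) (?A v u x) < e/2"
      using cont[of v u, unfolded continuous_at_eps_delta, rule_format, OF half_gt_zero[OF e]] by blast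
    define d where "d = min d0 (min d1 d2)"
    have d: "d > 0" "ball x d \<subseteq> S" using d0 d1 d2 by (auto simp: d_def)
    \<comment> \<open>The summand 1 keeps the denominator positive when both directions
      vanish.\<close>
    define h where "h = d / (2 * (norm u + norm v + 1))"
    have n: "norm u + norm v + 1 > 0" using norm_ge_zero[of u] norm_ge_zero[of v] by linarith
    have h: "h > 0" using d n by (simp add: h_def)
    have "h * (norm u + norm v) < h * (2 * (norm u + norm v + 1))" using h n by (intro mult_strict_left_mono) auto
    also have "\<dots> = d" using n by (simp add: h_def)
    finally have hd: "h * (norm u + norm v) < d" .
    obtain y where y: "y \<in> ball x d"
      "f (x + h *\<^sub>R u + h *\<^sub>R v) - f (x + h *\<^sub>R u) - f (x + h *\<^sub>R v) + f x = h\<^sup>2 * ?A u v y"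
      using second_difference_mean_value[OF d(2) smooth_on_differentiable[OF f]
          smooth_on_differentiable[OF f1] h hd] .
    obtain z where z: "z \<in> ball x d"
      "f (x + h *\<^sub>R v + h *\<^sub>R u) - f (x + h *\<^sub>R v) - f (x + h *\<^sub>R u) + f x = h\<^sup>2 * ?A v u z"
      using second_difference_mean_value[OF d(2) smooth_on_differentiable[OF f]
          smooth_on_differentiable[OF f1] h hd[unfolded add.commute[of "norm u"]]] .
    have swap: "x + h *\<^sub>R u + h *\<^sub>R v = x + h *\<^sub>R v + h *\<^sub>R u" by (simp only: add_ac)
    from y(2)[unfolded swap] z(2) have "h\<^sup>2 * ?A u v y = h\<^sup>2 * ?A v u z" by linarith
    moreover have "h\<^sup>2 \<noteq> 0" using h by simp
    ultimately have eq: "?A u v y = ?A v u z" by (rule mult_left_cancel[THEN iffD1, rotated])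
    have "dist (?A u v y) (?A u v x) < e/2" by (rule d1(2)) (use y in \<open>simp add: d_def dist_commute\<close>)
    moreover have "dist (?A v u z) (?A v u x) < e/2" by (rule d2(2)) (use z in \<open>simp add: d_def dist_commute\<close>)
    ultimately have "dist (?A u v x) (?A v u x) < e"
      unfolding eq by (rule dist_triangle_half_r)
    then show ?thesis by simp
  qed
  have "dist (?A u v x) (?A v u x) \<le> 0"
  proof (rule field_le_epsilon)
    show "dist (?A u v x) (?A v u x) \<le> 0 + e" if "e > 0" for e
      unfolding add_0 using that by (rule le)
  qed
  then show ?thesis by simp
qed

section \<open>Rules for partial derivatives\<close>

lemma partial_eq: "(f has_derivative f') (at x) \<Longrightarrow> partial i f x = f' (axis i 1)"
  unfolding partial_def by (metis frechet_derivative_at)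

text \<open>\<open>frechet_derivative\<close> is a choice among all derivatives, so functions that
  agree near \<open>x\<close> get the same value even where no derivative exists.\<close>

lemma partial_cong:
  assumes "open S" "x \<in> S" "\<And>y. y \<in> S \<Longrightarrow> f y = g y"
  shows "partial i f x = partial i g x"
proof -
  have "(f has_derivative D) (at x) \<longleftrightarrow> (g has_derivative D) (at x)" for D
    using assms has_derivative_transform_within_open[of f D x UNIV S g]
      has_derivative_transform_within_open[of g D x UNIV S f] by auto
  then show ?thesis unfolding partial_def frechet_derivative_def by simp
qed

lemma partial_const: "partial i (\<lambda>x. c) x = 0"
  by (rule partial_eq[OF has_derivative_const])

lemma partial_add:
  assumes "f differentiable (at x)" "g differentiable (at x)"
  shows "partial i (\<lambda>x. f x + g x) x = partial i f x + partial i g x"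
  using partial_eq[OF has_derivative_add[OF assms[unfolded frechet_derivative_works]]]
  by (simp add: partial_def)

lemma partial_linear:
  assumes "bounded_linear h" "f differentiable (at x)"
  shows "partial i (\<lambda>x. h (f x)) x = h (partial i f x)"
  using partial_eq[OF bounded_linear.has_derivative[OF assms(1) assms(2)[unfolded frechet_derivative_works]]]
  by (simp add: partial_def)

lemma partial_bilinear:
  assumes "bounded_bilinear h" "f differentiable (at x)" "g differentiable (at x)"
  shows "partial i (\<lambda>x. h (f x) (g x)) x = h (partial i f x) (g x) + h (f x) (partial i g x)"
  using partial_eq[OF bounded_bilinear.FDERIV[OF assms(1) assms(2,3)[unfolded frechet_derivative_works]]]
  by (simp add: partial_def add.commute)

lemmas partial_uminus = partial_linear[OF bounded_linear_minus[OF bounded_linear_ident]]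
lemmas partial_mult = partial_bilinear[OF bounded_bilinear_mult]
lemmas partial_inner = partial_bilinear[OF bounded_bilinear_inner]
lemmas partial_vec_nth = partial_linear[OF bounded_linear_vec_nth]

lemma partial_diff:
  assumes "f differentiable (at x)" "g differentiable (at x)"
  shows "partial i (\<lambda>x. f x - g x) x = partial i f x - partial i g x"
  using partial_eq[OF has_derivative_diff[OF assms[unfolded frechet_derivative_works]]]
  by (simp add: partial_def)

lemma smooth_on_partial_commute:
  fixes f :: "real^'n \<Rightarrow> real^'m"
  assumes "open S" "x \<in> S" "smooth_on S f"
  shows "partial i (partial j f) x = partial j (partial i f) x"
proof -
  have "partial i (partial j f) x $ k = partial i (partial j (\<lambda>x. f x $ k)) x" for i j k
  proof -
    have "partial i (partial j f) x $ k = partial i (\<lambda>x. partial j f x $ k) x"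
      using assms by (intro partial_vec_nth[symmetric] smooth_on_differentiable smooth_on_partial)
    also have "\<dots> = partial i (partial j (\<lambda>x. f x $ k)) x"
      by (rule partial_cong[OF assms(1,2)])
        (use assms in \<open>intro partial_vec_nth[symmetric] smooth_on_differentiable\<close>)
    finally show ?thesis .
  qed
  moreover have "partial i (partial j (\<lambda>x. f x $ k)) x = partial j (partial i (\<lambda>x. f x $ k)) x" for k
    unfolding partial_def[abs_def]
    by (rule smooth_on_mixed_derivatives[OF assms(1,2) smooth_on_vec_nth[OF assms(1,3)]])
  ultimately show ?thesis by (simp add: vec_eq_iff)
qed

section \<open>The left-invariant frame and the algebra of the Jacobi equation\<close>

text \<open>In the left-invariant frame of the Heisenberg group the Levi-Civita connection is the derivative of
  the components plus this bilinear map.\<close>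

definition nil3_gamma :: "real \<Rightarrow> real^3 \<Rightarrow> real^3 \<Rightarrow> real^3" where
  "nil3_gamma t X Y = t *\<^sub>R vector [X$2 * Y$3 + X$3 * Y$2, - (X$1 * Y$3 + X$3 * Y$1), X$1 * Y$2 - X$2 * Y$1]"

lemma nil3_gamma_nth [simp]:
  "nil3_gamma t X Y $ 1 = t * (X$2 * Y$3 + X$3 * Y$2)"
  "nil3_gamma t X Y $ 2 = - (t * (X$1 * Y$3 + X$3 * Y$1))"
  "nil3_gamma t X Y $ 3 = t * (X$1 * Y$2 - X$2 * Y$1)"
  by (simp_all add: nil3_gamma_def algebra_simps)

text \<open>Every plane contains a horizontal unit vector \<open>(x, y, 0)\<close>; with the normal \<open>n\<close> below, the unit
  vector \<open>(- z y, z x, - w)\<close> completes it to an oriented orthonormal frame.\<close>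

lemma horizontal_tangent_frame:
  fixes n :: "real^3"
  assumes "n \<bullet> n = 1"
  obtains x y w z where "x\<^sup>2 + y\<^sup>2 = 1" "w\<^sup>2 + z\<^sup>2 = 1" "n = vector [- y * w, x * w, z]"
proof (cases "(n$1)\<^sup>2 + (n$2)\<^sup>2 = 0")
  \<comment> \<open>The normal is vertical, every tangent vector is horizontal, and any direction
    may be chosen.\<close>
  case True
  then have "n$1 = 0" "n$2 = 0" by (simp_all add: sum_power2_eq_zero_iff)
  with assms have "(n$3)\<^sup>2 = 1" by (simp add: inner_vec_def sum_3 power2_eq_square)
  with \<open>n$1 = 0\<close> \<open>n$2 = 0\<close> show ?thesis
    by (intro that[of 1 0 0 "n$3"]) (simp_all add: vec_eq_iff forall_3)
next
  case False
  define w where "w = sqrt ((n$1)\<^sup>2 + (n$2)\<^sup>2)"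
  have w2: "w\<^sup>2 = (n$1)\<^sup>2 + (n$2)\<^sup>2" by (simp add: w_def)
  have "w \<noteq> 0" using False by (simp add: w_def)
  show ?thesis
  \<comment> \<open>The horizontal part of \<open>n\<close>, rotated by a quarter turn and
    normalised, is the horizontal tangent vector.\<close>
  proof (rule that[of "n$2 / w" "- n$1 / w" w "n$3"])
    have "(n$2 / w)\<^sup>2 + (- n$1 / w)\<^sup>2 = ((n$2)\<^sup>2 + (n$1)\<^sup>2) / w\<^sup>2"
      by (simp only: power_divide power2_minus add_divide_distrib)
    also have "(n$2)\<^sup>2 + (n$1)\<^sup>2 = w\<^sup>2" unfolding w2 by (rule add.commute)
    finally show "(n$2 / w)\<^sup>2 + (- n$1 / w)\<^sup>2 = 1" using \<open>w \<noteq> 0\<close> by simp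
    show "w\<^sup>2 + (n$3)\<^sup>2 = 1"
      using assms w2 by (simp add: inner_vec_def sum_3 power2_eq_square)
    show "n = vector [- (- n$1 / w) * w, n$2 / w * w, n$3]"
      using \<open>w \<noteq> 0\<close> by (simp add: vec_eq_iff forall_3)
  qed
qed

text \<open>\<open>b\<close> and \<open>c\<close> are the inner products of \<open>a\<close> with
  the tangent unit vectors \<open>(x, y, 0)\<close> and \<open>(- z y, z x, - w)\<close>. Each
  component is verified by writing the error as an explicit combination of
  \<open>n \<bullet> a\<close> and the two circle relations.\<close>

lemma tangent_expansion:
  fixes n a :: "real^3"
  assumes "x\<^sup>2 + y\<^sup>2 = 1" "w\<^sup>2 + z\<^sup>2 = 1" "n = vector [- y * w, x * w, z]" "n \<bullet> a = 0"
  obtains b c where "a = vector [b * x - c * z * y, b * y + c * z * x, - c * w]"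
proof
  define b where "b = x * a$1 + y * a$2"
  define c where "c = - z * y * a$1 + z * x * a$2 - w * a$3"
  have 0: "- y * w * a$1 + x * w * a$2 + z * a$3 = 0"
    using assms(3,4) by (simp add: inner_vec_def sum_3)
  let ?h = "- y * w * a$1 + x * w * a$2 + z * a$3"
  have "b * x - c * z * y = a$1 + w * y * ?h + (x\<^sup>2 + y\<^sup>2 - 1) * a$1
      + (w\<^sup>2 + z\<^sup>2 - 1) * (y\<^sup>2 * a$1 - x * y * a$2)"
    unfolding b_def c_def by (simp add: algebra_simps power2_eq_square)
  then have "a$1 = b * x - c * z * y" unfolding 0 assms(1,2) by simp
  moreover have "b * y + c * z * x = a$2 - w * x * ?h + (x\<^sup>2 + y\<^sup>2 - 1) * a$2
      + (w\<^sup>2 + z\<^sup>2 - 1) * (x\<^sup>2 * a$2 - x * y * a$1)"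
    unfolding b_def c_def by (simp add: algebra_simps power2_eq_square)
  then have "a$2 = b * y + c * z * x" unfolding 0 assms(1,2) by simp
  moreover have "- c * w = a$3 - z * ?h + (w\<^sup>2 + z\<^sup>2 - 1) * a$3"
    unfolding b_def c_def by (simp add: algebra_simps power2_eq_square)
  then have "a$3 = - c * w" unfolding 0 assms(1,2) by simp
  ultimately show "a = vector [b * x - c * z * y, b * y + c * z * x, - c * w]"
    by (simp add: vec_eq_iff forall_3)
qed

section \<open>Frame components and Killing fields\<close>

text \<open>Components in the left-invariant orthonormal frame. The third one is the contact form
  applied to \<open>v\<close>, so \<open>nil3_metric\<close> becomes the Euclidean inner
  product.\<close>

definition nil3_frame :: "real \<Rightarrow> real^3 \<Rightarrow> real^3 \<Rightarrow> real^3" where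
  "nil3_frame t p v = vector [v$1, v$2, v$3 + t * (p$2 * v$1 - p$1 * v$2)]"

lemma nil3_frame_nth [simp]:
  "nil3_frame t p v $ 1 = v$1" "nil3_frame t p v $ 2 = v$2"
  "nil3_frame t p v $ 3 = v$3 + t * (p$2 * v$1 - p$1 * v$2)"
  by (simp_all add: nil3_frame_def)

text \<open>The frame components of the Killing fields \<open>\<partial>\<^sub>x + t y \<partial>\<^sub>z\<close>, \<open>\<partial>\<^sub>y - t x \<partial>\<^sub>z\<close> and \<open>\<partial>\<^sub>z\<close>.\<close>

definition killing :: "real \<Rightarrow> 3 \<Rightarrow> real^3 \<Rightarrow> real^3" where
  "killing t k p = (if k = 1 then vector [1, 0, 2 * t * p$2]
    else if k = 2 then vector [0, 1, - 2 * t * p$1] else vector [0, 0, 1])"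

text \<open>The derivative of the frame components of a Killing field. In the slope
  \<open>2 * t\<close> one \<open>t\<close> comes from the coordinate field and one from the contact
  form.\<close>

definition killing_lin :: "real \<Rightarrow> 3 \<Rightarrow> real^3 \<Rightarrow> real^3" where
  "killing_lin t k v = (if k = 1 then vector [0, 0, 2 * t * v$2]
    else if k = 2 then vector [0, 0, - 2 * t * v$1] else 0)"

lemma killing_affine: "killing t k p = killing t k 0 + killing_lin t k p"
  by (simp add: killing_def killing_lin_def vec_eq_iff forall_3)

lemma bounded_linear_killing_lin: "bounded_linear (killing_lin t k)"
  unfolding linear_conv_bounded_linear[symmetric]
  by (rule linearI) (simp_all add: killing_lin_def vec_eq_iff forall_3 algebra_simps)

text \<open>Only the horizontal components enter, and these are the same in coordinates and in the
  frame.\<close>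

lemma killing_lin_frame: "killing_lin t k (nil3_frame t p v) = killing_lin t k v"
  by (simp add: killing_lin_def)

text \<open>At a point of a surface, \<open>a1\<close> and \<open>a2\<close> are the frame components of the coordinate fields,
  \<open>n\<close> those of the unit normal, \<open>n1\<close> and \<open>n2\<close> its partial derivatives, \<open>s1\<close> and \<open>s2\<close> the values of
  the shape operator, and \<open>c\<close> is \<open>\<partial>\<^sub>1 a2 - \<partial>\<^sub>2 a1\<close>. Up to the sign of \<open>n \<bullet> cross3 a1 a2\<close>, \<open>T1, T2\<close> are
  the contravariant components of \<open>sqrt (det g)\<close> times the coordinate frame, and \<open>F1, F2\<close> those of
  \<open>sqrt (det g)\<close> times the gradient of \<open>n\<close>. Their divergences \<open>dT\<close> and \<open>dF\<close> contain no second derivative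
  of \<open>n\<close>: these occur only in \<open>\<partial>\<^sub>1 s2 - \<partial>\<^sub>2 s1\<close>, where they cancel and leave \<open>ds\<close>.\<close>

locale nil3_jet =
  fixes t H2 :: real and n a1 a2 s1 s2 :: "real^3"
  assumes unit: "n \<bullet> n = 1"
    and perp: "n \<bullet> a1 = 0" "n \<bullet> a2 = 0" "n \<bullet> s1 = 0" "n \<bullet> s2 = 0"
    and sym: "s1 \<bullet> a2 = s2 \<bullet> a1"
    and indep: "n \<bullet> cross3 a1 a2 \<noteq> 0"
    and tr: "H2 * (n \<bullet> cross3 a1 a2) = n \<bullet> (cross3 s1 a2 + cross3 a1 s2)"
begin

definition "n1 = - (s1 + nil3_gamma t a1 n)"
definition "n2 = - (s2 + nil3_gamma t a2 n)"
definition "c = vector [0, 0, - 2 * t * cross3 a1 a2 $ 3]"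
definition "T1 = cross3 a2 n"
definition "T2 = - cross3 a1 n"
text \<open>With S the shape operator, the gradient flux of \<open>n\<close> is - S T - gamma(T, n).
  As S is symmetric on a plane, Cayley-Hamilton gives - S (v x n) = (S v) x n - tr(S) (v x n) for
  tangent v; this is the origin of the terms with \<open>s2\<close> and \<open>H2\<close>. In this
  form the divergence meets derivatives of S only through \<open>ds\<close>.\<close>

definition "F1 = cross3 s2 n - H2 *\<^sub>R T1 - nil3_gamma t T1 n"
definition "F2 = - cross3 s1 n - H2 *\<^sub>R T2 - nil3_gamma t T2 n"
definition "dT = cross3 c n + cross3 a2 n1 - cross3 a1 n2"
definition "ds = - (nil3_gamma t c n + nil3_gamma t a2 n1 - nil3_gamma t a1 n2)"
definition "dF = cross3 ds n + cross3 s2 n1 - cross3 s1 n2 - H2 *\<^sub>R dT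
  - nil3_gamma t dT n - nil3_gamma t T1 n1 - nil3_gamma t T2 n2"
text \<open>The Jacobi operator applied componentwise to \<open>n\<close>, times the area density up
  to sign: the potential is |A|^2 + Ric(N, N) with |A|^2 = tr(A)^2 - 2 det(A).\<close>

definition "R = dF + ((n \<bullet> cross3 a1 a2) * (H2\<^sup>2 - 2 * t\<^sup>2 + 4 * t\<^sup>2 * (n$3)\<^sup>2) - 2 * (n \<bullet> cross3 s1 s2)) *\<^sub>R n"

text \<open>Solves all constraints of the locale by free parameters: \<open>b1, c1, b2, c2\<close>
  are the coordinates of the tangent vectors in the adapted orthonormal frame, and
  \<open>p, q, r\<close> the entries of the symmetric matrix of the shape operator there. Identities
  then become polynomial modulo two circle relations.\<close>

lemma adapted_coordinates:
  obtains x y w z b1 b2 c1 c2 p q r where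
    "x\<^sup>2 + y\<^sup>2 = 1" "w\<^sup>2 + z\<^sup>2 = 1" "n = vector [- y * w, x * w, z]"
    "a1 = vector [b1 * x - c1 * z * y, b1 * y + c1 * z * x, - c1 * w]"
    "a2 = vector [b2 * x - c2 * z * y, b2 * y + c2 * z * x, - c2 * w]"
    "s1 = vector [(b1 * p + c1 * q) * x - (b1 * q + c1 * r) * z * y,
                  (b1 * p + c1 * q) * y + (b1 * q + c1 * r) * z * x, - (b1 * q + c1 * r) * w]"
    "s2 = vector [(b2 * p + c2 * q) * x - (b2 * q + c2 * r) * z * y,
                  (b2 * p + c2 * q) * y + (b2 * q + c2 * r) * z * x, - (b2 * q + c2 * r) * w]"
    "H2 = p + r"
proof -
  obtain x y w z where f: "x\<^sup>2 + y\<^sup>2 = 1" "w\<^sup>2 + z\<^sup>2 = 1" "n = vector [- y * w, x * w, z]"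
    using horizontal_tangent_frame[OF unit] by blast
  obtain b1 c1 where a1: "a1 = vector [b1 * x - c1 * z * y, b1 * y + c1 * z * x, - c1 * w]"
    using tangent_expansion[OF f perp(1)] .
  obtain b2 c2 where a2: "a2 = vector [b2 * x - c2 * z * y, b2 * y + c2 * z * x, - c2 * w]"
    using tangent_expansion[OF f perp(2)] .
  obtain d1 e1 where s1: "s1 = vector [d1 * x - e1 * z * y, d1 * y + e1 * z * x, - e1 * w]"
    using tangent_expansion[OF f perp(3)] .
  obtain d2 e2 where s2: "s2 = vector [d2 * x - e2 * z * y, d2 * y + e2 * z * x, - e2 * w]"
    using tangent_expansion[OF f perp(4)] .
  \<comment> \<open>Used as rewrite rules, these eliminate the squares of \<open>y\<close> and
    \<open>z\<close> and so give normal forms modulo the circle relations; the nested versions act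
    inside reassociated products.\<close>
  have red: "y * y = 1 - x * x" "z * z = 1 - w * w"
    using f(1,2) by (simp_all add: power2_eq_square algebra_simps)
  have red': "y * (y * u) = u - x * (x * u)" "z * (z * u) = u - w * (w * u)" for u
    using red by (simp_all add: left_diff_distrib flip: mult.assoc)
  have dot: "vector [b * x - c * z * y, b * y + c * z * x, - c * w] \<bullet>
      (vector [b' * x - c' * z * y, b' * y + c' * z * x, - c' * w] :: real^3) = b * b' + c * c'" for b c b' c'
    by (simp add: inner_vec_def sum_3 algebra_simps red red')
  have trip: "n \<bullet> cross3 (vector [b * x - c * z * y, b * y + c * z * x, - c * w])
      (vector [b' * x - c' * z * y, b' * y + c' * z * x, - c' * w]) = b * c' - c * b'" for b c b' c'
    unfolding f(3) by (simp add: inner_vec_def sum_3 cross_components algebra_simps red red')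
  have sy: "d1 * b2 + e1 * c2 = d2 * b1 + e2 * c1"
    using sym unfolding a1 a2 s1 s2 dot .
  define D where "D = b1 * c2 - c1 * b2"
  have D: "D \<noteq> 0" using indep unfolding a1 a2 trip D_def .
  have HD: "H2 * D = d1 * c2 - e1 * b2 + b1 * e2 - c1 * d2"
    using tr unfolding a1 a2 s1 s2 inner_add_right trip D_def by simp
  \<comment> \<open>Cramer's rule for the linear systems that express \<open>s1\<close>,
    \<open>s2\<close> through \<open>a1\<close>, \<open>a2\<close>.\<close>
  define p where "p = (c2 * d1 - c1 * d2) / D"
  define q where "q = (c2 * e1 - c1 * e2) / D"
  define r where "r = (b1 * e2 - b2 * e1) / D"
  have pD: "p * D = c2 * d1 - c1 * d2" and qD: "q * D = c2 * e1 - c1 * e2"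
    and rD: "r * D = b1 * e2 - b2 * e1" using D by (simp_all add: p_def q_def r_def)
  \<comment> \<open>The off-diagonal entry can be computed from either system; symmetry of the shape
    operator makes the results agree.\<close>
  have qD': "q * D = b1 * d2 - b2 * d1" using qD sy by (simp add: algebra_simps)
  have "d1 * D = (b1 * p + c1 * q) * D"
    unfolding ring_distribs mult.assoc pD qD' unfolding D_def by (simp add: algebra_simps)
  then have d1: "d1 = b1 * p + c1 * q" using D by simp
  have "d2 * D = (b2 * p + c2 * q) * D"
    unfolding ring_distribs mult.assoc pD qD' unfolding D_def by (simp add: algebra_simps)
  then have d2: "d2 = b2 * p + c2 * q" using D by simp
  have "e1 * D = (b1 * q + c1 * r) * D"
    unfolding ring_distribs mult.assoc rD qD unfolding D_def by (simp add: algebra_simps)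
  then have e1: "e1 = b1 * q + c1 * r" using D by simp
  have "e2 * D = (b2 * q + c2 * r) * D"
    unfolding ring_distribs mult.assoc rD qD unfolding D_def by (simp add: algebra_simps)
  then have e2: "e2 = b2 * q + c2 * r" using D by simp
  have "H2 * D = (p + r) * D" unfolding HD ring_distribs pD rD by (simp add: algebra_simps)
  then have "H2 = p + r" using D by simp
  with f a1 a2 s1[unfolded d1 e1] s2[unfolded d2 e2] show thesis by (intro that)
qed

lemmas jet_defs = R_def dF_def ds_def dT_def F1_def F2_def T1_def T2_def c_def n1_def n2_def

text \<open>The vertical Killing field has constant frame components, so its identity is bare; the
  horizontal ones pick up the derivatives of theirs. The flux and conormal identities say that
  contraction with the cofactors of the metric, applied to the derivatives of \<open>n\<close> or to
  the coordinate fields, gives the signed density times \<open>F1, F2\<close> or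
  \<open>T1, T2\<close>.\<close>

lemma vertical_identity:
    "R $ 3 = 0"
  and horizontal_identity1:
    "R $ 1 + killing_lin t 1 a1 \<bullet> F1 + killing_lin t 1 a2 \<bullet> F2
      + killing_lin t 1 dT \<bullet> n + killing_lin t 1 T1 \<bullet> n1 + killing_lin t 1 T2 \<bullet> n2 = 0"
  and horizontal_identity2:
    "R $ 2 + killing_lin t 2 a1 \<bullet> F1 + killing_lin t 2 a2 \<bullet> F2
      + killing_lin t 2 dT \<bullet> n + killing_lin t 2 T1 \<bullet> n1 + killing_lin t 2 T2 \<bullet> n2 = 0"
  and flux_identity1:
    "(a2 \<bullet> a2) *\<^sub>R n1 - (a1 \<bullet> a2) *\<^sub>R n2 = (n \<bullet> cross3 a1 a2) *\<^sub>R F1"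
  and flux_identity2:
    "(a1 \<bullet> a1) *\<^sub>R n2 - (a1 \<bullet> a2) *\<^sub>R n1 = (n \<bullet> cross3 a1 a2) *\<^sub>R F2"
  and conormal_identity1:
    "(a2 \<bullet> a2) *\<^sub>R a1 - (a1 \<bullet> a2) *\<^sub>R a2 = (n \<bullet> cross3 a1 a2) *\<^sub>R T1"
  and conormal_identity2:
    "(a1 \<bullet> a1) *\<^sub>R a2 - (a1 \<bullet> a2) *\<^sub>R a1 = (n \<bullet> cross3 a1 a2) *\<^sub>R T2"
proof -
  obtain x y w z b1 b2 c1 c2 p q r where
    f: "x\<^sup>2 + y\<^sup>2 = 1" "w\<^sup>2 + z\<^sup>2 = 1" and e: "n = vector [- y * w, x * w, z]"
    "a1 = vector [b1 * x - c1 * z * y, b1 * y + c1 * z * x, - c1 * w]"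
    "a2 = vector [b2 * x - c2 * z * y, b2 * y + c2 * z * x, - c2 * w]"
    "s1 = vector [(b1 * p + c1 * q) * x - (b1 * q + c1 * r) * z * y,
                  (b1 * p + c1 * q) * y + (b1 * q + c1 * r) * z * x, - (b1 * q + c1 * r) * w]"
    "s2 = vector [(b2 * p + c2 * q) * x - (b2 * q + c2 * r) * z * y,
                  (b2 * p + c2 * q) * y + (b2 * q + c2 * r) * z * x, - (b2 * q + c2 * r) * w]"
    "H2 = p + r" by (rule adapted_coordinates)
  have red: "y * y = 1 - x * x" "z * z = 1 - w * w"
    using f(1,2) by (simp_all add: power2_eq_square algebra_simps)
  have red': "y * (y * u) = u - x * (x * u)" "z * (z * u) = u - w * (w * u)" for u
    using red by (simp_all add: left_diff_distrib flip: mult.assoc)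
  note expand = inner_vec_def sum_3 cross_components algebra_simps power2_eq_square red red'
  show "R $ 3 = 0"
    unfolding jet_defs unfolding e by (simp add: expand)
  show "R $ 1 + killing_lin t 1 a1 \<bullet> F1 + killing_lin t 1 a2 \<bullet> F2
      + killing_lin t 1 dT \<bullet> n + killing_lin t 1 T1 \<bullet> n1 + killing_lin t 1 T2 \<bullet> n2 = 0"
    unfolding jet_defs killing_lin_def unfolding e by (simp add: expand)
  show "R $ 2 + killing_lin t 2 a1 \<bullet> F1 + killing_lin t 2 a2 \<bullet> F2
      + killing_lin t 2 dT \<bullet> n + killing_lin t 2 T1 \<bullet> n1 + killing_lin t 2 T2 \<bullet> n2 = 0"
    unfolding jet_defs killing_lin_def unfolding e by (simp add: expand)
  show "(a2 \<bullet> a2) *\<^sub>R n1 - (a1 \<bullet> a2) *\<^sub>R n2 = (n \<bullet> cross3 a1 a2) *\<^sub>R F1"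
    unfolding jet_defs unfolding e by (simp add: vec_eq_iff forall_3 expand)
  show "(a1 \<bullet> a1) *\<^sub>R n2 - (a1 \<bullet> a2) *\<^sub>R n1 = (n \<bullet> cross3 a1 a2) *\<^sub>R F2"
    unfolding jet_defs unfolding e by (simp add: vec_eq_iff forall_3 expand)
  show "(a2 \<bullet> a2) *\<^sub>R a1 - (a1 \<bullet> a2) *\<^sub>R a2 = (n \<bullet> cross3 a1 a2) *\<^sub>R T1"
    unfolding jet_defs unfolding e by (simp add: vec_eq_iff forall_3 expand)
  show "(a1 \<bullet> a1) *\<^sub>R a2 - (a1 \<bullet> a2) *\<^sub>R a1 = (n \<bullet> cross3 a1 a2) *\<^sub>R T2"
    unfolding jet_defs unfolding e by (simp add: vec_eq_iff forall_3 expand)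
qed

text \<open>The position enters a Killing field only through its third frame component, which is
  paired with \<open>R $ 3 = 0\<close>; hence \<open>p\<close> may be arbitrary.\<close>

lemma killing_identity:
  "killing t k p \<bullet> R + killing_lin t k a1 \<bullet> F1 + killing_lin t k a2 \<bullet> F2
    + killing_lin t k dT \<bullet> n + killing_lin t k T1 \<bullet> n1 + killing_lin t k T2 \<bullet> n2 = 0"
proof -
  have "k = 1 \<or> k = 2 \<or> k = 3" by (rule exhaust_3)
  then show ?thesis
    using vertical_identity horizontal_identity1 horizontal_identity2
    by (elim disjE) (simp_all add: killing_def inner_vec_def[of "vector _"] sum_3 killing_lin_def[of t 3])
qed

end

section \<open>Curvature of the Heisenberg group\<close>

lemma has_derivative_vec_nth' [derivative_intros]:
  "(f has_derivative f') F \<Longrightarrow> ((\<lambda>x. f x $ i) has_derivative (\<lambda>x. f' x $ i)) F"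
  by (rule bounded_linear.has_derivative[OF bounded_linear_vec_nth])

lemma axis_nth_3 [simp]:
  "axis 1 (1::real) $ (1::3) = 1" "axis 1 (1::real) $ (2::3) = 0" "axis 1 (1::real) $ (3::3) = 0"
  "axis 2 (1::real) $ (1::3) = 0" "axis 2 (1::real) $ (2::3) = 1" "axis 2 (1::real) $ (3::3) = 0"
  "axis 3 (1::real) $ (1::3) = 0" "axis 3 (1::real) $ (2::3) = 0" "axis 3 (1::real) $ (3::3) = 1"
  by (simp_all add: axis_def)

lemma matrix_inv_eqI:
  fixes A B :: "'a::semiring_1^'n^'n"
  assumes "A ** B = mat 1" "B ** A = mat 1"
  shows "matrix_inv A = B"
proof -
  have "A ** matrix_inv A = mat 1 \<and> matrix_inv A ** A = mat 1"
    unfolding matrix_inv_def by (rule someI_ex) (use assms in blast)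
  then show ?thesis by (metis assms(2) matrix_mul_assoc matrix_mul_lid matrix_mul_rid)
qed

text \<open>Stated in the exact shapes in which entries of the metric and of the Christoffel symbols
  occur, for direct rewriting.\<close>

lemma partial_monomials:
  fixes p :: "real^3"
  shows "partial l (\<lambda>q. k) p = (0::real)"
    and "partial l (\<lambda>q. k * q$i) p = k * axis l 1 $ i"
    and "partial l (\<lambda>q. k * (q$i * q$j)) p = k * (axis l 1 $ i * p$j + p$i * axis l 1 $ j)"
    and "partial l (\<lambda>q. c + k * (q$i * q$j)) p = k * (axis l 1 $ i * p$j + p$i * axis l 1 $ j)"
    and "partial l (\<lambda>q. k * (q$i * q$i - q$j * q$j)) p = k * (2 * p$i * axis l 1 $ i - 2 * p$j * axis l 1 $ j)"
proof -
  show "partial l (\<lambda>q. k) p = (0::real)"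
    by (rule partial_eq[of _ "\<lambda>h. 0"]) (auto intro!: derivative_eq_intros)
  show "partial l (\<lambda>q. k * q$i) p = k * axis l 1 $ i"
    by (rule partial_eq[of _ "\<lambda>h. k * h $ i"]) (auto intro!: derivative_eq_intros)
  show "partial l (\<lambda>q. k * (q$i * q$j)) p = k * (axis l 1 $ i * p$j + p$i * axis l 1 $ j)"
    by (rule partial_eq[of _ "\<lambda>h. k * (h $ i * p$j + p$i * h $ j)"]) (auto intro!: derivative_eq_intros)
  show "partial l (\<lambda>q. c + k * (q$i * q$j)) p = k * (axis l 1 $ i * p$j + p$i * axis l 1 $ j)"
    by (rule partial_eq[of _ "\<lambda>h. k * (h $ i * p$j + p$i * h $ j)"]) (auto intro!: derivative_eq_intros)
  show "partial l (\<lambda>q. k * (q$i * q$i - q$j * q$j)) p = k * (2 * p$i * axis l 1 $ i - 2 * p$j * axis l 1 $ j)"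
    by (rule partial_eq[of _ "\<lambda>h. k * (2 * p$i * h $ i - 2 * p$j * h $ j)"])
      (auto intro!: derivative_eq_intros)
qed

lemma nil3_metric_nth:
  "nil3_metric t p $ 1 $ 1 = 1 + t\<^sup>2 * (p$2 * p$2)"
  "nil3_metric t p $ 1 $ 2 = - (t\<^sup>2) * (p$1 * p$2)"
  "nil3_metric t p $ 2 $ 1 = - (t\<^sup>2) * (p$1 * p$2)"
  "nil3_metric t p $ 2 $ 2 = 1 + t\<^sup>2 * (p$1 * p$1)"
  "nil3_metric t p $ 1 $ 3 = t * p$2" "nil3_metric t p $ 3 $ 1 = t * p$2"
  "nil3_metric t p $ 2 $ 3 = - t * p$1" "nil3_metric t p $ 3 $ 2 = - t * p$1"
  "nil3_metric t p $ 3 $ 3 = 1"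
  by (simp_all add: nil3_metric_def nil3_contact_def power2_eq_square)

lemma metric_inner_nil3: "metric_inner (nil3_metric t) p v w = nil3_frame t p v \<bullet> nil3_frame t p w"
  by (simp add: metric_inner_def inner_vec_def matrix_vector_mult_def sum_3 nil3_metric_nth
      algebra_simps power2_eq_square)

lemma matrix_inv_nil3: "matrix_inv (nil3_metric t p) =
    vector [vector [1, 0, - (t * p$2)], vector [0, 1, t * p$1],
      vector [- (t * p$2), t * p$1, 1 + t\<^sup>2 * ((p$1)\<^sup>2 + (p$2)\<^sup>2)]]"
  by (rule matrix_inv_eqI; simp add: matrix_matrix_mult_def mat_def vec_eq_iff forall_3 sum_3 nil3_metric_nth
      algebra_simps power2_eq_square)

lemma christoffel_nil3:
  "christoffel (nil3_metric t) p 1 1 = vector [0, - 2 * t\<^sup>2 * p$2, - 2 * t^3 * (p$1 * p$2)]"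
  "christoffel (nil3_metric t) p 1 2 = vector [t\<^sup>2 * p$2, t\<^sup>2 * p$1, t^3 * (p$1 * p$1 - p$2 * p$2)]"
  "christoffel (nil3_metric t) p 2 1 = vector [t\<^sup>2 * p$2, t\<^sup>2 * p$1, t^3 * (p$1 * p$1 - p$2 * p$2)]"
  "christoffel (nil3_metric t) p 2 2 = vector [- 2 * t\<^sup>2 * p$1, 0, 2 * t^3 * (p$1 * p$2)]"
  "christoffel (nil3_metric t) p 1 3 = vector [0, - t, - t\<^sup>2 * p$1]"
  "christoffel (nil3_metric t) p 3 1 = vector [0, - t, - t\<^sup>2 * p$1]"
  "christoffel (nil3_metric t) p 2 3 = vector [t, 0, - t\<^sup>2 * p$2]"
  "christoffel (nil3_metric t) p 3 2 = vector [t, 0, - t\<^sup>2 * p$2]"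
  "christoffel (nil3_metric t) p 3 3 = vector [0, 0, 0]"
  unfolding christoffel_def sum_3 matrix_inv_nil3 vec_eq_iff forall_3 nil3_metric_nth partial_monomials axis_nth_3
    vec_lambda_beta vector_3
  by (simp_all add: power2_eq_square power3_eq_cube field_simps)

text \<open>The Ricci tensor is diagonal in the left-invariant frame, with eigenvalue
  \<open>- 2 * t\<^sup>2\<close> on horizontal vectors and \<open>2 * t\<^sup>2\<close> on the
  vertical one.\<close>

lemma ricci_nil3: "ricci (nil3_metric t) p v v
    = - 2 * t\<^sup>2 * (nil3_frame t p v \<bullet> nil3_frame t p v) + 4 * t\<^sup>2 * (nil3_frame t p v $ 3)\<^sup>2"
proof -
  define \<rho> :: "real^3^3" where "\<rho> = (\<chi> j k. \<Sum>i\<in>UNIV.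
        partial i (\<lambda>q. christoffel (nil3_metric t) q j k $ i) p
      - partial j (\<lambda>q. christoffel (nil3_metric t) q i k $ i) p
      + (\<Sum>m\<in>UNIV. christoffel (nil3_metric t) p i m $ i * christoffel (nil3_metric t) p j k $ m
                  - christoffel (nil3_metric t) p j m $ i * christoffel (nil3_metric t) p i k $ m))"
  have \<rho>: "\<rho> $ 1 $ 1 = 2 * t^4 * (p$2 * p$2) - 2 * t\<^sup>2" "\<rho> $ 1 $ 2 = - 2 * t^4 * (p$1 * p$2)"
    "\<rho> $ 2 $ 1 = - 2 * t^4 * (p$1 * p$2)" "\<rho> $ 2 $ 2 = 2 * t^4 * (p$1 * p$1) - 2 * t\<^sup>2"
    "\<rho> $ 1 $ 3 = 2 * t^3 * p$2" "\<rho> $ 3 $ 1 = 2 * t^3 * p$2"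
    "\<rho> $ 2 $ 3 = - 2 * t^3 * p$1" "\<rho> $ 3 $ 2 = - 2 * t^3 * p$1" "\<rho> $ 3 $ 3 = 2 * t\<^sup>2"
    unfolding \<rho>_def vec_lambda_beta sum_3 christoffel_nil3 vector_3 partial_monomials axis_nth_3
    by (simp_all add: power2_eq_square power3_eq_cube power4_eq_xxxx algebra_simps)
  have "ricci (nil3_metric t) p v v = (\<Sum>j\<in>UNIV. \<Sum>k\<in>UNIV. v $ j * v $ k * \<rho> $ j $ k)"
    unfolding ricci_def \<rho>_def vec_lambda_beta ..
  then show ?thesis unfolding sum_3 \<rho>
    by (simp add: inner_vec_def sum_3 power2_eq_square power3_eq_cube power4_eq_xxxx algebra_simps)
qed

text \<open>The Christoffel terms split into \<open>nil3_gamma\<close> and a part due to the moving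
  frame. When \<open>w\<close> is the derivative of \<open>v\<close> along \<open>u\<close>, that
  part completes the first summand to the derivative of the frame components of
  \<open>v\<close>.\<close>

lemma nil3_frame_covariant:
  "nil3_frame t p (w + (\<Sum>a\<in>UNIV. \<Sum>b\<in>UNIV. (u $ a * v $ b) *\<^sub>R christoffel (nil3_metric t) p a b))
    = nil3_frame t p w + vector [0, 0, t * (u$2 * v$1 - u$1 * v$2)]
      + nil3_gamma t (nil3_frame t p u) (nil3_frame t p v)"
  by (simp add: vec_eq_iff forall_3 sum_3 christoffel_nil3 power2_eq_square power3_eq_cube algebra_simps)

section \<open>Killing fields as Jacobi functions in a chart\<close>

lemma matrix_inv_2:
  fixes A :: "real^2^2"
  assumes "det A \<noteq> 0"
  shows "matrix_inv A = (1 / det A) *\<^sub>R vector [vector [A$2$2, - A$1$2], vector [- A$2$1, A$1$1]]"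
proof (rule matrix_inv_eqI)
  let ?B = "(1 / det A) *\<^sub>R vector [vector [A$2$2, - A$1$2], vector [- A$2$1, A$1$1]] :: real^2^2"
  show "A ** ?B = mat 1"
    using assms by (simp add: matrix_matrix_mult_def mat_def vec_eq_iff forall_2 sum_2 field_simps)
      (simp add: det_2 algebra_simps)
  show "?B ** A = mat 1"
    using assms by (simp add: matrix_matrix_mult_def mat_def vec_eq_iff forall_2 sum_2 field_simps)
      (simp add: det_2 algebra_simps)
qed

lemma matrix_inv_cancel:
  fixes A :: "real^'n^'n"
  assumes "det A \<noteq> 0"
  shows "A ** matrix_inv A = mat 1" "matrix_inv A ** A = mat 1"
proof -
  have "A ** matrix_inv A = mat 1 \<and> matrix_inv A ** A = mat 1"
    unfolding matrix_inv_def
    by (rule someI_ex) (use assms in \<open>auto simp: invertible_det_nz[symmetric] invertible_def\<close>)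
  then show "A ** matrix_inv A = mat 1" "matrix_inv A ** A = mat 1" by auto
qed

text \<open>The trace of the Cayley-Hamilton equation; it expresses |A|^2 by mean curvature and
  determinant.\<close>

lemma trace_square_2:
  fixes S :: "real^2^2"
  shows "trace (S ** S) = (trace S)\<^sup>2 - 2 * det S"
  by (simp add: trace_def matrix_matrix_mult_def sum_2 det_2 power2_eq_square algebra_simps)

lemma bounded_bilinear_cross3: "bounded_bilinear cross3"
  unfolding bilinear_conv_bounded_bilinear[symmetric]
  unfolding bilinear_def
  by (auto intro!: linearI simp: cross_add_left cross_add_right cross_mult_left cross_mult_right)

text \<open>The correction that makes \<open>nil3_frame\<close> the identity plus a bilinear map, so
  that the product rule applies to it.\<close>

definition nil3_twist :: "real \<Rightarrow> real^3 \<Rightarrow> real^3 \<Rightarrow> real^3" where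
  "nil3_twist t p v = vector [0, 0, t * (p$2 * v$1 - p$1 * v$2)]"

lemma nil3_twist_nth [simp]:
  "nil3_twist t p v $ 1 = 0" "nil3_twist t p v $ 2 = 0" "nil3_twist t p v $ 3 = t * (p$2 * v$1 - p$1 * v$2)"
  by (simp_all add: nil3_twist_def)

lemma nil3_frame_twist: "nil3_frame t p v = v + nil3_twist t p v"
  by (simp add: vec_eq_iff forall_3)

lemma bounded_bilinear_nil3_twist: "bounded_bilinear (nil3_twist t)"
  unfolding bilinear_conv_bounded_bilinear[symmetric]
  unfolding bilinear_def by (auto intro!: linearI simp: vec_eq_iff forall_3 algebra_simps)

lemma bounded_bilinear_nil3_gamma: "bounded_bilinear (nil3_gamma t)"
  unfolding bilinear_conv_bounded_bilinear[symmetric]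
  unfolding bilinear_def by (auto intro!: linearI simp: vec_eq_iff forall_3 algebra_simps)

lemmas smooth_on_cross3 = smooth_on_bilinear[OF bounded_bilinear_cross3]
lemmas smooth_on_nil3_gamma = smooth_on_bilinear[OF bounded_bilinear_nil3_gamma]
lemmas partial_cross3 = partial_bilinear[OF bounded_bilinear_cross3]
lemmas partial_nil3_gamma = partial_bilinear[OF bounded_bilinear_nil3_gamma]

lemma smooth_on_nil3_frame:
  "open S \<Longrightarrow> smooth_on S P \<Longrightarrow> smooth_on S V \<Longrightarrow> smooth_on S (\<lambda>y. nil3_frame t (P y) (V y))"
  unfolding nil3_frame_twist by (intro smooth_on_add smooth_on_bilinear[OF bounded_bilinear_nil3_twist])

lemma partial_nil3_frame:
  assumes "P differentiable (at y)" "V differentiable (at y)"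
  shows "partial i (\<lambda>y. nil3_frame t (P y) (V y)) y
    = nil3_frame t (P y) (partial i V y) + nil3_twist t (partial i P y) (V y)"
proof -
  have "(\<lambda>y. nil3_twist t (P y) (V y)) differentiable (at y)"
    using bounded_bilinear.FDERIV[OF bounded_bilinear_nil3_twist] assms unfolding differentiable_def by blast
  then show ?thesis unfolding nil3_frame_twist
    by (simp add: partial_add partial_bilinear[OF bounded_bilinear_nil3_twist] assms)
qed

lemma nil3_frame_eq_0: "nil3_frame t p v = 0 \<Longrightarrow> v = 0"
  by (auto simp: vec_eq_iff forall_3)

section \<open>Fundamental forms in a coordinate patch\<close>

locale nil3_patch =
  fixes t :: real and U :: "(real^2) set" and P N :: "real^2 \<Rightarrow> real^3"
  assumes U: "open U" and P: "smooth_on U P" and N: "smooth_on U N"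
    and immersed: "y \<in> U \<Longrightarrow> inj (frechet_derivative P (at y))"
    and unit_frame: "y \<in> U \<Longrightarrow> nil3_frame t (P y) (N y) \<bullet> nil3_frame t (P y) (N y) = 1"
    and perp_frame: "y \<in> U \<Longrightarrow> nil3_frame t (P y) (N y) \<bullet> nil3_frame t (P y) (partial i P y) = 0"
begin

definition "a i y = nil3_frame t (P y) (partial i P y)"
definition "n y = nil3_frame t (P y) (N y)"
text \<open>The shape operator on the \<open>i\<close>-th coordinate field: minus the covariant
  derivative of the normal, in frame components.\<close>

definition "s i y = - (partial i n y + nil3_gamma t (a i y) (n y))"
definition "g y = (\<chi> i j. a i y \<bullet> a j y)"
definition "b y = (\<chi> i j. a i y \<bullet> s j y)"
text \<open>The signed area density. Its square is the determinant of the metric, and being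
  polynomial in the frame data it avoids the square root; its sign compares the normal with the
  orientation of the coordinates.\<close>

definition "rho y = n y \<bullet> cross3 (a 1 y) (a 2 y)"
definition "flux u i y = sqrt (det (g y)) * (\<Sum>j\<in>UNIV. matrix_inv (g y) $ i $ j * partial j u y)"
definition "lap u y = (\<Sum>i\<in>UNIV. partial i (flux u i) y) / sqrt (det (g y))"
definition "grad u y = (\<chi> i. partial i u y)"
text \<open>The inner product of differentials; \<open>grad\<close> collects partial derivatives,
  hence is a covector.\<close>

definition "ip y v w = v \<bullet> (matrix_inv (g y) *v w)"

lemma smooth_a: "smooth_on U (a i)"
  unfolding a_def[abs_def] by (intro smooth_on_nil3_frame smooth_on_partial U P)

lemma smooth_n: "smooth_on U n"
  unfolding n_def[abs_def] by (intro smooth_on_nil3_frame U P N)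

lemma smooth_s: "smooth_on U (s i)"
  unfolding s_def[abs_def]
  by (intro smooth_on_uminus smooth_on_add smooth_on_partial smooth_n smooth_on_nil3_gamma smooth_a U)

lemma smooth_rho: "smooth_on U rho"
  unfolding rho_def[abs_def]
  by (intro smooth_on_inner smooth_on_cross3 smooth_n smooth_a U)

lemmas differentiables = smooth_on_differentiable[OF smooth_a] smooth_on_differentiable[OF smooth_n]
  smooth_on_differentiable[OF smooth_s] smooth_on_differentiable[OF P] smooth_on_differentiable[OF N]
  smooth_on_differentiable[OF smooth_on_partial[OF P]]
  smooth_on_differentiable[OF smooth_on_partial[OF smooth_n]]

lemma unit: "y \<in> U \<Longrightarrow> n y \<bullet> n y = 1"
  using unit_frame by (simp add: n_def)

lemma perp: "y \<in> U \<Longrightarrow> n y \<bullet> a i y = 0"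
  using perp_frame by (simp add: n_def a_def)

text \<open>Unit length kills the derivative part, and metric compatibility of the connection kills
  the \<open>nil3_gamma\<close> part.\<close>

lemma perp_s: assumes "y \<in> U" shows "n y \<bullet> s i y = 0"
proof -
  have "partial i (\<lambda>y. n y \<bullet> n y) y = partial i (\<lambda>y. 1) y"
    by (rule partial_cong[OF U assms unit])
  then have "n y \<bullet> partial i n y = 0"
    using assms by (simp add: partial_inner differentiables partial_const inner_commute)
  moreover have "n y \<bullet> nil3_gamma t (a i y) (n y) = 0"
    by (simp add: inner_vec_def sum_3 algebra_simps)
  ultimately show ?thesis by (simp add: s_def inner_diff_right)
qed

text \<open>Mixed partial derivatives of the immersion cancel and only twist terms survive: this is
  the structure equation [E1, E2] = 2 t E3 of the left-invariant frame, pulled back to the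
  patch.\<close>

lemma torsion:
  assumes "y \<in> U"
  shows "partial 1 (a 2) y - partial 2 (a 1) y = vector [0, 0, - 2 * t * cross3 (a 1 y) (a 2 y) $ 3]"
proof -
  have da: "partial i (a j) y = nil3_frame t (P y) (partial i (partial j P) y)
      + nil3_twist t (partial i P y) (partial j P y)" for i j
    unfolding a_def[abs_def] by (rule partial_nil3_frame) (use assms in \<open>auto intro: differentiables\<close>)
  have c: "partial 1 (partial 2 P) y = partial 2 (partial 1 P) y"
    by (rule smooth_on_partial_commute[OF U assms P])
  show ?thesis unfolding da c
    by (simp add: vec_eq_iff forall_3 cross_components a_def algebra_simps)
qed

text \<open>Differentiating \<open>n y \<bullet> a j y = 0\<close> turns the asymmetry of the
  derivatives of \<open>n\<close> into the normal part of \<open>torsion\<close>, which the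
  \<open>nil3_gamma\<close> terms compensate.\<close>

lemma symmetric: assumes "y \<in> U" shows "s 1 y \<bullet> a 2 y = s 2 y \<bullet> a 1 y"
proof -
  have "n y \<bullet> partial i (a j) y = - (partial i n y \<bullet> a j y)" for i j
  proof -
    have "partial i (\<lambda>y. n y \<bullet> a j y) y = partial i (\<lambda>y. 0) y"
      by (rule partial_cong[OF U assms perp])
    then show ?thesis using assms by (simp add: partial_inner differentiables partial_const)
  qed
  then have "partial 1 n y \<bullet> a 2 y - partial 2 n y \<bullet> a 1 y = - (n y \<bullet> (partial 1 (a 2) y - partial 2 (a 1) y))"
    by (simp add: inner_diff_right)
  then show ?thesis
    unfolding torsion[OF assms]
    by (simp add: s_def inner_add_left inner_vec_def[of "vector _"] inner_vec_def[of "nil3_gamma _ _ _"]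
        inner_vec_def[of _ "vector _"] sum_3 cross_components algebra_simps)
qed

lemma frame_independent:
  assumes "y \<in> U" "p *\<^sub>R a 1 y + q *\<^sub>R a 2 y = 0"
  shows "p = 0 \<and> q = 0"
proof -
  let ?D = "frechet_derivative P (at y)"
  have lin: "linear ?D" by (rule linear_frechet_derivative[OF differentiables(4)[OF assms(1)]])
  have "nil3_frame t (P y) (p *\<^sub>R partial 1 P y + q *\<^sub>R partial 2 P y) = p *\<^sub>R a 1 y + q *\<^sub>R a 2 y"
    by (simp add: a_def vec_eq_iff forall_3 algebra_simps)
  then have "p *\<^sub>R partial 1 P y + q *\<^sub>R partial 2 P y = 0"
    unfolding assms(2) by (rule nil3_frame_eq_0)
  then have "?D (p *\<^sub>R axis 1 1 + q *\<^sub>R axis 2 1) = ?D 0"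
    using lin by (simp add: partial_def linear_add linear_cmul linear_0)
  then have "p *\<^sub>R axis 1 1 + q *\<^sub>R axis 2 1 = (0 :: real^2)"
    using immersed[OF assms(1)] by (meson injD)
  then show ?thesis by (simp add: vec_eq_iff forall_2 axis_def)
qed

text \<open>A vector whose cross product with the unit vector \<open>n y\<close> is zero is a
  multiple of it; a second cross product extracts the factor.\<close>

lemma cross_a: assumes "y \<in> U" shows "cross3 (a 1 y) (a 2 y) = rho y *\<^sub>R n y"
proof -
  have "cross3 (n y) (cross3 (a 1 y) (a 2 y)) = 0"
    by (simp add: Lagrange perp assms)
  then have "cross3 (n y) (cross3 (n y) (cross3 (a 1 y) (a 2 y))) = 0" by simp
  then show ?thesis by (simp add: Lagrange[of "n y" "n y"] unit assms rho_def)
qed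

lemma rho_nonzero: assumes "y \<in> U" shows "rho y \<noteq> 0"
proof
  assume "rho y = 0"
  then have "cross3 (a 1 y) (a 2 y) = 0" using cross_a[OF assms] by simp
  then have "cross3 (a 2 y) (cross3 (a 1 y) (a 2 y)) = 0" by simp
  then have "(a 2 y \<bullet> a 2 y) *\<^sub>R a 1 y + (- (a 2 y \<bullet> a 1 y)) *\<^sub>R a 2 y = 0" by (simp add: Lagrange)
  \<comment> \<open>The first coefficient is the squared length of \<open>a 2 y\<close>, so this
    vector is zero, which is again a forbidden linear relation.\<close>
  from frame_independent[OF assms this] have "0 *\<^sub>R a 1 y + 1 *\<^sub>R a 2 y = 0" by simp
  from frame_independent[OF assms this] show False by simp
qed

lemma det_g: assumes "y \<in> U" shows "det (g y) = (rho y)\<^sup>2"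
proof -
  have "det (g y) = cross3 (a 1 y) (a 2 y) \<bullet> cross3 (a 1 y) (a 2 y)"
    by (simp add: det_2 g_def inner_vec_def sum_3 cross_components algebra_simps)
  then show ?thesis by (simp add: cross_a[OF assms] unit[OF assms] power2_eq_square)
qed

lemma det_g_pos: "y \<in> U \<Longrightarrow> det (g y) > 0"
  using rho_nonzero det_g by simp

text \<open>The Binet-Cauchy identity, after which \<open>cross_a\<close> replaces one cross product
  by a multiple of the normal.\<close>

lemma det_b: assumes "y \<in> U" shows "det (b y) = rho y * (n y \<bullet> cross3 (s 1 y) (s 2 y))"
proof -
  have "det (b y) = cross3 (a 1 y) (a 2 y) \<bullet> cross3 (s 1 y) (s 2 y)"
    by (simp add: det_2 b_def inner_vec_def sum_3 cross_components algebra_simps)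
  then show ?thesis by (simp add: cross_a[OF assms])
qed

lemma matrix_inv_g:
  assumes "y \<in> U"
  shows "matrix_inv (g y) $ 1 $ 1 = (a 2 y \<bullet> a 2 y) / (rho y)\<^sup>2"
    "matrix_inv (g y) $ 1 $ 2 = - (a 1 y \<bullet> a 2 y) / (rho y)\<^sup>2"
    "matrix_inv (g y) $ 2 $ 1 = - (a 1 y \<bullet> a 2 y) / (rho y)\<^sup>2"
    "matrix_inv (g y) $ 2 $ 2 = (a 1 y \<bullet> a 1 y) / (rho y)\<^sup>2"
  unfolding matrix_inv_2[OF det_g_pos[OF assms, THEN less_imp_neq, symmetric]] det_g[OF assms]
  by (simp_all add: g_def inner_commute)

lemma trace_shape:
  assumes "y \<in> U"
  shows "trace (matrix_inv (g y) ** b y) * rho y = n y \<bullet> (cross3 (s 1 y) (a 2 y) + cross3 (a 1 y) (s 2 y))"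
proof -
  have "(rho y)\<^sup>2 * trace (matrix_inv (g y) ** b y)
      = cross3 (a 1 y) (a 2 y) \<bullet> (cross3 (s 1 y) (a 2 y) + cross3 (a 1 y) (s 2 y))"
    using rho_nonzero[OF assms]
    by (simp add: trace_def matrix_matrix_mult_def sum_2 matrix_inv_g assms b_def field_simps)
      (simp add: inner_vec_def sum_3 cross_components algebra_simps)
  then have "rho y * (rho y * trace (matrix_inv (g y) ** b y))
      = rho y * (n y \<bullet> (cross3 (s 1 y) (a 2 y) + cross3 (a 1 y) (s 2 y)))"
    unfolding cross_a[OF assms] by (simp add: power2_eq_square mult.assoc)
  then show ?thesis using rho_nonzero[OF assms] by (simp add: mult.commute)
qed

lemma transpose_g: "transpose (g y) = g y"
  by (simp add: vec_eq_iff transpose_def g_def inner_commute)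

lemma transpose_b: assumes "y \<in> U" shows "transpose (b y) = b y"
  using symmetric[OF assms] by (simp add: vec_eq_iff forall_2 transpose_def b_def inner_commute)

text \<open>Symmetry of \<open>b y\<close> makes the shape operator self-adjoint for the metric, so
  its squared norm is the trace of its square.\<close>

lemma shape_norm:
  assumes "y \<in> U"
  defines "S \<equiv> matrix_inv (g y) ** b y"
  shows "trace (matrix_inv (g y) ** transpose S ** g y ** S)
    = (trace S)\<^sup>2 - 2 * (n y \<bullet> cross3 (s 1 y) (s 2 y)) / rho y"
proof -
  have d: "det (g y) \<noteq> 0" using det_g_pos[OF assms(1)] by simp
  note inv = matrix_inv_cancel[OF d]
  have "transpose (matrix_inv (g y)) ** g y = mat 1" "g y ** transpose (matrix_inv (g y)) = mat 1"
    using arg_cong[OF inv(1), of transpose] arg_cong[OF inv(2), of transpose]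
    by (simp_all add: matrix_transpose_mul transpose_g transpose_mat)
  then have "transpose (matrix_inv (g y)) = matrix_inv (g y)"
    by (intro matrix_inv_eqI[symmetric])
  then have "transpose S = b y ** matrix_inv (g y)"
    by (simp add: S_def matrix_transpose_mul transpose_b[OF assms(1)])
  then have "matrix_inv (g y) ** transpose S ** g y = matrix_inv (g y) ** (b y ** (matrix_inv (g y) ** g y))"
    by (simp only: matrix_mul_assoc)
  also have "\<dots> = S" by (simp add: S_def inv)
  finally have S: "matrix_inv (g y) ** transpose S ** g y = S" .
  have "det S * (rho y)\<^sup>2 = rho y * (n y \<bullet> cross3 (s 1 y) (s 2 y))"
  proof -
    have "det (matrix_inv (g y)) * det (g y) = 1" unfolding det_mul[symmetric] inv(2) by simp
    then have "det S * det (g y) = det (b y)" by (simp add: S_def det_mul)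
    then show ?thesis unfolding det_g[OF assms(1)] det_b[OF assms(1)] .
  qed
  then have "det S = (n y \<bullet> cross3 (s 1 y) (s 2 y)) / rho y"
    using rho_nonzero[OF assms(1)] by (simp add: field_simps power2_eq_square)
  then show ?thesis unfolding S trace_square_2 by simp
qed

lemma smooth_inverse_metric: "smooth_on U (\<lambda>y. matrix_inv (g y) $ i $ j)"
proof -
  have 1: "smooth_on U (\<lambda>y. a k y \<bullet> a l y * inverse (rho y * rho y))" for k l
    by (intro smooth_on_mult smooth_on_inner smooth_on_inverse smooth_a smooth_rho U) (simp add: rho_nonzero)
  then have 2: "smooth_on U (\<lambda>y. - (a k y \<bullet> a l y * inverse (rho y * rho y)))" for k l
    by (intro smooth_on_uminus U)
  have "smooth_on U (\<lambda>y. matrix_inv (g y) $ 1 $ 1)"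
    by (rule smooth_on_cong[OF U _ 1[of 2 2]]) (simp add: matrix_inv_g power2_eq_square divide_inverse)
  moreover have "smooth_on U (\<lambda>y. matrix_inv (g y) $ 1 $ 2)"
    by (rule smooth_on_cong[OF U _ 2[of 1 2]]) (simp add: matrix_inv_g power2_eq_square divide_inverse)
  moreover have "smooth_on U (\<lambda>y. matrix_inv (g y) $ 2 $ 1)"
    by (rule smooth_on_cong[OF U _ 2[of 1 2]]) (simp add: matrix_inv_g power2_eq_square divide_inverse)
  moreover have "smooth_on U (\<lambda>y. matrix_inv (g y) $ 2 $ 2)"
    by (rule smooth_on_cong[OF U _ 1[of 1 1]]) (simp add: matrix_inv_g power2_eq_square divide_inverse)
  ultimately show ?thesis using exhaust_2[of i] exhaust_2[of j] by (elim disjE) simp_all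
qed

lemma sqrt_det_g: "y \<in> U \<Longrightarrow> sqrt (det (g y)) = \<bar>rho y\<bar>"
  by (simp add: det_g)

text \<open>The radicand is the square of a smooth function without zeros.\<close>

lemma smooth_sqrt_det_g: "smooth_on U (\<lambda>y. sqrt (det (g y)))"
proof -
  have "rho y * rho y > 0" if "y \<in> U" for y
    using rho_nonzero[OF that] by (simp add: zero_less_mult_iff linorder_neq_iff) linarith
  then have "smooth_on U (\<lambda>y. sqrt (rho y * rho y))"
    by (intro smooth_on_sqrt smooth_on_mult smooth_rho U)
  then show ?thesis
    by (rule smooth_on_cong[OF U, rotated]) (simp add: det_g)
qed

lemma smooth_flux: "smooth_on U u \<Longrightarrow> smooth_on U (flux u i)"
  unfolding flux_def[abs_def] sum_2
  by (intro smooth_on_mult smooth_on_add smooth_on_partial smooth_inverse_metric smooth_sqrt_det_g U)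

section \<open>Differentials and the Laplacian of a norm\<close>

lemma ip_add_left: "ip y (u + v) w = ip y u w + ip y v w"
  and ip_scale_left: "ip y (c *\<^sub>R u) w = c * ip y u w"
  by (simp_all add: ip_def inner_add_left)

lemma ip_commute: "y \<in> U \<Longrightarrow> ip y v w = ip y w v"
  by (simp add: ip_def inner_vec_def sum_2 matrix_vector_mult_def matrix_inv_g algebra_simps)

text \<open>The inverse of a two by two matrix is its cofactor matrix over the determinant, so the
  quadratic form on differentials is the metric on the quarter turn of the covector. Definiteness
  follows from this.\<close>

lemma ip_self:
  assumes "y \<in> U"
  shows "ip y v v = ((norm (v$1 *\<^sub>R a 2 y - v$2 *\<^sub>R a 1 y)) / rho y)\<^sup>2"
proof -
  have "ip y v v * (rho y)\<^sup>2 = (v$1 *\<^sub>R a 2 y - v$2 *\<^sub>R a 1 y) \<bullet> (v$1 *\<^sub>R a 2 y - v$2 *\<^sub>R a 1 y)"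
    using rho_nonzero[OF assms]
    by (simp add: ip_def inner_vec_def[of v] sum_2 matrix_vector_mult_def matrix_inv_g[OF assms] field_simps)
      (simp add: inner_diff_left inner_diff_right inner_commute algebra_simps)
  then show ?thesis using rho_nonzero[OF assms]
    by (simp add: power_divide power2_norm_eq_inner field_simps)
qed

lemma ip_self_nonneg: "y \<in> U \<Longrightarrow> ip y v v \<ge> 0"
  by (simp add: ip_self)

lemma ip_self_eq_0: assumes "y \<in> U" "ip y v v = 0" shows "v = 0"
proof -
  have "v$1 *\<^sub>R a 2 y - v$2 *\<^sub>R a 1 y = 0"
    using assms rho_nonzero by (simp add: ip_self)
  then have "(- v$2) *\<^sub>R a 1 y + v$1 *\<^sub>R a 2 y = 0" by simp
  from frame_independent[OF assms(1) this] show ?thesis by (simp add: vec_eq_iff forall_2)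
qed

lemma flux_eq: "flux u i y = sqrt (det (g y)) * (matrix_inv (g y) *v grad u y) $ i"
  by (simp add: flux_def grad_def matrix_vector_mult_def)

lemma sum_partial_flux: "(\<Sum>i\<in>UNIV. partial i u y * flux v i y) = sqrt (det (g y)) * ip y (grad u y) (grad v y)"
  by (simp add: flux_eq ip_def inner_vec_def sum_2 grad_def algebra_simps)

lemma grad_norm:
  fixes u :: "3 \<Rightarrow> real^2 \<Rightarrow> real"
  assumes u: "\<And>k. smooth_on U (u k)" and f: "smooth_on U f"
    and sq: "\<And>z. z \<in> U \<Longrightarrow> (f z)\<^sup>2 = (\<Sum>k\<in>UNIV. (u k z)\<^sup>2)" and y: "y \<in> U"
  shows "f y *\<^sub>R grad f y = (\<Sum>k\<in>UNIV. u k y *\<^sub>R grad (u k) y)"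
proof -
  have d: "(u k) differentiable (at y)" "f differentiable (at y)" for k
    using u f y smooth_on_differentiable by blast+
  have sq': "partial i (\<lambda>z. h z * h z) y = 2 * (h y * partial i h y)" if "h differentiable (at y)" for h :: "real^2 \<Rightarrow> real" and i
    using that by (simp add: partial_mult)
  have d2: "(\<lambda>z. u k z * u k z) differentiable (at y)" for k using d by simp
  have "partial i (\<lambda>z. f z * f z) y = partial i (\<lambda>z. u 1 z * u 1 z + u 2 z * u 2 z + u 3 z * u 3 z) y" for i
    by (rule partial_cong[OF U y]) (use sq in \<open>simp add: sum_3 power2_eq_square\<close>)
  then have dd: "2 * (f y * partial i f y) = 2 * (u 1 y * partial i (u 1) y) + 2 * (u 2 y * partial i (u 2) y)
      + 2 * (u 3 y * partial i (u 3) y)" for i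
    using d d2 by (simp add: sq' partial_add)
  have "f y * partial i f y = u 1 y * partial i (u 1) y + u 2 y * partial i (u 2) y
      + u 3 y * partial i (u 3) y" for i
    using dd[of i] by linarith
  then show ?thesis by (simp add: vec_eq_iff grad_def sum_3)
qed

text \<open>Both sides are half the Laplacian of f^2, taken as the divergence of \<open>f\<close>
  times its flux; \<open>grad_norm\<close> equates the fluxes before they are
  differentiated.\<close>

lemma lap_norm:
  fixes u :: "3 \<Rightarrow> real^2 \<Rightarrow> real"
  assumes u: "\<And>k. smooth_on U (u k)" and f: "smooth_on U f"
    and sq: "\<And>z. z \<in> U \<Longrightarrow> (f z)\<^sup>2 = (\<Sum>k\<in>UNIV. (u k z)\<^sup>2)" and y: "y \<in> U"
  shows "f y * lap f y + ip y (grad f y) (grad f y)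
    = (\<Sum>k\<in>UNIV. u k y * lap (u k) y + ip y (grad (u k) y) (grad (u k) y))"
proof -
  let ?r = "sqrt (det (g y))"
  have r: "?r > 0" using det_g_pos[OF y] by simp
  have d: "(u k) differentiable (at y)" "f differentiable (at y)"
    "(flux (u k) i) differentiable (at y)" "(flux f i) differentiable (at y)" for k i
    using u f y smooth_flux smooth_on_differentiable by blast+
  have d2: "(\<lambda>z. u k z * flux (u k) i z) differentiable (at y)" for k i using d by simp
  have "f z * flux f i z = u 1 z * flux (u 1) i z + u 2 z * flux (u 2) i z + u 3 z * flux (u 3) i z"
    if "z \<in> U" for z i
  proof -
    have "(matrix_inv (g z) *v (f z *\<^sub>R grad f z)) $ i
        = (matrix_inv (g z) *v (\<Sum>k\<in>UNIV. u k z *\<^sub>R grad (u k) z)) $ i"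
      by (simp only: grad_norm[OF u f sq that])
    then have "f z * (matrix_inv (g z) *v grad f z) $ i = u 1 z * (matrix_inv (g z) *v grad (u 1) z) $ i
        + u 2 z * (matrix_inv (g z) *v grad (u 2) z) $ i + u 3 z * (matrix_inv (g z) *v grad (u 3) z) $ i"
      by (simp add: sum_3 matrix_vector_right_distrib matrix_vector_mult_scaleR)
    from arg_cong[OF this, of "(*) (sqrt (det (g z)))"] show ?thesis
      by (simp add: flux_eq algebra_simps)
  qed
  then have "partial i (\<lambda>z. f z * flux f i z) y =
      partial i (\<lambda>z. u 1 z * flux (u 1) i z + u 2 z * flux (u 2) i z + u 3 z * flux (u 3) i z) y" for i
    by (intro partial_cong[OF U y])
  then have "partial i f y * flux f i y + f y * partial i (flux f i) y =
      (\<Sum>k\<in>UNIV. partial i (u k) y * flux (u k) i y + u k y * partial i (flux (u k) i) y)" for i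
    using d d2 by (simp add: partial_add partial_mult sum_3)
  then have "(\<Sum>i\<in>UNIV. partial i f y * flux f i y) + f y * (\<Sum>i\<in>UNIV. partial i (flux f i) y) =
      (\<Sum>k\<in>UNIV. (\<Sum>i\<in>UNIV. partial i (u k) y * flux (u k) i y) + u k y * (\<Sum>i\<in>UNIV. partial i (flux (u k) i) y))"
    by (simp add: sum_3 sum_2 algebra_simps)
  moreover have "(\<Sum>i\<in>UNIV. partial i (flux h i) y) = ?r * lap h y" for h
    using r by (simp add: lap_def)
  ultimately have "?r * (f y * lap f y + ip y (grad f y) (grad f y))
    = ?r * (\<Sum>k\<in>UNIV. u k y * lap (u k) y + ip y (grad (u k) y) (grad (u k) y))"
    unfolding sum_partial_flux by (simp add: sum_3 algebra_simps)
  then show ?thesis using r by simp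
qed

text \<open>By \<open>grad_norm\<close>, grad f is the sum of c_k grad u_k, where the c_k = u_k / f
  have square sum 1. In the expansion the mixed terms contribute - 2 |grad f|^2 and the last ones
  |grad f|^2.\<close>

lemma sum_ip_defect:
  fixes u :: "3 \<Rightarrow> real^2 \<Rightarrow> real"
  assumes u: "\<And>k. smooth_on U (u k)" and f: "smooth_on U f"
    and sq: "\<And>z. z \<in> U \<Longrightarrow> (f z)\<^sup>2 = (\<Sum>k\<in>UNIV. (u k z)\<^sup>2)" and y: "y \<in> U" and pos: "f y > 0"
  defines "v \<equiv> \<lambda>k. grad (u k) y - (u k y / f y) *\<^sub>R grad f y"
  shows "(\<Sum>k\<in>UNIV. ip y (v k) (v k))
    = (\<Sum>k\<in>UNIV. ip y (grad (u k) y) (grad (u k) y)) - ip y (grad f y) (grad f y)"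
proof -
  let ?W = "grad f y"
  define c where "c k = u k y / f y" for k
  have v: "ip y (v k) w = ip y (grad (u k) y) w - c k * ip y ?W w" for k w
    by (simp add: v_def c_def ip_def inner_diff_left)
  have vv: "ip y (v k) (v k) = ip y (grad (u k) y) (grad (u k) y) - 2 * (c k * ip y (grad (u k) y) ?W)
      + (c k)\<^sup>2 * ip y ?W ?W" for k
    using v[of k "v k"] v[of k "grad (u k) y"] v[of k ?W] ip_commute[OF y, of "grad (u k) y" "v k"]
      ip_commute[OF y, of ?W "v k"] ip_commute[OF y, of ?W "grad (u k) y"]
    by (simp add: power2_eq_square algebra_simps)
  have "(\<Sum>k\<in>UNIV. ip y (v k) (v k)) = (\<Sum>k\<in>UNIV. ip y (grad (u k) y) (grad (u k) y))
      - 2 * ip y (\<Sum>k\<in>UNIV. c k *\<^sub>R grad (u k) y) ?W + (\<Sum>k\<in>UNIV. (c k)\<^sup>2) * ip y ?W ?W"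
    unfolding vv by (simp add: sum_3 ip_add_left ip_scale_left algebra_simps)
  moreover have "(\<Sum>k\<in>UNIV. c k *\<^sub>R grad (u k) y) = ?W"
  proof -
    have "(\<Sum>k\<in>UNIV. c k *\<^sub>R grad (u k) y) = (1 / f y) *\<^sub>R (\<Sum>k\<in>UNIV. u k y *\<^sub>R grad (u k) y)"
      by (simp add: c_def scaleR_sum_right)
    also have "\<dots> = (1 / f y) *\<^sub>R (f y *\<^sub>R ?W)"
      by (simp only: grad_norm[OF u f sq y, symmetric])
    finally show ?thesis using pos by simp
  qed
  moreover have "(\<Sum>k\<in>UNIV. (c k)\<^sup>2) = 1"
  proof -
    have "(\<Sum>k\<in>UNIV. (c k)\<^sup>2) = (\<Sum>k\<in>UNIV. (u k y)\<^sup>2) / (f y)\<^sup>2"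
      by (simp add: c_def power_divide sum_divide_distrib)
    then show ?thesis using pos by (simp add: sq[OF y, symmetric])
  qed
  ultimately show ?thesis by simp
qed

end

section \<open>The Jacobi equation on a patch\<close>

text \<open>\<open>H2\<close> is twice the mean curvature. Fixing one value for the whole patch is
  how its constancy enters: no derivative of it appears in the divergence.\<close>

locale nil3_cmc_patch = nil3_patch +
  fixes H2 :: real
  assumes mean: "y \<in> U \<Longrightarrow> trace (matrix_inv (g y) ** b y) = H2"
begin

definition "T1 y = cross3 (a 2 y) (n y)"
definition "T2 y = - cross3 (a 1 y) (n y)"
definition "F1 y = cross3 (s 2 y) (n y) - H2 *\<^sub>R T1 y - nil3_gamma t (T1 y) (n y)"
definition "F2 y = - cross3 (s 1 y) (n y) - H2 *\<^sub>R T2 y - nil3_gamma t (T2 y) (n y)"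
definition "u k y = killing t k (P y) \<bullet> n y"

lemma jet: "y \<in> U \<Longrightarrow> nil3_jet H2 (n y) (a 1 y) (a 2 y) (s 1 y) (s 2 y)"
  using unit perp perp_s symmetric rho_nonzero trace_shape mean
  by unfold_locales (simp_all add: rho_def)

lemma smooth_T: "smooth_on U T1" "smooth_on U T2"
  unfolding T1_def[abs_def] T2_def[abs_def]
  by (intro smooth_on_cross3 smooth_on_uminus smooth_a smooth_n U)+

lemma smooth_F: "smooth_on U F1" "smooth_on U F2"
  unfolding F1_def[abs_def] F2_def[abs_def]
  by (intro smooth_on_cross3 smooth_on_uminus smooth_on_diff smooth_on_nil3_gamma smooth_s smooth_n U smooth_T
      smooth_on_bounded_linear[OF bounded_linear_scaleR_right])+

lemma smooth_killing: "smooth_on U (\<lambda>y. killing t k (P y))"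
  unfolding killing_affine[of _ _ "P _"]
  by (intro smooth_on_add smooth_on_const smooth_on_bounded_linear[OF bounded_linear_killing_lin] P U)

lemma smooth_u: "smooth_on U (u k)"
  unfolding u_def[abs_def] by (intro smooth_on_inner smooth_killing smooth_n U)

lemmas differentiables' = smooth_T[THEN smooth_on_differentiable] smooth_F[THEN smooth_on_differentiable]
  smooth_on_differentiable[OF smooth_killing] smooth_on_differentiable[OF smooth_u]

lemma partial_killing:
  assumes "y \<in> U" shows "partial i (\<lambda>y. killing t k (P y)) y = killing_lin t k (a i y)"
proof -
  have "(\<lambda>y. killing_lin t k (P y)) differentiable (at y)"
    using smooth_on_differentiable[OF smooth_on_bounded_linear[OF bounded_linear_killing_lin U P] assms] .
  then show ?thesis
    unfolding killing_affine[of _ _ "P _"] a_def killing_lin_frame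
    by (simp add: partial_add partial_const partial_linear[OF bounded_linear_killing_lin] differentiables assms)
qed

lemma partial_killing_fun:
  "y \<in> U \<Longrightarrow> partial i (u k) y = killing_lin t k (a i y) \<bullet> n y + killing t k (P y) \<bullet> partial i n y"
  unfolding u_def[abs_def] by (simp add: partial_inner differentiables differentiables' partial_killing)

text \<open>The inverse metric is made of cofactors over the square of \<open>rho\<close>. The flux
  and conormal identities cancel one factor \<open>rho\<close>, and against the positive density in
  \<open>flux\<close> only a sign remains.\<close>

lemma flux_killing:
  assumes "y \<in> U"
  shows "flux (u k) 1 y = sgn (rho y) * (killing t k (P y) \<bullet> F1 y + killing_lin t k (T1 y) \<bullet> n y)"
    "flux (u k) 2 y = sgn (rho y) * (killing t k (P y) \<bullet> F2 y + killing_lin t k (T2 y) \<bullet> n y)"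
proof -
  interpret J: nil3_jet t H2 "n y" "a 1 y" "a 2 y" "s 1 y" "s 2 y" by (rule jet[OF assms])
  interpret L: bounded_linear "killing_lin t k" by (rule bounded_linear_killing_lin)
  have n: "partial 1 n y = J.n1" "partial 2 n y = J.n2"
    unfolding J.n1_def J.n2_def unfolding s_def by simp_all
  have T: "T1 y = J.T1" "T2 y = J.T2" by (simp_all add: J.T1_def J.T2_def T1_def T2_def)
  have F: "F1 y = J.F1" "F2 y = J.F2" by (simp_all add: J.F1_def J.F2_def F1_def F2_def T)
  have r: "\<bar>rho y\<bar> / (rho y)\<^sup>2 * rho y = sgn (rho y)"
    using rho_nonzero[OF assms] by (simp add: power2_eq_square sgn_if)
  have "(a 2 y \<bullet> a 2 y) * partial 1 (u k) y - (a 1 y \<bullet> a 2 y) * partial 2 (u k) y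
      = killing_lin t k ((a 2 y \<bullet> a 2 y) *\<^sub>R a 1 y - (a 1 y \<bullet> a 2 y) *\<^sub>R a 2 y) \<bullet> n y
        + killing t k (P y) \<bullet> ((a 2 y \<bullet> a 2 y) *\<^sub>R J.n1 - (a 1 y \<bullet> a 2 y) *\<^sub>R J.n2)"
    by (simp add: partial_killing_fun assms n L.diff L.scaleR inner_diff_left inner_diff_right algebra_simps)
  also have "\<dots> = rho y * (killing t k (P y) \<bullet> F1 y + killing_lin t k (T1 y) \<bullet> n y)"
    unfolding J.flux_identity1 J.conormal_identity1 by (simp add: L.scaleR T F rho_def algebra_simps)
  finally have 1: "(a 2 y \<bullet> a 2 y) * partial 1 (u k) y - (a 1 y \<bullet> a 2 y) * partial 2 (u k) y
    = rho y * (killing t k (P y) \<bullet> F1 y + killing_lin t k (T1 y) \<bullet> n y)" .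
  have "flux (u k) 1 y = \<bar>rho y\<bar> / (rho y)\<^sup>2 * ((a 2 y \<bullet> a 2 y) * partial 1 (u k) y - (a 1 y \<bullet> a 2 y) * partial 2 (u k) y)"
    using rho_nonzero[OF assms]
    by (simp add: flux_def sqrt_det_g assms sum_2 matrix_inv_g field_simps)
  then show "flux (u k) 1 y = sgn (rho y) * (killing t k (P y) \<bullet> F1 y + killing_lin t k (T1 y) \<bullet> n y)"
    unfolding 1 mult.assoc[symmetric] r .
  have "(a 1 y \<bullet> a 1 y) * partial 2 (u k) y - (a 1 y \<bullet> a 2 y) * partial 1 (u k) y
      = killing_lin t k ((a 1 y \<bullet> a 1 y) *\<^sub>R a 2 y - (a 1 y \<bullet> a 2 y) *\<^sub>R a 1 y) \<bullet> n y
        + killing t k (P y) \<bullet> ((a 1 y \<bullet> a 1 y) *\<^sub>R J.n2 - (a 1 y \<bullet> a 2 y) *\<^sub>R J.n1)"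
    by (simp add: partial_killing_fun assms n L.diff L.scaleR inner_diff_left inner_diff_right algebra_simps)
  also have "\<dots> = rho y * (killing t k (P y) \<bullet> F2 y + killing_lin t k (T2 y) \<bullet> n y)"
    unfolding J.flux_identity2 J.conormal_identity2 by (simp add: L.scaleR T F rho_def algebra_simps)
  finally have 2: "(a 1 y \<bullet> a 1 y) * partial 2 (u k) y - (a 1 y \<bullet> a 2 y) * partial 1 (u k) y
    = rho y * (killing t k (P y) \<bullet> F2 y + killing_lin t k (T2 y) \<bullet> n y)" .
  have "flux (u k) 2 y = \<bar>rho y\<bar> / (rho y)\<^sup>2 * ((a 1 y \<bullet> a 1 y) * partial 2 (u k) y - (a 1 y \<bullet> a 2 y) * partial 1 (u k) y)"
    using rho_nonzero[OF assms]
    by (simp add: flux_def sqrt_det_g assms sum_2 matrix_inv_g field_simps)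
  then show "flux (u k) 2 y = sgn (rho y) * (killing t k (P y) \<bullet> F2 y + killing_lin t k (T2 y) \<bullet> n y)"
    unfolding 2 mult.assoc[symmetric] r .
qed

text \<open>Lets the sign in \<open>flux_killing\<close> be pulled out of derivatives.\<close>

lemma sgn_rho_locally_constant:
  assumes "y \<in> U"
  shows "\<exists>V. open V \<and> y \<in> V \<and> V \<subseteq> U \<and> (\<forall>z\<in>V. sgn (rho z) = sgn (rho y))"
proof (intro exI conjI ballI)
  let ?V = "U \<inter> (\<lambda>z. rho z * rho y) -` {0<..}"
  have "continuous_on U (\<lambda>z. rho z * rho y)"
    by (intro continuous_intros smooth_on_continuous smooth_rho)
  then show "open ?V" by (rule continuous_open_preimage[OF _ U open_greaterThan])
  show "y \<in> ?V" using assms rho_nonzero[OF assms] by (auto simp: zero_less_mult_iff)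
  show "?V \<subseteq> U" by blast
  show "sgn (rho z) = sgn (rho y)" if "z \<in> ?V" for z
    using that by (auto simp: sgn_if zero_less_mult_iff)
qed

lemma divergence_T: assumes "y \<in> U"
  shows "partial 1 T1 y + partial 2 T2 y = nil3_jet.dT t (n y) (a 1 y) (a 2 y) (s 1 y) (s 2 y)"
proof -
  interpret J: nil3_jet t H2 "n y" "a 1 y" "a 2 y" "s 1 y" "s 2 y" by (rule jet[OF assms])
  have n: "J.n1 = partial 1 n y" "J.n2 = partial 2 n y"
    unfolding J.n1_def J.n2_def unfolding s_def by simp_all
  have T: "partial 1 T1 y = cross3 (partial 1 (a 2) y) (n y) + cross3 (a 2 y) (partial 1 n y)"
    "partial 2 T2 y = - (cross3 (partial 2 (a 1) y) (n y) + cross3 (a 1 y) (partial 2 n y))"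
    unfolding T1_def[abs_def] T2_def[abs_def] using assms smooth_on_differentiable[OF smooth_on_cross3[OF U smooth_a smooth_n]]
    by (simp_all add: partial_cross3 partial_uminus differentiables)
  show ?thesis
    unfolding T J.dT_def J.c_def torsion[OF assms, symmetric] n
    by (simp add: Cross3.left_diff_distrib)
qed

lemma divergence_F: assumes "y \<in> U"
  shows "partial 1 F1 y + partial 2 F2 y = nil3_jet.dF t H2 (n y) (a 1 y) (a 2 y) (s 1 y) (s 2 y)"
proof -
  interpret J: nil3_jet t H2 "n y" "a 1 y" "a 2 y" "s 1 y" "s 2 y" by (rule jet[OF assms])
  interpret G: bounded_bilinear "nil3_gamma t" by (rule bounded_bilinear_nil3_gamma)
  have n: "J.n1 = partial 1 n y" "J.n2 = partial 2 n y"
    unfolding J.n1_def J.n2_def unfolding s_def by simp_all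
  have T: "J.T1 = T1 y" "J.T2 = T2 y" by (simp_all add: J.T1_def J.T2_def T1_def T2_def)
  note [simp] = smooth_on_differentiable[OF smooth_on_cross3[OF U smooth_s smooth_n] assms]
    smooth_on_differentiable[OF smooth_on_bounded_linear[OF bounded_linear_scaleR_right U smooth_T(1)] assms]
    smooth_on_differentiable[OF smooth_on_bounded_linear[OF bounded_linear_scaleR_right U smooth_T(2)] assms]
    smooth_on_differentiable[OF smooth_on_nil3_gamma[OF U smooth_T(1) smooth_n] assms]
    smooth_on_differentiable[OF smooth_on_nil3_gamma[OF U smooth_T(2) smooth_n] assms]
    smooth_on_differentiable[OF smooth_on_nil3_gamma[OF U smooth_a smooth_n] assms]
    differentiables[OF assms] differentiables'[OF assms]
  have s: "partial i (s j) y = - (partial i (partial j n) y + (nil3_gamma t (partial i (a j) y) (n y)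
      + nil3_gamma t (a j y) (partial i n y)))" for i j
    unfolding s_def[abs_def] by (simp add: partial_uminus partial_add partial_nil3_gamma del: minus_add_distrib)
  \<comment> \<open>The Codazzi step: second derivatives of \<open>n\<close> occur only
    antisymmetrised and cancel.\<close>
  have ds: "partial 1 (s 2) y - partial 2 (s 1) y = J.ds"
    unfolding s J.ds_def J.c_def torsion[OF assms, symmetric] n smooth_on_partial_commute[OF U assms smooth_n, of 1 2]
    by (simp add: G.diff_left)
  have "partial 1 F1 y = cross3 (partial 1 (s 2) y) (n y) + cross3 (s 2 y) (partial 1 n y)
      - H2 *\<^sub>R partial 1 T1 y - (nil3_gamma t (partial 1 T1 y) (n y) + nil3_gamma t (T1 y) (partial 1 n y))"
    unfolding F1_def[abs_def]
    by (simp add: partial_diff partial_cross3 partial_linear[OF bounded_linear_scaleR_right] partial_nil3_gamma)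
  moreover have "partial 2 F2 y = - (cross3 (partial 2 (s 1) y) (n y) + cross3 (s 1 y) (partial 2 n y))
      - H2 *\<^sub>R partial 2 T2 y - (nil3_gamma t (partial 2 T2 y) (n y) + nil3_gamma t (T2 y) (partial 2 n y))"
    unfolding F2_def[abs_def]
    by (simp add: partial_diff partial_cross3 partial_linear[OF bounded_linear_scaleR_right] partial_nil3_gamma
        partial_uminus)
  ultimately show ?thesis
    unfolding J.dF_def ds[symmetric] divergence_T[OF assms, symmetric] n T
    by (simp add: Cross3.left_diff_distrib G.add_left scaleR_add_right)
qed

text \<open>The divergence of the flux is known pointwise from \<open>killing_identity\<close>. The
  bracket is |A|^2 + Ric(N, N), as the quotient by \<open>rho\<close> is the determinant of the
  shape operator.\<close>

theorem killing_jacobi_equation: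
  assumes "y \<in> U"
  shows "lap (u k) y = - (H2\<^sup>2 - 2 * (n y \<bullet> cross3 (s 1 y) (s 2 y)) / rho y
    - 2 * t\<^sup>2 + 4 * t\<^sup>2 * (n y $ 3)\<^sup>2) * u k y"
proof -
  interpret J: nil3_jet t H2 "n y" "a 1 y" "a 2 y" "s 1 y" "s 2 y" by (rule jet[OF assms])
  interpret L: bounded_linear "killing_lin t k" by (rule bounded_linear_killing_lin)
  have n: "J.n1 = partial 1 n y" "J.n2 = partial 2 n y"
    unfolding J.n1_def J.n2_def unfolding s_def by simp_all
  have T: "J.T1 = T1 y" "J.T2 = T2 y" by (simp_all add: J.T1_def J.T2_def T1_def T2_def)
  have F: "J.F1 = F1 y" "J.F2 = F2 y" by (simp_all add: J.F1_def J.F2_def F1_def F2_def T)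
  \<comment> \<open>The flux without its sign factor; near \<open>y\<close> the two differ by a
    constant multiple only.\<close>
  define Psi1 where "Psi1 z = killing t k (P z) \<bullet> F1 z + killing_lin t k (T1 z) \<bullet> n z" for z
  define Psi2 where "Psi2 z = killing t k (P z) \<bullet> F2 z + killing_lin t k (T2 z) \<bullet> n z" for z
  have smooth: "smooth_on U (\<lambda>z. killing t k (P z) \<bullet> F1 z)" "smooth_on U (\<lambda>z. killing_lin t k (T1 z))"
    "smooth_on U (\<lambda>z. killing t k (P z) \<bullet> F2 z)" "smooth_on U (\<lambda>z. killing_lin t k (T2 z))"
    by (intro smooth_on_inner smooth_killing smooth_F smooth_on_bounded_linear[OF bounded_linear_killing_lin]
        smooth_T U)+
  note [simp] = smooth[THEN smooth_on_differentiable, OF assms]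
    smooth_on_differentiable[OF smooth_on_inner[OF U smooth(2) smooth_n] assms]
    smooth_on_differentiable[OF smooth_on_inner[OF U smooth(4) smooth_n] assms]
    differentiables[OF assms] differentiables'[OF assms]
  obtain V where V: "open V" "y \<in> V" "V \<subseteq> U" "\<forall>z\<in>V. sgn (rho z) = sgn (rho y)"
    using sgn_rho_locally_constant[OF assms] by (elim exE conjE)
  have d: "Psi1 differentiable (at y)" "Psi2 differentiable (at y)"
    unfolding Psi1_def[abs_def] Psi2_def[abs_def] by simp_all
  have "partial 1 (flux (u k) 1) y = partial 1 (\<lambda>z. sgn (rho y) * Psi1 z) y"
  proof (rule partial_cong[OF V(1,2)])
    fix z assume "z \<in> V"
    then have "z \<in> U" "sgn (rho z) = sgn (rho y)" using V(3,4) by blast+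
    then show "flux (u k) 1 z = sgn (rho y) * Psi1 z" by (simp add: flux_killing(1) Psi1_def)
  qed
  then have 1: "partial 1 (flux (u k) 1) y = sgn (rho y) * partial 1 Psi1 y"
    by (simp add: partial_linear[OF bounded_linear_mult_right] d)
  have "partial 2 (flux (u k) 2) y = partial 2 (\<lambda>z. sgn (rho y) * Psi2 z) y"
  proof (rule partial_cong[OF V(1,2)])
    fix z assume "z \<in> V"
    then have "z \<in> U" "sgn (rho z) = sgn (rho y)" using V(3,4) by blast+
    then show "flux (u k) 2 z = sgn (rho y) * Psi2 z" by (simp add: flux_killing(2) Psi2_def)
  qed
  then have 2: "partial 2 (flux (u k) 2) y = sgn (rho y) * partial 2 Psi2 y"
    by (simp add: partial_linear[OF bounded_linear_mult_right] d)
  have "lap (u k) y = sgn (rho y) * (partial 1 Psi1 y + partial 2 Psi2 y) / \<bar>rho y\<bar>"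
    by (simp add: lap_def sum_2 1 2 sqrt_det_g[OF assms] distrib_left)
  also have "\<dots> = (partial 1 Psi1 y + partial 2 Psi2 y) / rho y"
    using rho_nonzero[OF assms] by (simp add: sgn_if field_simps)
  also have "partial 1 Psi1 y + partial 2 Psi2 y = killing t k (P y) \<bullet> (partial 1 F1 y + partial 2 F2 y)
      + killing_lin t k (a 1 y) \<bullet> F1 y + killing_lin t k (a 2 y) \<bullet> F2 y
      + killing_lin t k (partial 1 T1 y + partial 2 T2 y) \<bullet> n y
      + killing_lin t k (T1 y) \<bullet> partial 1 n y + killing_lin t k (T2 y) \<bullet> partial 2 n y"
    unfolding Psi1_def[abs_def] Psi2_def[abs_def]
    by (simp add: partial_add partial_inner partial_killing[OF assms] partial_linear[OF bounded_linear_killing_lin]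
        L.add inner_add_left inner_add_right)
  \<comment> \<open>The identity trades all terms other than the divergence of the flux of
    \<open>n\<close> for \<open>J.R\<close>, and in the difference only the potential times
    \<open>n y\<close> is left.\<close>
  also have "\<dots> = - (killing t k (P y) \<bullet> (J.R - J.dF))"
    using J.killing_identity[of k "P y"]
    unfolding divergence_F[OF assms] divergence_T[OF assms] n T F inner_diff_right by linarith
  also have "\<dots> = - (rho y * (H2\<^sup>2 - 2 * t\<^sup>2 + 4 * t\<^sup>2 * (n y $ 3)\<^sup>2) - 2 * (n y \<bullet> cross3 (s 1 y) (s 2 y))) * u k y"
    by (simp add: J.R_def u_def rho_def left_diff_distrib)
  finally show ?thesis using rho_nonzero[OF assms] by (simp add: field_simps)
qed

end

section \<open>The area measure\<close>

lemma set_nn_integral_eq_has_integral_iff: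
  fixes f :: "'a::euclidean_space \<Rightarrow> real"
  assumes "set_borel_measurable borel A f" "\<And>x. x \<in> A \<Longrightarrow> 0 \<le> f x" "0 \<le> r"
  shows "(\<integral>\<^sup>+x\<in>A. ennreal (f x) \<partial>lborel) = ennreal r \<longleftrightarrow> (f has_integral r) A"
proof
  assume r: "(\<integral>\<^sup>+x\<in>A. ennreal (f x) \<partial>lborel) = ennreal r"
  let ?g = "\<lambda>x. indicator A x *\<^sub>R f x"
  have "(?g has_integral r) UNIV"
  proof (rule nn_integral_has_integral)
    show "?g \<in> borel_measurable borel" using assms(1) by (simp add: set_borel_measurable_def)
    show "0 \<le> ?g x" for x using assms(2) by (auto simp: indicator_def)
    have "(\<integral>\<^sup>+x. ennreal (?g x) \<partial>lborel) = (\<integral>\<^sup>+x\<in>A. ennreal (f x) \<partial>lborel)"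
      by (intro nn_integral_cong) (auto simp: indicator_def)
    with r show "(\<integral>\<^sup>+x. ennreal (?g x) \<partial>lborel) = ennreal r" by simp
  qed fact
  moreover have "?g = (\<lambda>x. if x \<in> A then f x else 0)" by (auto simp: indicator_def)
  ultimately show "(f has_integral r) A" by (simp add: has_integral_restrict_UNIV)
next
  assume "(f has_integral r) A"
  then show "(\<integral>\<^sup>+x\<in>A. ennreal (f x) \<partial>lborel) = ennreal r"
    using nn_integral_has_integral_lebesgue'[of A f r] assms(2) by blast
qed

text \<open>The formula for absolutely integrable functions with values in \<open>real^1\<close>,
  brought to nonnegative scalars, for which integrability is already absolute.\<close>

lemma has_integral_change_of_variables_nonneg:
  fixes f :: "real^'n::{finite,wellorder} \<Rightarrow> real" and g :: "real^'n::_ \<Rightarrow> real^'n::_"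
  assumes S: "S \<in> sets lebesgue"
    and der: "\<And>x. x \<in> S \<Longrightarrow> (g has_derivative g' x) (at x within S)"
    and inj: "inj_on g S" and nonneg: "\<And>y. y \<in> g ` S \<Longrightarrow> 0 \<le> f y"
  shows "((\<lambda>x. \<bar>det (matrix (g' x))\<bar> * f (g x)) has_integral r) S \<longleftrightarrow> (f has_integral r) (g ` S)"
proof -
  have *: "h absolutely_integrable_on A \<and> integral A h = r \<longleftrightarrow> (h has_integral r) A"
    if "\<And>x. x \<in> A \<Longrightarrow> 0 \<le> h x" for h :: "real^'n::{finite,wellorder} \<Rightarrow> real" and A
    using nonnegative_absolutely_integrable_1[of h A] that set_lebesgue_integral_eq_integral(1)[of A h]
    by (auto simp: has_integral_iff)
  have "(\<lambda>x. \<bar>det (matrix (g' x))\<bar> *\<^sub>R (vec (f (g x)) :: real^1)) absolutely_integrable_on S \<and>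
        integral S (\<lambda>x. \<bar>det (matrix (g' x))\<bar> *\<^sub>R (vec (f (g x)) :: real^1)) = vec r
     \<longleftrightarrow> (\<lambda>x. vec (f x) :: real^1) absolutely_integrable_on (g ` S) \<and> integral (g ` S) (\<lambda>x. vec (f x) :: real^1) = vec r"
    using has_absolute_integral_change_of_variables[OF S der inj] .
  then show ?thesis
    unfolding absolutely_integrable_on_1_iff integral_on_1_eq
    using nonneg by (simp add: * flip: of_real_def)
qed

text \<open>Assuming measurability of \<open>h\<close>, which will be the density of the first
  chart, makes a separate argument for the Jacobian unnecessary.\<close>

lemma nn_integral_change_of_variables:
  fixes f :: "real^'n::{finite,wellorder} \<Rightarrow> real" and g :: "real^'n::_ \<Rightarrow> real^'n::_"
  assumes S: "S \<in> sets borel"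
    and der: "\<And>x. x \<in> S \<Longrightarrow> (g has_derivative g' x) (at x within S)"
    and inj: "inj_on g S" and nonneg: "\<And>y. y \<in> g ` S \<Longrightarrow> 0 \<le> f y"
    and meas: "set_borel_measurable borel (g ` S) f"
    and h: "set_borel_measurable borel S h" "\<And>x. x \<in> S \<Longrightarrow> h x = \<bar>det (matrix (g' x))\<bar> * f (g x)"
  shows "(\<integral>\<^sup>+x\<in>S. ennreal (h x) \<partial>lborel) = (\<integral>\<^sup>+y\<in>g ` S. ennreal (f y) \<partial>lborel)"
    (is "?a = ?b")
proof -
  have "(h has_integral r) S \<longleftrightarrow> ((\<lambda>x. \<bar>det (matrix (g' x))\<bar> * f (g x)) has_integral r) S" for r
    by (rule has_integral_cong) (simp add: h)
  also have "\<dots> r \<longleftrightarrow> (f has_integral r) (g ` S)" for r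
    by (rule has_integral_change_of_variables_nonneg[OF _ der inj nonneg]) (use S in auto)
  finally have *: "?a = ennreal r \<longleftrightarrow> ?b = ennreal r" if "r \<ge> 0" for r
    using set_nn_integral_eq_has_integral_iff[OF h(1) _ that] nonneg h(2)
      set_nn_integral_eq_has_integral_iff[OF meas nonneg that] by auto
  \<comment> \<open>Both values equal the same finite reals, so they coincide if one of them is
    finite and are both infinite otherwise.\<close>
  show ?thesis by (cases ?a; cases ?b) (use * in \<open>auto simp: top_unique\<close>)
qed

section \<open>Borel sets and charts\<close>

locale smooth_atlas_space =
  fixes X :: "'a topology" and A :: "'a chart set"
  assumes atlas: "smooth_atlas X A"
begin

lemma chart: "c \<in> A \<Longrightarrow> is_chart X c"
  and cover: "(\<Union>c\<in>A. fst c) = topspace X"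
  and smooth_transition: "c \<in> A \<Longrightarrow> d \<in> A \<Longrightarrow> smooth_on (snd c ` (fst c \<inter> fst d)) (in_chart c (snd d))"
  using atlas by (auto simp: smooth_atlas_def)

lemma transition: "c \<in> A \<Longrightarrow> d \<in> A \<Longrightarrow> y \<in> snd c ` (fst c \<inter> fst d)
    \<Longrightarrow> (in_chart c (snd d)) differentiable (at y)"
  by (rule smooth_on_differentiable[OF smooth_transition])

definition "borel_X = sigma (topspace X) {U. openin X U}"

lemma opens_Pow: "{U. openin X U} \<subseteq> Pow (topspace X)"
  by (auto dest: openin_subset)

lemma space_borel_X [simp]: "space borel_X = topspace X"
  by (simp add: borel_X_def space_measure_of[OF opens_Pow])

lemma sets_borel_X: "sets borel_X = sigma_sets (topspace X) {U. openin X U}"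
  by (simp add: borel_X_def sets_measure_of[OF opens_Pow])

lemma open_sets_borel_X: "openin X U \<Longrightarrow> U \<in> sets borel_X"
  by (auto simp: sets_borel_X)

definition "kappa c = inv_into (fst c) (snd c)"

context
  fixes c assumes c: "c \<in> A"
begin

lemma chart_open: "openin X (fst c)" "open (chart_image c)"
  and chart_hom: "homeomorphic_map (subtopology X (fst c)) (top_of_set (chart_image c)) (snd c)"
  using chart[OF c] by (auto simp: is_chart_def)

lemma chart_subset: "fst c \<subseteq> topspace X"
  using chart_open(1) openin_subset by blast

lemma chart_inj: "inj_on (snd c) (fst c)"
  using chart_hom chart_subset by (simp add: homeomorphic_map_def topspace_subtopology inf_absorb2)

lemma kappa_snd: "p \<in> fst c \<Longrightarrow> kappa c (snd c p) = p"
  by (simp add: kappa_def chart_inj)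

lemma snd_kappa: "y \<in> chart_image c \<Longrightarrow> snd c (kappa c y) = y"
  by (simp add: kappa_def chart_image_def f_inv_into_f)

lemma kappa_in: "y \<in> chart_image c \<Longrightarrow> kappa c y \<in> fst c"
  by (simp add: kappa_def chart_image_def inv_into_into)

lemma kappa_vimage: "B \<subseteq> fst c \<Longrightarrow> kappa c -` B \<inter> chart_image c = snd c ` B"
  using kappa_snd snd_kappa by (force simp: chart_image_def)

lemma open_chart_image: "openin X U \<Longrightarrow> U \<subseteq> fst c \<Longrightarrow> open (snd c ` U)"
  using homeomorphic_map_openness[OF chart_hom, of U] chart_open chart_subset
  by (simp add: topspace_subtopology openin_open_subtopology openin_open_eq)

lemma open_chart_vimage:
  assumes "open S" "S \<subseteq> chart_image c" shows "openin X (fst c \<inter> snd c -` S)"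
proof -
  have "snd c ` (fst c \<inter> snd c -` S) = S" using assms(2) by (auto simp: chart_image_def)
  then have "openin (subtopology X (fst c)) (fst c \<inter> snd c -` S)"
    using homeomorphic_map_openness[OF chart_hom, of "fst c \<inter> snd c -` S"] chart_open chart_subset assms
    by (simp add: topspace_subtopology openin_open_eq le_infI1)
  then show ?thesis using chart_open by (simp add: openin_open_subtopology)
qed

lemma kappa_measurable: "kappa c \<in> measurable (restrict_space borel (chart_image c)) borel_X"
  unfolding borel_X_def
proof (rule measurable_measure_of[OF opens_Pow])
  show "kappa c \<in> space (restrict_space borel (chart_image c)) \<rightarrow> topspace X"
    using kappa_in chart_subset by (auto simp: space_restrict_space)
  fix U assume "U \<in> {U. openin X U}"
  then have "openin X (U \<inter> fst c)" using chart_open by blast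
  then have "open (snd c ` (U \<inter> fst c))" by (rule open_chart_image) simp
  moreover have "kappa c -` U \<inter> space (restrict_space borel (chart_image c)) = snd c ` (U \<inter> fst c)"
    using kappa_vimage[of "U \<inter> fst c"] kappa_in by (auto simp: space_restrict_space)
  ultimately show "kappa c -` U \<inter> space (restrict_space borel (chart_image c)) \<in> sets (restrict_space borel (chart_image c))"
    using chart_open by (subst sets_restrict_space_iff) (auto simp: chart_image_def)
qed

lemma chart_image_measurable: "B \<in> sets borel_X \<Longrightarrow> B \<subseteq> fst c \<Longrightarrow> snd c ` B \<in> sets borel"
  using measurable_sets[OF kappa_measurable, of B] chart_open kappa_vimage[of B]
  by (subst (asm) sets_restrict_space_iff) (auto simp: space_restrict_space)

end

end

section \<open>Gluing chart densities to a measure\<close>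

text \<open>Of the area element only continuity, positivity and the Jacobian rule matter for the
  measure, together with compactness.\<close>

locale chart_density = smooth_atlas_space +
  fixes D :: "'a chart \<Rightarrow> real^2 \<Rightarrow> real"
  assumes compact: "compact_space X"
    and continuous: "c \<in> A \<Longrightarrow> continuous_on (chart_image c) (D c)"
    and positive: "c \<in> A \<Longrightarrow> y \<in> chart_image c \<Longrightarrow> D c y > 0"
    and density: "c \<in> A \<Longrightarrow> d \<in> A \<Longrightarrow> y \<in> snd c ` (fst c \<inter> fst d)
      \<Longrightarrow> D c y = \<bar>det (matrix (frechet_derivative (in_chart c (snd d)) (at y)))\<bar> * D d (in_chart c (snd d) y)"
begin

context
  fixes c assumes c: "c \<in> A"
begin

lemma density_measurable:
  assumes "S \<in> sets borel" "S \<subseteq> chart_image c" shows "set_borel_measurable borel S (D c)"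
proof -
  have "set_borel_measurable borel (chart_image c) (D c)"
    by (rule borel_measurable_continuous_on_indicator[folded set_borel_measurable_def])
      (use chart_open[OF c] continuous[OF c] in auto)
  then show ?thesis by (rule set_borel_measurable_subset) (use assms in auto)
qed

text \<open>A measure on all of \<open>X\<close> that ignores what lies outside the chart; the
  measures of different charts thus share a sigma-algebra and can be added.\<close>

definition "chart_measure =
  distr (restrict_space (density lborel (\<lambda>y. ennreal (D c y) * indicator (chart_image c) y)) (chart_image c)) borel_X (kappa c)"

lemma density_indicator_measurable: "(\<lambda>y. ennreal (D c y) * indicator (chart_image c) y) \<in> borel_measurable lborel"
proof -
  have "(\<lambda>y. ennreal (indicator (chart_image c) y *\<^sub>R D c y)) \<in> borel_measurable lborel"
    using density_measurable[of "chart_image c"] chart_open[OF c] by (simp add: set_borel_measurable_def)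
  also have "(\<lambda>y. ennreal (indicator (chart_image c) y *\<^sub>R D c y)) = (\<lambda>y. ennreal (D c y) * indicator (chart_image c) y)"
    by (auto simp: indicator_def)
  finally show ?thesis .
qed

lemma sets_chart_measure: "sets chart_measure = sets borel_X"
  by (simp add: chart_measure_def)

lemma emeasure_chart_measure:
  assumes "B \<in> sets borel_X"
  shows "emeasure chart_measure B = (\<integral>\<^sup>+y\<in>snd c ` (B \<inter> fst c). ennreal (D c y) \<partial>lborel)"
proof -
  let ?N = "density lborel (\<lambda>y. ennreal (D c y) * indicator (chart_image c) y)"
  have k: "kappa c \<in> measurable (restrict_space ?N (chart_image c)) borel_X"
  proof -
    have "sets (restrict_space ?N (chart_image c)) = sets (restrict_space borel (chart_image c))"
      by (simp add: sets_restrict_space)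
    from measurable_cong_sets[OF this refl] show ?thesis using kappa_measurable[OF c] by simp
  qed
  have B: "B \<inter> fst c \<in> sets borel_X" using assms open_sets_borel_X[OF chart_open(1)[OF c]] by blast
  have v: "kappa c -` B \<inter> chart_image c = snd c ` (B \<inter> fst c)"
    using kappa_vimage[OF c, of "B \<inter> fst c"] kappa_in[OF c] by auto
  have sub: "snd c ` (B \<inter> fst c) \<subseteq> chart_image c" by (auto simp: chart_image_def)
  have "emeasure chart_measure B = emeasure (restrict_space ?N (chart_image c)) (snd c ` (B \<inter> fst c))"
    unfolding chart_measure_def by (subst emeasure_distr[OF k assms]) (simp add: space_restrict_space v)
  also have "\<dots> = emeasure ?N (snd c ` (B \<inter> fst c))"
    using sub chart_open[OF c] by (intro emeasure_restrict_space) auto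
  also have "\<dots> = (\<integral>\<^sup>+y\<in>snd c ` (B \<inter> fst c). (ennreal (D c y) * indicator (chart_image c) y) \<partial>lborel)"
    using chart_image_measurable[OF c B] by (intro emeasure_density density_indicator_measurable) auto
  also have "\<dots> = (\<integral>\<^sup>+y\<in>snd c ` (B \<inter> fst c). ennreal (D c y) \<partial>lborel)"
    using sub by (intro nn_integral_cong) (auto simp: indicator_def)
  finally show ?thesis .
qed

end

lemma chart_measure_overlap:
  assumes c: "c \<in> A" and d: "d \<in> A" and B: "B \<in> sets borel_X" "B \<subseteq> fst c" "B \<subseteq> fst d"
  shows "emeasure (chart_measure c) B = emeasure (chart_measure d) B"
proof -
  let ?T = "in_chart c (snd d)"
  have T: "?T (snd c p) = snd d p" if "p \<in> fst c" for p
    using kappa_snd[OF c that] by (simp add: in_chart_def kappa_def)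
  then have im: "?T ` snd c ` B = snd d ` B"
    unfolding image_image using B by (intro image_cong refl) auto
  have sub: "snd c ` B \<subseteq> snd c ` (fst c \<inter> fst d)" using B by blast
  have "(\<integral>\<^sup>+y\<in>snd c ` B. ennreal (D c y) \<partial>lborel) = (\<integral>\<^sup>+y\<in>?T ` snd c ` B. ennreal (D d y) \<partial>lborel)"
  proof (rule nn_integral_change_of_variables)
    show "snd c ` B \<in> sets borel" by (rule chart_image_measurable[OF c B(1,2)])
    show "(?T has_derivative frechet_derivative ?T (at x)) (at x within snd c ` B)" if "x \<in> snd c ` B" for x
    proof (rule has_derivative_at_withinI)
      have "?T differentiable (at x)" by (rule transition[OF c d]) (use that sub in blast)
      then show "(?T has_derivative frechet_derivative ?T (at x)) (at x)"
        by (simp only: frechet_derivative_works)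
    qed
    show "inj_on ?T (snd c ` B)"
    proof (rule inj_onI, elim imageE)
      fix x y p q assume *: "?T x = ?T y" "x = snd c p" "p \<in> B" "y = snd c q" "q \<in> B"
      then have "?T (snd c p) = snd d p" "?T (snd c q) = snd d q" using T B(2) by blast+
      with * have "snd d p = snd d q" by simp
      then have "p = q" using inj_onD[OF chart_inj[OF d]] * B(3) by blast
      then show "x = y" using * by simp
    qed
    show "0 \<le> D d y" if "y \<in> ?T ` snd c ` B" for y
    proof -
      have "y \<in> chart_image d" using that B(3) unfolding im chart_image_def by blast
      then show ?thesis using positive[OF d] less_imp_le by blast
    qed
    show "set_borel_measurable borel (?T ` snd c ` B) (D d)"
      unfolding im using B by (intro density_measurable[OF d] chart_image_measurable[OF d]) (auto simp: chart_image_def)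
    show "set_borel_measurable borel (snd c ` B) (D c)"
      using B by (intro density_measurable[OF c] chart_image_measurable[OF c]) (auto simp: chart_image_def)
    show "D c x = \<bar>det (matrix (frechet_derivative ?T (at x)))\<bar> * D d (?T x)" if "x \<in> snd c ` B" for x
      using density[OF c d, of x] that sub by blast
  qed
  then show ?thesis using B unfolding im
    by (simp add: emeasure_chart_measure c d inf_absorb1)
qed

definition "is_density_measure M \<longleftrightarrow>
    space M = topspace X \<and> sets M = sets borel_X \<and>
    (\<forall>c\<in>A. \<forall>B\<in>sets M. B \<subseteq> fst c \<longrightarrow>
      emeasure M B = (\<integral>\<^sup>+y\<in>snd c ` B. ennreal (D c y) \<partial>lborel))"

lemma is_density_measure_iff:
  "is_density_measure M \<longleftrightarrow> sets M = sets borel_X \<and>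
    (\<forall>c\<in>A. \<forall>B\<in>sets borel_X. B \<subseteq> fst c \<longrightarrow> emeasure M B = emeasure (chart_measure c) B)"
  unfolding is_density_measure_def
  using sets_eq_imp_space_eq[of M borel_X] by (auto simp: emeasure_chart_measure inf_absorb1)

lemma finite_subcover:
  assumes "\<forall>p\<in>topspace X. \<exists>U\<in>F. openin X U \<and> p \<in> U"
  shows "\<exists>G. finite G \<and> G \<subseteq> F \<and> (\<forall>U\<in>G. openin X U) \<and> \<Union>G = topspace X"
proof -
  have "compactin X (topspace X)" using compact by (simp add: compact_space_def)
  moreover have "topspace X \<subseteq> \<Union>{U\<in>F. openin X U}" using assms by blast
  moreover have "\<forall>U\<in>{U\<in>F. openin X U}. openin X U" by blast
  ultimately obtain G where G: "finite G" "G \<subseteq> {U\<in>F. openin X U}" "topspace X \<subseteq> \<Union>G"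
    unfolding compactin_def by meson
  then have "\<Union>G \<subseteq> topspace X" using openin_subset by blast
  with G show ?thesis by blast
qed

lemma finite_chart_cover:
  "\<exists>(cs :: nat \<Rightarrow> 'a chart) m. (\<forall>i<m. cs i \<in> A) \<and> (\<Union>i<m. fst (cs i)) = topspace X"
proof -
  have "\<forall>p\<in>topspace X. \<exists>U\<in>fst ` A. openin X U \<and> p \<in> U"
  proof
    fix p assume "p \<in> topspace X"
    then obtain c where c: "c \<in> A" "p \<in> fst c" using cover by blast
    show "\<exists>U\<in>fst ` A. openin X U \<and> p \<in> U"
      by (rule bexI[of _ "fst c"]) (use c chart_open(1)[OF c(1)] in simp_all)
  qed
  from finite_subcover[OF this] obtain G where G: "finite G" "G \<subseteq> fst ` A" "\<Union>G = topspace X"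
    by (elim exE conjE)
  obtain C where C: "finite C" "C \<subseteq> A" "G = fst ` C"
    using finite_subset_image[OF G(1,2)] by (elim exE conjE)
  obtain l where l: "set l = C" using finite_list[OF C(1)] by (elim exE)
  have nth: "set l = (!) l ` {..<length l}" unfolding set_conv_nth by blast
  have "\<forall>i<length l. l ! i \<in> A"
  proof (intro allI impI)
    fix i assume "i < length l"
    then have "l ! i \<in> set l" by (rule nth_mem)
    then show "l ! i \<in> A" using l C(2) by blast
  qed
  moreover have "(\<Union>i<length l. fst (l ! i)) = topspace X"
  proof -
    have "(\<Union>i<length l. fst (l ! i)) = \<Union>(fst ` set l)" unfolding nth image_image ..
    then show ?thesis using l C(3) G(3) by simp
  qed
  ultimately show ?thesis by (intro exI[of _ "(!) l"] exI[of _ "length l"] conjI)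
qed

text \<open>Removing from each chart domain the earlier ones leaves pieces on which nothing is
  counted twice.\<close>

lemma measurable_chart_partition:
  "\<exists>(cs :: nat \<Rightarrow> 'a chart) V m. (\<forall>i<m. cs i \<in> A \<and> V i \<in> sets borel_X \<and> V i \<subseteq> fst (cs i)) \<and>
    (\<Union>i<m. V i) = topspace X \<and> disjoint_family V"
proof -
  obtain cs :: "nat \<Rightarrow> 'a chart" and m where cs: "\<forall>i<m. cs i \<in> A" "(\<Union>i<m. fst (cs i)) = topspace X"
    using finite_chart_cover by (elim exE conjE)
  \<comment> \<open>\<open>disjointed\<close> acts on sequences, so the finite family is continued
    by empty sets.\<close>
  define W where "W i = (if i < m then fst (cs i) else {})" for i
  have W: "W i \<in> sets borel_X" for i
    using open_sets_borel_X[OF chart_open(1)] cs(1) by (simp add: W_def)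
  have "disjointed W i \<in> sets borel_X" for i
    using sets.range_disjointed_sets[of W borel_X] W by blast
  moreover have "disjointed W i \<subseteq> fst (cs i)" if "i < m" for i
    using disjointed_subset[of W i] that by (simp add: W_def)
  moreover have "(\<Union>i<m. disjointed W i) = topspace X"
  proof -
    have "(\<Union>i\<in>{0..<m}. disjointed W i) = (\<Union>i\<in>{0..<m}. W i)"
      by (rule finite_UN_disjointed_eq)
    also have "\<dots> = topspace X" using cs(2) by (simp add: W_def atLeast0LessThan)
    finally show ?thesis by (simp add: atLeast0LessThan)
  qed
  ultimately show ?thesis using cs(1) disjoint_family_disjointed[of W]
    by (intro exI[of _ cs] exI[of _ "disjointed W"] exI[of _ m] conjI allI impI) auto
qed

lemma partition_sums:
  fixes m :: nat
  assumes "sets M = sets borel_X" "B \<in> sets borel_X" "(\<Union>i<m. V i) = topspace X" "disjoint_family V"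
    "\<And>i. i < m \<Longrightarrow> V i \<in> sets borel_X"
  shows "(\<Sum>i<m. emeasure M (B \<inter> V i)) = emeasure M B"
proof -
  have "(\<Sum>i<m. emeasure M (B \<inter> V i)) = emeasure M (\<Union>i<m. B \<inter> V i)"
  proof (rule sum_emeasure)
    have "B \<inter> V i \<inter> (B \<inter> V j) = {}" if "i \<noteq> j" for i j
      using disjoint_family_onD[OF assms(4), of i j] that by auto
    then show "disjoint_family_on (\<lambda>i. B \<inter> V i) {..<m}" by (simp add: disjoint_family_on_def)
  qed (use assms in auto)
  also have "(\<Union>i<m. B \<inter> V i) = B"
    using assms(2,3) sets.sets_into_space[of B borel_X] by auto
  finally show ?thesis .
qed

text \<open>Each piece of a partition is measured in its own chart; by
  \<open>chart_measure_overlap\<close> any chart containing the set gives the same sum.\<close>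

lemma ex_density_measure: "\<exists>M. is_density_measure M"
proof -
  obtain cs :: "nat \<Rightarrow> 'a chart" and V m where
    csV: "\<forall>i<m. cs i \<in> A \<and> V i \<in> sets borel_X \<and> V i \<subseteq> fst (cs i)"
    and V3: "(\<Union>i<m. V i) = topspace X" "disjoint_family V"
    using measurable_chart_partition by (elim exE conjE)
  have cs: "cs i \<in> A" and V: "V i \<in> sets borel_X" "V i \<subseteq> fst (cs i)" if "i < m" for i
    using csV that by auto
  define mu where "mu B = (\<Sum>i<m. emeasure (chart_measure (cs i)) (B \<inter> V i))" for B
  define M where "M = measure_of (topspace X) (sets borel_X) mu"
  have Pow: "sets borel_X \<subseteq> Pow (topspace X)" using sets.space_closed[of borel_X] by simp
  have sets: "sets M = sets borel_X"
    using sets_measure_of[OF Pow] sets.sigma_sets_eq[of borel_X] by (simp add: M_def)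
  have "countably_additive (sets borel_X) mu"
  proof (rule countably_additiveI)
    fix B :: "nat \<Rightarrow> 'a set"
    assume B: "range B \<subseteq> sets borel_X" "disjoint_family B" "(\<Union>i. B i) \<in> sets borel_X"
    have "(\<lambda>n. emeasure (chart_measure (cs i)) (B n \<inter> V i)) sums emeasure (chart_measure (cs i)) ((\<Union>n. B n) \<inter> V i)"
      if "i < m" for i
    proof -
      have "range (\<lambda>n. B n \<inter> V i) \<subseteq> sets (chart_measure (cs i))"
        using B V(1)[OF that] by (auto simp: sets_chart_measure[OF cs[OF that]])
      moreover have "disjoint_family (\<lambda>n. B n \<inter> V i)" using B(2) by (auto simp: disjoint_family_on_def)
      ultimately have "suminf (\<lambda>n. emeasure (chart_measure (cs i)) (B n \<inter> V i)) = emeasure (chart_measure (cs i)) (\<Union>n. B n \<inter> V i)"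
        by (rule suminf_emeasure)
      then show ?thesis using summable_sums[OF summableI, of "\<lambda>n. emeasure (chart_measure (cs i)) (B n \<inter> V i)"] by simp
    qed
    then have "(\<lambda>n. mu (B n)) sums mu (\<Union>n. B n)"
      unfolding mu_def by (intro sums_sum) auto
    then show "suminf (\<lambda>n. mu (B n)) = mu (\<Union>n. B n)" by (rule sums_unique[symmetric])
  qed
  moreover have "positive (sets M) mu" by (simp add: positive_def mu_def)
  ultimately have M: "emeasure M B = mu B" if "B \<in> sets borel_X" for B
    using that Pow sets by (intro emeasure_measure_of[OF M_def]) auto
  have "emeasure M B = emeasure (chart_measure c) B" if c: "c \<in> A" and B: "B \<in> sets borel_X" "B \<subseteq> fst c" for c B
  proof -
    have "emeasure M B = (\<Sum>i<m. emeasure (chart_measure c) (B \<inter> V i))"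
      unfolding M[OF B(1)] mu_def
    proof (intro sum.cong refl)
      fix i assume "i \<in> {..<m}"
      then have i: "i < m" by simp
      show "emeasure (chart_measure (cs i)) (B \<inter> V i) = emeasure (chart_measure c) (B \<inter> V i)"
        using V(1,2)[OF i] B by (intro chart_measure_overlap cs i c) auto
    qed
    also have "\<dots> = emeasure (chart_measure c) B"
      by (rule partition_sums[OF sets_chart_measure[OF c] B(1) V3 V(1)])
    finally show ?thesis .
  qed
  then have "is_density_measure M" using sets by (simp add: is_density_measure_iff)
  then show ?thesis by blast
qed

text \<open>Both measures are forced on subsets of chart domains, and a partition cuts every Borel
  set into finitely many of these.\<close>

lemma density_measure_unique:
  assumes "is_density_measure M" "is_density_measure M'"
  shows "M = M'"
proof (rule measure_eqI)
  obtain cs :: "nat \<Rightarrow> 'a chart" and V m where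
    csV: "\<forall>i<m. cs i \<in> A \<and> V i \<in> sets borel_X \<and> V i \<subseteq> fst (cs i)"
    and V3: "(\<Union>i<m. V i) = topspace X" "disjoint_family V"
    using measurable_chart_partition by (elim exE conjE)
  have cs: "cs i \<in> A" and V: "V i \<in> sets borel_X" "V i \<subseteq> fst (cs i)" if "i < m" for i
    using csV that by auto
  have s: "sets M = sets borel_X" "sets M' = sets borel_X" using assms by (simp_all add: is_density_measure_iff)
  then show "sets M = sets M'" by simp
  fix B assume "B \<in> sets M"
  then have B: "B \<in> sets borel_X" using s by simp
  have "emeasure M (B \<inter> V i) = emeasure M' (B \<inter> V i)" if "i < m" for i
  proof -
    have "B \<inter> V i \<in> sets borel_X" "B \<inter> V i \<subseteq> fst (cs i)" using V(1,2)[OF that] B by auto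
    then show ?thesis using assms cs[OF that] unfolding is_density_measure_iff by metis
  qed
  then have "(\<Sum>i<m. emeasure M (B \<inter> V i)) = (\<Sum>i<m. emeasure M' (B \<inter> V i))"
    by (intro sum.cong) auto
  moreover have "(\<Sum>i<m. emeasure M (B \<inter> V i)) = emeasure M B"
    by (rule partition_sums[OF s(1) B V3]) (rule V(1))
  moreover have "(\<Sum>i<m. emeasure M' (B \<inter> V i)) = emeasure M' B"
    by (rule partition_sums[OF s(2) B V3]) (rule V(1))
  ultimately show "emeasure M B = emeasure M' B" by simp
qed

context
  fixes M assumes M: "is_density_measure M"
begin

lemma density_measure_sets: "sets M = sets borel_X" and density_measure_space: "space M = topspace X"
  and density_measure_emeasure:
    "c \<in> A \<Longrightarrow> B \<in> sets borel_X \<Longrightarrow> B \<subseteq> fst c \<Longrightarrow> emeasure M B = (\<integral>\<^sup>+y\<in>snd c ` B. ennreal (D c y) \<partial>lborel)"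
  using M by (auto simp: is_density_measure_def)

text \<open>The density is continuous, hence bounded on a closed ball inside the chart image;
  compactness of \<open>X\<close> then makes the total finite.\<close>

lemma density_measure_locally_finite:
  assumes "p \<in> topspace X"
  shows "\<exists>U. openin X U \<and> p \<in> U \<and> emeasure M U < \<infinity>"
proof -
  obtain c where c: "c \<in> A" "p \<in> fst c" using assms cover by blast
  have "snd c p \<in> chart_image c" using c by (simp add: chart_image_def)
  then obtain r where r: "r > 0" "cball (snd c p) r \<subseteq> chart_image c"
    using chart_open(2)[OF c(1)] open_contains_cball by blast
  let ?S = "ball (snd c p) r"
  let ?U = "fst c \<inter> snd c -` ?S"
  have S: "?S \<subseteq> chart_image c" using r(2) ball_subset_cball[of "snd c p" r] by blast
  have U: "openin X ?U" by (rule open_chart_vimage[OF c(1) open_ball S])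
  have im: "snd c ` ?U = ?S" using S by (auto simp: chart_image_def)
  have "bdd_above (D c ` cball (snd c p) r)"
    using compact_continuous_image[OF continuous_on_subset[OF continuous[OF c(1)] r(2)] compact_cball]
    by (intro bounded_imp_bdd_above compact_imp_bounded)
  then obtain K where K: "\<forall>y\<in>cball (snd c p) r. D c y \<le> K" by (auto simp: bdd_above_def)
  have "emeasure M ?U = (\<integral>\<^sup>+y\<in>?S. ennreal (D c y) \<partial>lborel)"
    using density_measure_emeasure[OF c(1) open_sets_borel_X[OF U]] im by simp
  also have "\<dots> \<le> (\<integral>\<^sup>+y. ennreal K * indicator ?S y \<partial>lborel)"
    using K by (intro nn_integral_mono) (auto simp: indicator_def intro!: ennreal_leI)
  also have "\<dots> = ennreal K * emeasure lborel ?S" by (rule nn_integral_cmult_indicator) simp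
  also have "\<dots> < \<infinity>" using emeasure_lborel_ball_finite[of "snd c p" r] by (simp add: ennreal_mult_less_top)
  finally show ?thesis using U c(2) r(1) by (intro exI[of _ ?U]) auto
qed

lemma density_measure_finite: "emeasure M (topspace X) < \<infinity>"
proof -
  have "\<forall>p\<in>topspace X. \<exists>U\<in>{U. emeasure M U < \<infinity>}. openin X U \<and> p \<in> U"
  proof
    fix p assume "p \<in> topspace X"
    from density_measure_locally_finite[OF this]
    obtain U where "openin X U" "p \<in> U" "emeasure M U < \<infinity>" by (elim exE conjE)
    then show "\<exists>U\<in>{U. emeasure M U < \<infinity>}. openin X U \<and> p \<in> U"
      by (intro bexI[of _ U]) simp_all
  qed
  from finite_subcover[OF this] obtain G where
    G: "finite G" "G \<subseteq> {U. emeasure M U < \<infinity>}" "\<forall>U\<in>G. openin X U" "\<Union>G = topspace X"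
    by (elim exE conjE)
  have "emeasure M (\<Union>U\<in>G. U) \<le> (\<Sum>U\<in>G. emeasure M U)"
    using G(1,3) by (intro emeasure_subadditive_finite) (auto simp: density_measure_sets intro: open_sets_borel_X)
  also have "\<dots> < \<infinity>" using G(1,2) by (auto simp: ennreal_sum_less_top)
  finally show ?thesis using G(4) by simp
qed

text \<open>A positive density with zero integral would make a nonempty open subset of the plane
  negligible.\<close>

lemma density_measure_open_pos:
  assumes U: "openin X U" "U \<noteq> {}" shows "emeasure M U > 0"
proof -
  obtain p where p: "p \<in> U" using U by blast
  then have "p \<in> topspace X" using U openin_subset by blast
  then obtain c where c: "c \<in> A" "p \<in> fst c" using cover by blast
  have o: "openin X (U \<inter> fst c)" using U chart_open(1)[OF c(1)] by blast
  let ?S = "snd c ` (U \<inter> fst c)"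
  have S: "open ?S" "?S \<noteq> {}" using open_chart_image[OF c(1) o] p c by auto
  have sub: "?S \<subseteq> chart_image c" by (auto simp: chart_image_def)
  have eq: "emeasure M (U \<inter> fst c) = (\<integral>\<^sup>+y\<in>?S. ennreal (D c y) \<partial>lborel)"
    by (rule density_measure_emeasure[OF c(1) open_sets_borel_X[OF o]]) simp
  have "emeasure M (U \<inter> fst c) \<noteq> 0"
  proof
    assume z0: "emeasure M (U \<inter> fst c) = 0"
    have z: "(\<integral>\<^sup>+y. ennreal (indicator ?S y *\<^sub>R D c y) \<partial>lborel) = 0"
    proof -
      have "ennreal (indicator ?S y *\<^sub>R D c y) = ennreal (D c y) * indicator ?S y" for y
        by (simp split: split_indicator)
      with z0 eq show ?thesis by simp
    qed
    have "(\<lambda>y. indicator ?S y *\<^sub>R D c y) \<in> borel_measurable lborel"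
      using density_measurable[OF c(1) _ sub] S(1) by (simp add: set_borel_measurable_def)
    then have "AE y in lborel. ennreal (indicator ?S y *\<^sub>R D c y) = 0"
      using z by (subst (asm) nn_integral_0_iff_AE) auto
    then have "AE y in lborel. y \<notin> ?S"
    proof (eventually_elim, intro notI)
      fix y assume "ennreal (indicator ?S y *\<^sub>R D c y) = 0" "y \<in> ?S"
      moreover from \<open>y \<in> ?S\<close> sub have "D c y > 0" by (intro positive[OF c(1)]) blast
      ultimately show False by (simp add: ennreal_eq_0_iff)
    qed
    then have "?S \<in> null_sets lborel"
      using S(1) AE_iff_null_sets[of ?S lborel] by simp
    then have "negligible ?S" using negligible_iff_null_sets null_sets_completionI by blast
    then show False using open_not_negligible S by blast
  qed
  moreover have "emeasure M (U \<inter> fst c) \<le> emeasure M U"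
    using open_sets_borel_X[OF U(1)] density_measure_sets by (intro emeasure_mono) auto
  ultimately show ?thesis by (metis le_zero_eq not_gr_zero)
qed

end

end

section \<open>Change of charts and instability\<close>

lemma frechet_derivative_partial:
  fixes f :: "real^'n \<Rightarrow> 'b::real_normed_vector"
  assumes "f differentiable (at x)"
  shows "frechet_derivative f (at x) v = (\<Sum>i\<in>UNIV. v $ i *\<^sub>R partial i f x)"
proof -
  have lin: "linear (frechet_derivative f (at x))" by (rule linear_frechet_derivative[OF assms])
  have "v = (\<Sum>i\<in>UNIV. v $ i *\<^sub>R axis i 1)"
    using basis_expansion[of v] by (simp add: scalar_mult_eq_scaleR)
  then have "frechet_derivative f (at x) v = frechet_derivative f (at x) (\<Sum>i\<in>UNIV. v $ i *\<^sub>R axis i 1)"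
    by (rule arg_cong)
  also have "\<dots> = (\<Sum>i\<in>UNIV. v $ i *\<^sub>R partial i f x)"
    by (simp add: linear_sum[OF lin] linear_cmul[OF lin] partial_def)
  finally show ?thesis .
qed

lemma in_chart_apply: "in_chart c f y = f (inv_into (fst c) (snd c) y)"
  by (simp add: in_chart_def)

lemma matrix_inv_congruence:
  fixes G J :: "real^'n^'n"
  assumes "det G \<noteq> 0" "det J \<noteq> 0"
  shows "matrix_inv (transpose J ** G ** J) = matrix_inv J ** matrix_inv G ** matrix_inv (transpose J)"
proof (rule matrix_inv_eqI)
  note J = matrix_inv_cancel[OF assms(2)] and G = matrix_inv_cancel[OF assms(1)]
  note T = matrix_inv_cancel[of "transpose J", unfolded det_transpose, OF assms(2)]
  have "transpose J ** G ** J ** (matrix_inv J ** matrix_inv G ** matrix_inv (transpose J))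
      = transpose J ** (G ** (J ** matrix_inv J) ** matrix_inv G) ** matrix_inv (transpose J)"
    by (simp only: matrix_mul_assoc)
  then show "transpose J ** G ** J ** (matrix_inv J ** matrix_inv G ** matrix_inv (transpose J)) = mat 1"
    by (simp add: J G T)
  have "matrix_inv J ** matrix_inv G ** matrix_inv (transpose J) ** (transpose J ** G ** J)
      = matrix_inv J ** (matrix_inv G ** (matrix_inv (transpose J) ** transpose J) ** G) ** J"
    by (simp only: matrix_mul_assoc)
  then show "matrix_inv J ** matrix_inv G ** matrix_inv (transpose J) ** (transpose J ** G ** J) = mat 1"
    by (simp add: J G T)
qed

text \<open>Changing both forms by the same congruence conjugates their quotient.\<close>

lemma trace_congruence:
  fixes G b J :: "real^'n^'n"
  assumes "det G \<noteq> 0" "det J \<noteq> 0"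
  shows "trace (matrix_inv (transpose J ** G ** J) ** (transpose J ** b ** J)) = trace (matrix_inv G ** b)"
proof -
  note J = matrix_inv_cancel[OF assms(2)]
  note T = matrix_inv_cancel[of "transpose J", unfolded det_transpose, OF assms(2)]
  have "matrix_inv (transpose J ** G ** J) ** (transpose J ** b ** J)
      = matrix_inv J ** (matrix_inv G ** (matrix_inv (transpose J) ** transpose J) ** b ** J)"
    unfolding matrix_inv_congruence[OF assms] by (simp only: matrix_mul_assoc)
  also have "trace \<dots> = trace (matrix_inv G ** (matrix_inv (transpose J) ** transpose J) ** b ** J ** matrix_inv J)"
    by (rule trace_mul_sym)
  also have "\<dots> = trace (matrix_inv G ** b ** (J ** matrix_inv J))"
    by (simp add: T matrix_mul_assoc)
  finally show ?thesis by (simp add: J)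
qed

lemma congruence_entries:
  fixes x z :: "2 \<Rightarrow> 'a::real_inner" and J :: "real^2^2"
  assumes "\<And>j. x' j = (\<Sum>i\<in>UNIV. J $ i $ j *\<^sub>R x i)" "\<And>j. z' j = (\<Sum>i\<in>UNIV. J $ i $ j *\<^sub>R z i)"
  shows "(\<chi> i j. x' i \<bullet> z' j) = transpose J ** (\<chi> i j. x i \<bullet> z j) ** J"
  by (simp add: assms vec_eq_iff sum_2 matrix_matrix_mult_def transpose_def inner_add_left inner_add_right algebra_simps)

context smooth_atlas_space
begin

lemma in_chart_kappa: "in_chart c f y = f (kappa c y)"
  by (simp add: in_chart_apply kappa_def)

lemma open_overlap: "c \<in> A \<Longrightarrow> d \<in> A \<Longrightarrow> open (snd c ` (fst c \<inter> fst d))"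
  by (rule open_chart_image) (auto intro: openin_Int chart_open(1))

lemma in_chart_overlap:
  assumes "c \<in> A" "d \<in> A" "y \<in> snd c ` (fst c \<inter> fst d)"
  shows "in_chart c f y = in_chart d f (in_chart c (snd d) y)" "in_chart c (snd d) y \<in> chart_image d"
proof -
  obtain p where p: "p \<in> fst c" "p \<in> fst d" "y = snd c p" using assms(3) by blast
  then show "in_chart c f y = in_chart d f (in_chart c (snd d) y)"
    by (simp add: in_chart_kappa kappa_snd assms)
  show "in_chart c (snd d) y \<in> chart_image d"
    using p by (simp add: in_chart_kappa kappa_snd assms chart_image_def)
qed

lemma partial_chart_change:
  assumes cd: "c \<in> A" "d \<in> A" and y: "y \<in> snd c ` (fst c \<inter> fst d)"
    and f: "in_chart d f differentiable (at (in_chart c (snd d) y))"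
  shows "partial j (in_chart c f) y = (\<Sum>i\<in>UNIV. matrix (frechet_derivative (in_chart c (snd d)) (at y)) $ i $ j
    *\<^sub>R partial i (in_chart d f) (in_chart c (snd d) y))"
proof -
  let ?T = "in_chart c (snd d)"
  have T: "(?T has_derivative frechet_derivative ?T (at y)) (at y)"
    using transition[OF cd y] by (simp only: frechet_derivative_works)
  have F: "(in_chart d f has_derivative frechet_derivative (in_chart d f) (at (?T y))) (at (?T y))"
    using f by (simp only: frechet_derivative_works)
  have "partial j (in_chart c f) y = partial j (\<lambda>y. in_chart d f (?T y)) y"
    by (rule partial_cong[OF open_overlap[OF cd] y]) (rule in_chart_overlap(1)[OF cd])
  also have "\<dots> = frechet_derivative (in_chart d f) (at (?T y)) (frechet_derivative ?T (at y) (axis j 1))"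
    by (rule partial_eq[OF has_derivative_compose[OF T F]])
  also have "\<dots> = (\<Sum>i\<in>UNIV. matrix (frechet_derivative ?T (at y)) $ i $ j *\<^sub>R partial i (in_chart d f) (?T y))"
    unfolding frechet_derivative_partial[OF f] by (simp add: matrix_def)
  finally show ?thesis .
qed

end

section \<open>Chart independence on the surface\<close>

locale nil3_surface =
  fixes t :: real and X :: "'a topology" and A :: "'a chart set" and \<psi> N :: "'a \<Rightarrow> real^3" and H :: real
  assumes cmc: "compact_two_sided_cmc_surface (nil3_metric t) X A \<psi> N H"
begin

sublocale smooth_atlas_space X A
  using cmc by unfold_locales (simp add: compact_two_sided_cmc_surface_def surface_def)

lemma compact: "compact_space X" and connected: "connected_space X" and nonempty: "topspace X \<noteq> {}"
  and mean: "p \<in> topspace X \<Longrightarrow> mean_curvature (nil3_metric t) A \<psi> N p = H"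
  using cmc by (auto simp: compact_two_sided_cmc_surface_def surface_def)

lemma patch:
  assumes c: "c \<in> A" shows "nil3_patch t (chart_image c) (in_chart c \<psi>) (in_chart c N)"
proof
  show "open (chart_image c)" by (rule chart_open(2)[OF c])
  show "smooth_on (chart_image c) (in_chart c \<psi>)" "smooth_on (chart_image c) (in_chart c N)"
    "\<And>y. y \<in> chart_image c \<Longrightarrow> inj (frechet_derivative (in_chart c \<psi>) (at y))"
    "\<And>y. y \<in> chart_image c \<Longrightarrow> nil3_frame t (in_chart c \<psi> y) (in_chart c N y) \<bullet> nil3_frame t (in_chart c \<psi> y) (in_chart c N y) = 1"
    "\<And>y i. y \<in> chart_image c \<Longrightarrow> nil3_frame t (in_chart c \<psi> y) (in_chart c N y) \<bullet> nil3_frame t (in_chart c \<psi> y) (partial i (in_chart c \<psi>) y) = 0"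
    using cmc c unfolding compact_two_sided_cmc_surface_def immersion_def smooth_map_def unit_normal_field_def metric_inner_nil3
    by blast+
qed

abbreviation "frame_a c \<equiv> nil3_patch.a t (in_chart c \<psi>)"
abbreviation "frame_n c \<equiv> nil3_patch.n t (in_chart c \<psi>) (in_chart c N)"
abbreviation "frame_s c \<equiv> nil3_patch.s t (in_chart c \<psi>) (in_chart c N)"
abbreviation "frame_g c \<equiv> nil3_patch.g t (in_chart c \<psi>)"
abbreviation "frame_b c \<equiv> nil3_patch.b t (in_chart c \<psi>) (in_chart c N)"
abbreviation "frame_ip c \<equiv> nil3_patch.ip t (in_chart c \<psi>)"
abbreviation "J c d y \<equiv> matrix (frechet_derivative (in_chart c (snd d)) (at y))"

lemma induced_metric_eq: assumes c: "c \<in> A" shows "induced_metric (nil3_metric t) c \<psi> = frame_g c"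
proof -
  interpret C: nil3_patch t "chart_image c" "in_chart c \<psi>" "in_chart c N" by (rule patch[OF c])
  show ?thesis by (simp add: fun_eq_iff induced_metric_def metric_inner_nil3 C.g_def C.a_def)
qed

lemma normal_derivative_eq:
  assumes c: "c \<in> A" and y: "y \<in> chart_image c"
  shows "nil3_frame t (in_chart c \<psi> y) (normal_derivative (nil3_metric t) c \<psi> N i y) = - frame_s c i y"
proof -
  interpret C: nil3_patch t "chart_image c" "in_chart c \<psi>" "in_chart c N" by (rule patch[OF c])
  have "partial i C.n y = nil3_frame t (in_chart c \<psi> y) (partial i (in_chart c N) y)
      + nil3_twist t (partial i (in_chart c \<psi>) y) (in_chart c N y)"
    unfolding C.n_def[abs_def] by (rule partial_nil3_frame[OF C.differentiables(4,5)[OF y]])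
  then show ?thesis
    unfolding normal_derivative_def nil3_frame_covariant C.s_def
    by (simp add: C.a_def C.n_def nil3_twist_def)
qed

lemma shape_operator_eq:
  assumes c: "c \<in> A" and y: "y \<in> chart_image c"
  shows "shape_operator (nil3_metric t) c \<psi> N y = matrix_inv (frame_g c y) ** frame_b c y"
proof -
  interpret C: nil3_patch t "chart_image c" "in_chart c \<psi>" "in_chart c N" by (rule patch[OF c])
  have "nil3_frame t p (- v) = - nil3_frame t p v" for p v
    by (simp add: vec_eq_iff forall_3 algebra_simps)
  then have "metric_inner (nil3_metric t) (in_chart c \<psi> y) (partial i (in_chart c \<psi>) y)
      (- normal_derivative (nil3_metric t) c \<psi> N j y) = C.a i y \<bullet> C.s j y" for i j
    by (simp add: metric_inner_nil3 normal_derivative_eq[OF c y] C.a_def)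
  then show ?thesis by (simp add: shape_operator_def induced_metric_eq[OF c] C.b_def)
qed

context
  fixes c d y assumes c: "c \<in> A" and d: "d \<in> A" and y: "y \<in> snd c ` (fst c \<inter> fst d)"
begin

interpretation C: nil3_patch t "chart_image c" "in_chart c \<psi>" "in_chart c N" by (rule patch[OF c])
interpretation D: nil3_patch t "chart_image d" "in_chart d \<psi>" "in_chart d N" by (rule patch[OF d])

private abbreviation "y' \<equiv> in_chart c (snd d) y"

lemma y_in: "y \<in> chart_image c" "y' \<in> chart_image d"
  using y in_chart_overlap(2)[OF c d y] by (auto simp: chart_image_def)

lemma partial_change: "in_chart d f differentiable (at y') \<Longrightarrow>
    partial j (in_chart c f) y = (\<Sum>i\<in>UNIV. J c d y $ i $ j *\<^sub>R partial i (in_chart d f) y')"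
  by (rule partial_chart_change[OF c d y])

lemma a_change: "frame_a c j y = (\<Sum>i\<in>UNIV. J c d y $ i $ j *\<^sub>R frame_a d i y')"
  using in_chart_overlap(1)[OF c d y, of \<psi>] partial_change[OF D.differentiables(4)[OF y_in(2)], of j]
  by (simp add: C.a_def D.a_def sum_2 vec_eq_iff forall_3 algebra_simps)

lemma n_change: "frame_n c y = frame_n d y'"
  using in_chart_overlap(1)[OF c d y, of \<psi>] in_chart_overlap(1)[OF c d y, of N]
  by (simp add: C.n_def D.n_def)

lemma s_change: "frame_s c j y = (\<Sum>i\<in>UNIV. J c d y $ i $ j *\<^sub>R frame_s d i y')"
proof -
  define n where "n p = nil3_frame t (\<psi> p) (N p)" for p
  have n: "C.n = in_chart c n" "D.n = in_chart d n"
    by (simp_all add: fun_eq_iff C.n_def D.n_def in_chart_apply n_def)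
  show ?thesis
    using partial_change[of n j] D.differentiables(2)[OF y_in(2)]
    unfolding C.s_def D.s_def a_change n_change unfolding n
    by (simp add: sum_2 vec_eq_iff forall_3 algebra_simps)
qed

lemma g_change: "frame_g c y = transpose (J c d y) ** frame_g d y' ** J c d y"
  unfolding C.g_def D.g_def by (rule congruence_entries) (rule a_change)+

lemma b_change: "frame_b c y = transpose (J c d y) ** frame_b d y' ** J c d y"
  unfolding C.b_def D.b_def by (rule congruence_entries) (rule a_change s_change)+

lemma det_g_change: "det (frame_g c y) = (det (J c d y))\<^sup>2 * det (frame_g d y')"
  unfolding g_change by (simp add: det_mul det_transpose power2_eq_square)

text \<open>The metric determinant of the first chart is positive and contains this factor squared,
  so the transition map need not be inverted.\<close>

lemma det_J: "det (J c d y) \<noteq> 0"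
  using det_g_change C.det_g_pos[OF y_in(1)] by auto

lemma trace_change: "trace (matrix_inv (frame_g c y) ** frame_b c y) = trace (matrix_inv (frame_g d y') ** frame_b d y')"
  unfolding g_change b_change
  using D.det_g_pos[OF y_in(2)] det_J by (intro trace_congruence) auto

lemma grad_change: "in_chart d f differentiable (at y') \<Longrightarrow>
    nil3_patch.grad (in_chart c f) y = transpose (J c d y) *v nil3_patch.grad (in_chart d f) y'"
  by (simp add: C.grad_def D.grad_def partial_change vec_eq_iff matrix_vector_mult_def transpose_def)

text \<open>Differentials pull back by the transposed Jacobian, and the inverse metric transforms by
  exactly the inverse factors.\<close>

lemma ip_change: "frame_ip c y (transpose (J c d y) *v v) (transpose (J c d y) *v w) = frame_ip d y' v w"
proof -
  let ?J = "J c d y"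
  note Ji = matrix_inv_cancel[OF det_J]
  note T = matrix_inv_cancel[of "transpose ?J", unfolded det_transpose, OF det_J]
  have "matrix_inv (C.g y) *v (transpose ?J *v w)
      = matrix_inv ?J *v (matrix_inv (D.g y') *v (matrix_inv (transpose ?J) ** transpose ?J *v w))"
    unfolding g_change matrix_inv_congruence[OF D.det_g_pos[OF y_in(2), THEN less_imp_neq, symmetric] det_J]
    by (simp only: matrix_vector_mul_assoc matrix_mul_assoc)
  also have "\<dots> = matrix_inv ?J *v (matrix_inv (D.g y') *v w)" by (simp add: T)
  finally have "frame_ip c y (transpose ?J *v v) (transpose ?J *v w)
      = (transpose ?J *v v) \<bullet> (matrix_inv ?J *v (matrix_inv (D.g y') *v w))" by (simp add: C.ip_def)
  also have "\<dots> = v \<bullet> (?J *v (matrix_inv ?J *v (matrix_inv (D.g y') *v w)))"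
    by (simp only: transpose_matrix_vector dot_lmul_matrix)
  also have "\<dots> = v \<bullet> ((?J ** matrix_inv ?J) *v (matrix_inv (D.g y') *v w))"
    by (simp only: matrix_vector_mul_assoc matrix_mul_assoc)
  also have "\<dots> = v \<bullet> (matrix_inv (D.g y') *v w)" by (simp add: Ji)
  finally show ?thesis by (simp add: D.ip_def)
qed

end

lemma chart_at: assumes "p \<in> topspace X" shows "chart_at A p \<in> A" "p \<in> fst (chart_at A p)"
proof -
  obtain c where "c \<in> A \<and> p \<in> fst c" using assms cover by blast
  then have "chart_at A p \<in> A \<and> p \<in> fst (chart_at A p)"
    unfolding chart_at_def by (rule someI)
  then show "chart_at A p \<in> A" "p \<in> fst (chart_at A p)" by auto
qed

text \<open>\<open>mean_curvature\<close> is computed in the chart chosen at each point, so its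
  constancy reaches a fixed chart only through \<open>trace_change\<close>.\<close>

lemma cmc_patch:
  assumes c: "c \<in> A" shows "nil3_cmc_patch t (chart_image c) (in_chart c \<psi>) (in_chart c N) (2 * H)"
proof -
  interpret C: nil3_patch t "chart_image c" "in_chart c \<psi>" "in_chart c N" by (rule patch[OF c])
  show ?thesis
  proof
    fix y assume y: "y \<in> chart_image c"
    define p where "p = kappa c y"
    have p: "p \<in> fst c" "y = snd c p" using kappa_in[OF c y] snd_kappa[OF c y] by (simp_all add: p_def)
    then have pX: "p \<in> topspace X" using chart_subset[OF c] by blast
    let ?d = "chart_at A p"
    note d = chart_at[OF pX]
    have yo: "y \<in> snd c ` (fst c \<inter> fst ?d)" using p d by blast
    have yd: "in_chart c (snd ?d) y = snd ?d p" using kappa_snd[OF c p(1)] p by (simp add: in_chart_kappa)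
    have "trace (matrix_inv (C.g y) ** C.b y) = trace (shape_operator (nil3_metric t) ?d \<psi> N (snd ?d p))"
      using trace_change[OF c d(1) yo] y_in(2)[OF c d(1) yo] by (simp add: yd shape_operator_eq[OF d(1)])
    then show "trace (matrix_inv (C.g y) ** C.b y) = 2 * H"
      using mean[OF pX] by (simp add: mean_curvature_def Let_def)
  qed
qed

section \<open>The norm of the Killing functions\<close>

definition "killing_fun k p = killing t k (\<psi> p) \<bullet> nil3_frame t (\<psi> p) (N p)"
definition "killing_norm p = sqrt (\<Sum>k\<in>UNIV. (killing_fun k p)\<^sup>2)"
text \<open>The gradient of \<open>killing_fun k / killing_norm\<close>, up to a factor.\<close>

definition "deviation c k y = nil3_patch.grad (in_chart c (killing_fun k)) y
  - (in_chart c (killing_fun k) y / in_chart c killing_norm y) *\<^sub>R nil3_patch.grad (in_chart c killing_norm) y"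
definition "defect c y = (\<Sum>k\<in>UNIV. frame_ip c y (deviation c k y) (deviation c k y))"

lemma killing_fun_chart: assumes c: "c \<in> A"
  shows "in_chart c (killing_fun k) = nil3_cmc_patch.u t (in_chart c \<psi>) (in_chart c N) k"
proof -
  interpret C: nil3_cmc_patch t "chart_image c" "in_chart c \<psi>" "in_chart c N" "2 * H" by (rule cmc_patch[OF c])
  show ?thesis by (simp add: fun_eq_iff in_chart_apply killing_fun_def C.u_def C.n_def)
qed

text \<open>The Killing fields span at every point: the third function is the vertical component of
  the normal, and where it vanishes the other two are the horizontal components. This is what makes
  the norm smooth.\<close>

lemma sum_killing_fun_pos:
  assumes c: "c \<in> A" and y: "y \<in> chart_image c"
  shows "(\<Sum>k\<in>UNIV. (in_chart c (killing_fun k) y)\<^sup>2) > 0"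
proof -
  interpret C: nil3_cmc_patch t "chart_image c" "in_chart c \<psi>" "in_chart c N" "2 * H" by (rule cmc_patch[OF c])
  have "(\<Sum>k\<in>UNIV. (in_chart c (killing_fun k) y)\<^sup>2) \<noteq> 0"
  proof
    assume "(\<Sum>k\<in>UNIV. (in_chart c (killing_fun k) y)\<^sup>2) = 0"
    then have "in_chart c (killing_fun k) y = 0" for k by (simp add: sum_nonneg_eq_0_iff)
    then have u: "C.u k y = 0" for k by (simp add: killing_fun_chart[OF c])
    have 3: "C.n y $ 3 = 0"
      using u[of 3] by (simp add: C.u_def killing_def inner_vec_def sum_3)
    have "C.n y $ 1 = 0" "C.n y $ 2 = 0"
      using u[of 1] u[of 2] 3 by (simp_all add: C.u_def killing_def inner_vec_def sum_3)
    with 3 C.unit[OF y] show False by (simp add: inner_vec_def sum_3)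
  qed
  moreover have "(\<Sum>k\<in>UNIV. (in_chart c (killing_fun k) y)\<^sup>2) \<ge> 0" by (intro sum_nonneg) simp
  ultimately show ?thesis by linarith
qed

lemma killing_norm_chart: "in_chart c killing_norm y = sqrt (\<Sum>k\<in>UNIV. (in_chart c (killing_fun k) y)\<^sup>2)"
  by (simp add: in_chart_apply killing_norm_def)

lemma killing_norm_square: "(in_chart c killing_norm y)\<^sup>2 = (\<Sum>k\<in>UNIV. (in_chart c (killing_fun k) y)\<^sup>2)"
  unfolding killing_norm_chart by (simp add: sum_nonneg)

lemma killing_norm_pos: "c \<in> A \<Longrightarrow> y \<in> chart_image c \<Longrightarrow> in_chart c killing_norm y > 0"
  unfolding killing_norm_chart using sum_killing_fun_pos by simp

lemma smooth_killing_fun: assumes c: "c \<in> A" shows "smooth_on (chart_image c) (in_chart c (killing_fun k))"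
proof -
  interpret C: nil3_cmc_patch t "chart_image c" "in_chart c \<psi>" "in_chart c N" "2 * H" by (rule cmc_patch[OF c])
  show ?thesis unfolding killing_fun_chart[OF c] by (rule C.smooth_u)
qed

lemma smooth_killing_norm: assumes c: "c \<in> A" shows "smooth_on (chart_image c) (in_chart c killing_norm)"
proof -
  have "in_chart c killing_norm = (\<lambda>y. sqrt (\<Sum>k\<in>UNIV. (in_chart c (killing_fun k) y)\<^sup>2))"
    by (simp add: fun_eq_iff killing_norm_chart)
  moreover have "smooth_on (chart_image c) (\<lambda>y. sqrt (\<Sum>k\<in>UNIV. (in_chart c (killing_fun k) y)\<^sup>2))"
  proof (rule smooth_on_sqrt[OF chart_open(2)[OF c]])
    show "smooth_on (chart_image c) (\<lambda>y. \<Sum>k\<in>UNIV. (in_chart c (killing_fun k) y)\<^sup>2)"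
      unfolding sum_3 power2_eq_square
      by (intro smooth_on_add smooth_on_mult smooth_killing_fun c chart_open(2))
  qed (rule sum_killing_fun_pos[OF c])
  ultimately show ?thesis by simp
qed

lemma smooth_map_killing_norm: "smooth_map A killing_norm"
  by (simp add: smooth_map_def smooth_killing_norm)

text \<open>All three Killing functions satisfy the Jacobi equation with the same potential
  \<open>q\<close>. As the squared norm is the sum of their squares, \<open>q\<close> drops out and
  a difference of gradient terms is left.\<close>

lemma jacobi_killing_norm_defect:
  assumes "p \<in> topspace X"
  shows "killing_norm p * jacobi_operator (nil3_metric t) A \<psi> N killing_norm p = defect (chart_at A p) (snd (chart_at A p) p)"
proof -
  define c where "c = chart_at A p"
  define y where "y = snd c p"
  have c: "c \<in> A" "p \<in> fst c" using chart_at[OF assms] by (simp_all add: c_def)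
  have y: "y \<in> chart_image c" using c(2) by (simp add: y_def chart_image_def)
  have at: "in_chart c h y = h p" for h :: "'a \<Rightarrow> 'b"
    using kappa_snd[OF c] by (simp add: in_chart_kappa y_def)
  interpret C: nil3_cmc_patch t "chart_image c" "in_chart c \<psi>" "in_chart c N" "2 * H" by (rule cmc_patch[OF c(1)])
  define q where "q = (2 * H)\<^sup>2 - 2 * (C.n y \<bullet> cross3 (C.s 1 y) (C.s 2 y)) / C.rho y - 2 * t\<^sup>2 + 4 * t\<^sup>2 * (C.n y $ 3)\<^sup>2"
  have lap: "laplacian (nil3_metric t) A \<psi> killing_norm p = C.lap (in_chart c killing_norm) y"
    unfolding laplacian_def Let_def c_def[symmetric] y_def[symmetric] induced_metric_eq[OF c(1)]
      C.lap_def C.flux_def[abs_def] ..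
  have "shape_norm2 (nil3_metric t) A \<psi> N p = (2 * H)\<^sup>2 - 2 * (C.n y \<bullet> cross3 (C.s 1 y) (C.s 2 y)) / C.rho y"
    unfolding shape_norm2_def Let_def c_def[symmetric] y_def[symmetric] induced_metric_eq[OF c(1)]
      shape_operator_eq[OF c(1) y] C.shape_norm[OF y] C.mean[OF y] ..
  moreover have "ricci (nil3_metric t) (\<psi> p) (N p) (N p) = - 2 * t\<^sup>2 + 4 * t\<^sup>2 * (C.n y $ 3)\<^sup>2"
    unfolding ricci_nil3 at[symmetric] C.n_def[symmetric] C.unit[OF y] by simp
  ultimately have jac: "jacobi_operator (nil3_metric t) A \<psi> N killing_norm p = C.lap (in_chart c killing_norm) y + q * in_chart c killing_norm y"
    by (simp add: jacobi_operator_def lap q_def at)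
  note hyps = smooth_killing_fun[OF c(1)] smooth_killing_norm[OF c(1)] killing_norm_square y
  have lapu: "C.lap (in_chart c (killing_fun k)) y = - q * in_chart c (killing_fun k) y" for k
    unfolding killing_fun_chart[OF c(1)] C.killing_jacobi_equation[OF y] q_def by simp
  have "killing_norm p * jacobi_operator (nil3_metric t) A \<psi> N killing_norm p
      = in_chart c killing_norm y * C.lap (in_chart c killing_norm) y + q * (in_chart c killing_norm y)\<^sup>2"
    unfolding jac by (simp add: at power2_eq_square algebra_simps)
  also have "\<dots> = (\<Sum>k\<in>UNIV. C.ip y (C.grad (in_chart c (killing_fun k)) y) (C.grad (in_chart c (killing_fun k)) y))
      - C.ip y (C.grad (in_chart c killing_norm) y) (C.grad (in_chart c killing_norm) y)"
    using C.lap_norm[OF hyps] unfolding killing_norm_square lapu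
    by (simp add: sum_3 power2_eq_square algebra_simps)
  also have "\<dots> = defect c y"
    unfolding defect_def deviation_def by (rule C.sum_ip_defect[OF hyps killing_norm_pos[OF c(1) y], symmetric])
  finally show ?thesis by (simp add: c_def y_def)
qed

lemma defect_change:
  assumes c: "c \<in> A" and d: "d \<in> A" and y: "y \<in> snd c ` (fst c \<inter> fst d)"
  shows "defect c y = defect d (in_chart c (snd d) y)"
proof -
  note y' = y_in(2)[OF c d y]
  have deviation: "deviation c k y = transpose (J c d y) *v deviation d k (in_chart c (snd d) y)" for k
    using grad_change[OF c d y smooth_on_differentiable[OF smooth_killing_fun[OF d] y']]
      grad_change[OF c d y smooth_on_differentiable[OF smooth_killing_norm[OF d] y']]
      in_chart_overlap(1)[OF c d y, of "killing_fun k"] in_chart_overlap(1)[OF c d y, of killing_norm]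
    by (simp add: deviation_def matrix_vector_mult_diff_distrib matrix_vector_mult_scaleR)
  show ?thesis unfolding defect_def deviation ip_change[OF c d y] ..
qed

text \<open>The chart picked by \<open>chart_at\<close> may jump from point to point; a fixed chart
  is needed for continuity.\<close>

lemma jacobi_killing_norm:
  assumes c: "c \<in> A" and p: "p \<in> fst c"
  shows "killing_norm p * jacobi_operator (nil3_metric t) A \<psi> N killing_norm p = defect c (snd c p)"
proof -
  have pX: "p \<in> topspace X" using p chart_subset[OF c] by blast
  let ?d = "chart_at A p"
  note d = chart_at[OF pX]
  have "snd c p \<in> snd c ` (fst c \<inter> fst ?d)" using p d by blast
  from defect_change[OF c d(1) this] show ?thesis
    using kappa_snd[OF c p] by (simp add: jacobi_killing_norm_defect[OF pX] in_chart_kappa)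
qed

lemma defect_nonneg:
  assumes c: "c \<in> A" and y: "y \<in> chart_image c" shows "defect c y \<ge> 0"
proof -
  interpret C: nil3_patch t "chart_image c" "in_chart c \<psi>" "in_chart c N" by (rule patch[OF c])
  show ?thesis unfolding defect_def by (intro sum_nonneg C.ip_self_nonneg y)
qed

lemma defect_eq_0:
  assumes c: "c \<in> A" and y: "y \<in> chart_image c" and "defect c y = 0" shows "deviation c k y = 0"
proof -
  interpret C: nil3_patch t "chart_image c" "in_chart c \<psi>" "in_chart c N" by (rule patch[OF c])
  have "frame_ip c y (deviation c k y) (deviation c k y) = 0"
    using assms(3) C.ip_self_nonneg[OF y] unfolding defect_def by (subst (asm) sum_nonneg_eq_0_iff) auto
  then show ?thesis by (rule C.ip_self_eq_0[OF y])
qed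

lemma defect_continuous:
  assumes c: "c \<in> A" shows "continuous_on (chart_image c) (defect c)"
proof -
  interpret C: nil3_patch t "chart_image c" "in_chart c \<psi>" "in_chart c N" by (rule patch[OF c])
  note cont = smooth_on_continuous
  have kn0: "in_chart c killing_norm y \<noteq> 0" if "y \<in> chart_image c" for y using killing_norm_pos[OF c that] by simp
  have dvc: "continuous_on (chart_image c) (\<lambda>y. deviation c k y $ i)" for k i
    unfolding deviation_def C.grad_def
    by (simp, intro continuous_intros cont smooth_on_partial smooth_killing_fun smooth_killing_norm c) (use kn0 in auto)
  show ?thesis
    unfolding defect_def[abs_def] C.ip_def inner_vec_def matrix_vector_mult_def inner_real_def vec_lambda_beta
    by (intro continuous_on_sum continuous_on_mult dvc cont C.smooth_inverse_metric)
qed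

section \<open>Area and energy\<close>

abbreviation "dens c y \<equiv> sqrt (det (induced_metric (nil3_metric t) c \<psi> y))"

sublocale area: chart_density X A "\<lambda>c y. dens c y"
proof
  show "compact_space X" by (rule compact)
  fix c assume c: "c \<in> A"
  interpret C: nil3_patch t "chart_image c" "in_chart c \<psi>" "in_chart c N" by (rule patch[OF c])
  show "continuous_on (chart_image c) (dens c)"
    using smooth_on_continuous[OF C.smooth_sqrt_det_g] by (simp add: induced_metric_eq[OF c])
  show "dens c y > 0" if "y \<in> chart_image c" for y
    using C.det_g_pos[OF that] by (simp add: induced_metric_eq[OF c])
  fix d y assume d: "d \<in> A" and y: "y \<in> snd c ` (fst c \<inter> fst d)"
  show "dens c y = \<bar>det (J c d y)\<bar> * dens d (in_chart c (snd d) y)"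
    unfolding induced_metric_eq[OF c] induced_metric_eq[OF d] det_g_change[OF c d y]
    by (simp add: real_sqrt_mult)
qed

abbreviation "area_M \<equiv> area_measure (nil3_metric t) X A \<psi>"

text \<open>The definite description in \<open>area_measure\<close> can be used only once existence
  and uniqueness are known.\<close>

lemma area_density_measure: "area.is_density_measure area_M"
proof -
  have eq: "is_area_measure (nil3_metric t) X A \<psi> = area.is_density_measure"
    unfolding fun_eq_iff is_area_measure_def area.is_density_measure_def sets_borel_X by simp
  have "\<exists>!M. area.is_density_measure M"
    using area.ex_density_measure area.density_measure_unique by (elim exE) (rule ex1I)
  then show ?thesis unfolding area_measure_def eq by (rule theI')
qed

lemmas area_sets = area.density_measure_sets[OF area_density_measure]
  and area_space = area.density_measure_space[OF area_density_measure]
  and area_finite = area.density_measure_finite[OF area_density_measure]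
  and area_open_pos = area.density_measure_open_pos[OF area_density_measure]

lemma chart_of_point:
  assumes "p \<in> topspace X"
  shows "\<exists>c\<in>A. p \<in> fst c \<and> snd c p \<in> chart_image c \<and> kappa c (snd c p) = p"
proof -
  obtain c where c: "c \<in> A" "p \<in> fst c" using assms cover by blast
  then show ?thesis by (intro bexI[of _ c]) (simp_all add: kappa_snd chart_image_def)
qed

lemma openin_if_charts:
  assumes "S \<subseteq> topspace X"
    and "\<And>c. c \<in> A \<Longrightarrow> open {y \<in> chart_image c. kappa c y \<in> S}"
  shows "openin X S"
proof (subst openin_subopen, intro ballI)
  fix p assume p: "p \<in> S"
  then obtain c where c: "c \<in> A" "p \<in> fst c" "snd c p \<in> chart_image c" "kappa c (snd c p) = p"
    using chart_of_point assms(1) by blast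
  let ?T = "fst c \<inter> snd c -` {y \<in> chart_image c. kappa c y \<in> S}"
  have "openin X ?T" by (rule open_chart_vimage[OF c(1) assms(2)[OF c(1)]]) blast
  moreover have "p \<in> ?T" using c p by simp
  moreover have "?T \<subseteq> S" using kappa_snd[OF c(1)] by auto
  ultimately show "\<exists>T. openin X T \<and> p \<in> T \<and> T \<subseteq> S" by blast
qed

lemma continuous_map_charts:
  fixes h :: "'a \<Rightarrow> real"
  assumes "\<And>c. c \<in> A \<Longrightarrow> continuous_on (chart_image c) (in_chart c h)"
  shows "continuous_map X euclideanreal h"
proof -
  have "openin X {p \<in> topspace X. h p \<in> V}" if V: "open V" for V
  proof (rule openin_if_charts)
    fix c assume c: "c \<in> A"
    have "open (chart_image c \<inter> in_chart c h -` V)"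
      by (rule continuous_open_preimage[OF assms[OF c] chart_open(2)[OF c] V])
    also have "chart_image c \<inter> in_chart c h -` V = {y \<in> chart_image c. kappa c y \<in> {p \<in> topspace X. h p \<in> V}}"
      using kappa_in[OF c] chart_subset[OF c] by (auto simp: in_chart_kappa)
    finally show "open {y \<in> chart_image c. kappa c y \<in> {p \<in> topspace X. h p \<in> V}}" .
  qed blast
  then show ?thesis by (simp add: continuous_map_def)
qed

definition "energy p = killing_norm p * jacobi_operator (nil3_metric t) A \<psi> N killing_norm p"

lemma energy_chart: assumes c: "c \<in> A" and y: "y \<in> chart_image c" shows "in_chart c energy y = defect c y"
  using jacobi_killing_norm[OF c kappa_in[OF c y]] snd_kappa[OF c y] by (simp add: in_chart_kappa energy_def)

lemma energy_continuous: "continuous_map X euclideanreal energy"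
proof (rule continuous_map_charts)
  fix c assume c: "c \<in> A"
  show "continuous_on (chart_image c) (in_chart c energy)"
    using defect_continuous[OF c] by (simp add: energy_chart[OF c] cong: continuous_on_cong)
qed

lemma energy_nonneg: assumes "p \<in> topspace X" shows "energy p \<ge> 0"
proof -
  obtain c where c: "c \<in> A" "p \<in> fst c" "snd c p \<in> chart_image c" using chart_of_point[OF assms] by blast
  then show ?thesis using jacobi_killing_norm[OF c(1,2)] defect_nonneg[OF c(1,3)] by (simp add: energy_def)
qed

lemma energy_measurable: "energy \<in> borel_measurable area_M"
proof (rule borel_measurableI)
  fix S :: "real set" assume "open S"
  then have "openin X {p \<in> topspace X. energy p \<in> S}"
    using energy_continuous by (simp add: continuous_map_def)
  then have "{p \<in> topspace X. energy p \<in> S} \<in> sets area_M" unfolding area_sets by (rule open_sets_borel_X)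
  also have "{p \<in> topspace X. energy p \<in> S} = energy -` S \<inter> space area_M" by (auto simp: area_space)
  finally show "energy -` S \<inter> space area_M \<in> sets area_M" .
qed

text \<open>The integral of a nonintegrable function is 0 by convention, so a vanishing integral is
  informative only together with this.\<close>

lemma energy_integrable: "integrable area_M energy"
proof -
  interpret F: finite_measure area_M
    by (rule finite_measureI) (use area_finite in \<open>simp add: area_space\<close>)
  have "compactin euclideanreal (energy ` topspace X)"
    using compact energy_continuous unfolding compact_space_def by (rule image_compactin)
  then have "bounded (energy ` topspace X)" by (simp add: compact_imp_bounded)
  then obtain K where "\<forall>p\<in>topspace X. norm (energy p) \<le> K" unfolding bounded_iff by auto
  then show ?thesis
    by (intro F.integrable_const_bound[of _ K] AE_I2 energy_measurable) (simp add: area_space)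
qed

text \<open>Tested on the norm, stability bounds the integral of a nonnegative function by 0. The
  set where the function is nonzero is open by continuity, and of measure zero, hence empty.\<close>

lemma stable_imp_energy_0:
  assumes stable: "strongly_stable (nil3_metric t) X A \<psi> N" and p: "p \<in> topspace X"
  shows "energy p = 0"
proof (rule ccontr)
  assume "energy p \<noteq> 0"
  have ae: "AE p in area_M. 0 \<le> energy p" by (rule AE_I2) (simp add: area_space energy_nonneg)
  have "- (\<integral>p. energy p \<partial>area_M) \<ge> 0"
    using stable smooth_map_killing_norm unfolding strongly_stable_def energy_def by blast
  moreover have "(\<integral>p. energy p \<partial>area_M) \<ge> 0" by (rule integral_nonneg_AE[OF ae])
  ultimately have "(\<integral>p. energy p \<partial>area_M) = 0" by simp
  then have "AE p in area_M. energy p = 0"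
    using integral_nonneg_eq_0_iff_AE[OF energy_integrable ae] by simp
  then have "emeasure area_M {p \<in> space area_M. energy p \<noteq> 0} = 0"
    using energy_measurable by (subst (asm) AE_iff_measurable[OF _ refl]) auto
  moreover have "openin X {p \<in> topspace X. energy p \<in> - {0}}"
    by (rule energy_continuous[unfolded continuous_map_def, THEN conjunct2, rule_format]) (simp add: open_Compl)
  then have "emeasure area_M {p \<in> topspace X. energy p \<in> - {0}} > 0"
    by (rule area_open_pos) (use p \<open>energy p \<noteq> 0\<close> in blast)
  ultimately show False by (simp add: area_space)
qed

section \<open>Critical points and constancy\<close>

lemma attains_max:
  fixes h :: "'a \<Rightarrow> real"
  assumes "\<And>c. c \<in> A \<Longrightarrow> smooth_on (chart_image c) (in_chart c h)"
  shows "\<exists>c\<in>A. \<exists>y\<in>chart_image c. \<forall>i. partial i (in_chart c h) y = 0"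
proof -
  have "continuous_map X euclideanreal h"
    by (rule continuous_map_charts) (rule smooth_on_continuous[OF assms])
  then have "compactin euclideanreal (h ` topspace X)"
    using compact unfolding compact_space_def by (rule image_compactin[rotated])
  then have "compact (h ` topspace X)" by simp
  then obtain p where p: "p \<in> topspace X" "\<forall>q\<in>topspace X. h q \<le> h p"
    using compact_attains_sup[of "h ` topspace X"] nonempty by auto
  obtain c where c: "c \<in> A" "p \<in> fst c" "snd c p \<in> chart_image c" "kappa c (snd c p) = p"
    using chart_of_point[OF p(1)] by blast
  let ?f = "in_chart c h" and ?y = "snd c p"
  have "(?f has_derivative frechet_derivative ?f (at ?y)) (at ?y)"
    using smooth_on_differentiable[OF assms[OF c(1)] c(3)] by (simp only: frechet_derivative_works)
  moreover have "\<forall>z\<in>chart_image c. ?f z \<le> ?f ?y"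
    using p(2) c(4) kappa_in[OF c(1)] chart_subset[OF c(1)] by (auto simp: in_chart_kappa)
  ultimately have "frechet_derivative ?f (at ?y) = (\<lambda>v. 0)"
    using differential_zero_maxmin[OF c(3) chart_open(2)[OF c(1)]] by blast
  then have "\<forall>i. partial i ?f ?y = 0" by (simp add: partial_def)
  with c show ?thesis by blast
qed

lemma component_critical_point:
  "\<exists>c\<in>A. \<exists>y\<in>chart_image c. \<forall>i. partial i (in_chart c \<psi>) y $ m = 0"
proof -
  have eq: "in_chart c (\<lambda>p. \<psi> p $ m) = (\<lambda>y. in_chart c \<psi> y $ m)" for c by (simp add: fun_eq_iff in_chart_apply)
  have sm: "smooth_on (chart_image c) (in_chart c \<psi>)" if "c \<in> A" for c
    using patch[OF that] by (simp add: nil3_patch_def)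
  have "smooth_on (chart_image c) (in_chart c (\<lambda>p. \<psi> p $ m))" if "c \<in> A" for c
    unfolding eq by (rule smooth_on_vec_nth[OF chart_open(2)[OF that] sm[OF that]])
  from attains_max[OF this] obtain c y where c: "c \<in> A" "y \<in> chart_image c"
    "\<forall>i. partial i (\<lambda>y. in_chart c \<psi> y $ m) y = 0"
    unfolding eq by blast
  then have "\<forall>i. partial i (in_chart c \<psi>) y $ m = 0"
    using partial_vec_nth[OF smooth_on_differentiable[OF sm[OF c(1)] c(2)]] by simp
  with c show ?thesis by blast
qed

text \<open>Vanishing derivatives make preimages of arbitrary sets open, so each level set is also
  closed, and connectedness leaves only one.\<close>

lemma locally_constant_imp_constant:
  fixes r :: "'a \<Rightarrow> real"
  assumes smooth: "\<And>c. c \<in> A \<Longrightarrow> smooth_on (chart_image c) (in_chart c r)"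
    and zero: "\<And>c y i. c \<in> A \<Longrightarrow> y \<in> chart_image c \<Longrightarrow> partial i (in_chart c r) y = 0"
    and pq: "p \<in> topspace X" "q \<in> topspace X"
  shows "r p = r q"
proof -
  have op: "openin X {p \<in> topspace X. r p \<in> B}" for B
  proof (rule openin_if_charts)
    fix c assume c: "c \<in> A"
    let ?f = "in_chart c r"
    have d: "(?f has_derivative (\<lambda>h. 0)) (at y)" if "y \<in> chart_image c" for y
    proof -
      have D: "?f differentiable (at y)" by (rule smooth_on_differentiable[OF smooth[OF c] that])
      have "frechet_derivative ?f (at y) = (\<lambda>h. 0)"
        by (simp add: fun_eq_iff frechet_derivative_partial[OF D] zero[OF c that])
      then show ?thesis using D by (simp add: frechet_derivative_works)
    qed
    have "open {y \<in> chart_image c. ?f y \<in> B}"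
      unfolding open_contains_ball
    proof
      fix y assume y: "y \<in> {y \<in> chart_image c. ?f y \<in> B}"
      then obtain e where e: "e > 0" "ball y e \<subseteq> chart_image c"
        using openE[OF chart_open(2)[OF c]] by blast
      have "ball y e \<subseteq> {y \<in> chart_image c. ?f y \<in> B}"
      proof
        fix z assume z: "z \<in> ball y e"
        have "?f z = ?f y"
          by (rule has_derivative_zero_unique[OF convex_ball has_derivative_at_withinI[OF d] z]) (use e in auto)
        then show "z \<in> {y \<in> chart_image c. ?f y \<in> B}" using z e(2) y by auto
      qed
      with e(1) show "\<exists>e>0. ball y e \<subseteq> {y \<in> chart_image c. ?f y \<in> B}" by blast
    qed
    also have "{y \<in> chart_image c. ?f y \<in> B} = {y \<in> chart_image c. kappa c y \<in> {p \<in> topspace X. r p \<in> B}}"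
      using kappa_in[OF c] chart_subset[OF c] by (auto simp: in_chart_kappa)
    finally show "open {y \<in> chart_image c. kappa c y \<in> {p \<in> topspace X. r p \<in> B}}" .
  qed blast
  let ?S = "{x \<in> topspace X. r x \<in> {r p}}"
  have "topspace X - ?S = {x \<in> topspace X. r x \<in> - {r p}}" by blast
  then have "closedin X ?S" using op[of "- {r p}"] by (simp add: closedin_def)
  with op[of "{r p}"] have "?S = {} \<or> ?S = topspace X"
    using connected unfolding connected_space_clopen_in by blast
  with pq have "q \<in> ?S" by blast
  then show ?thesis by simp
qed

text \<open>The ratio \<open>r\<close> is constant, and vanishes where the first coordinate is maximal, since the surface
  is tangent to a vertical plane there. So the normal is horizontal everywhere, also where the third
  coordinate is maximal; but there the tangent plane is spanned by \<open>\<partial>\<^sub>x\<close> and \<open>\<partial>\<^sub>y\<close>.\<close>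

theorem not_strongly_stable: "\<not> strongly_stable (nil3_metric t) X A \<psi> N"
proof
  assume stable: "strongly_stable (nil3_metric t) X A \<psi> N"
  define r where "r p = killing_fun 3 p * inverse (killing_norm p)" for p
  have r: "in_chart c r = (\<lambda>y. in_chart c (killing_fun 3) y * inverse (in_chart c killing_norm y))" for c
    by (simp add: fun_eq_iff in_chart_apply r_def)
  have kn0: "in_chart c killing_norm y \<noteq> 0" if "c \<in> A" "y \<in> chart_image c" for c y using killing_norm_pos[OF that] by simp
  have smooth_r: "smooth_on (chart_image c) (in_chart c r)" if c: "c \<in> A" for c
    unfolding r by (intro smooth_on_mult smooth_on_inverse smooth_killing_fun smooth_killing_norm c chart_open(2) kn0)
  have zero: "partial i (in_chart c r) y = 0" if c: "c \<in> A" and y: "y \<in> chart_image c" for c y i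
  proof -
    interpret C: nil3_patch t "chart_image c" "in_chart c \<psi>" "in_chart c N" by (rule patch[OF c])
    have "kappa c y \<in> topspace X" using kappa_in[OF c y] chart_subset[OF c] by blast
    then have "defect c y = 0"
      using stable_imp_energy_0[OF stable] energy_chart[OF c y] by (simp add: in_chart_kappa)
    then have "deviation c 3 y $ i = 0" by (simp add: defect_eq_0[OF c y])
    then have eq: "partial i (in_chart c (killing_fun 3)) y * in_chart c killing_norm y = in_chart c (killing_fun 3) y * partial i (in_chart c killing_norm) y"
      using kn0[OF c y] by (simp add: deviation_def C.grad_def field_simps)
    \<comment> \<open>The quotient rule, obtained by differentiating the product of \<open>r\<close>
      with the norm.\<close>
    have "partial i (\<lambda>y. in_chart c r y * in_chart c killing_norm y) y = partial i (in_chart c (killing_fun 3)) y"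
      by (rule partial_cong[OF chart_open(2)[OF c] y]) (simp add: r kn0[OF c])
    then have "partial i (in_chart c r) y * in_chart c killing_norm y + in_chart c r y * partial i (in_chart c killing_norm) y
        = partial i (in_chart c (killing_fun 3)) y"
      using smooth_on_differentiable[OF smooth_r[OF c] y] smooth_on_differentiable[OF smooth_killing_norm[OF c] y]
      by (simp add: partial_mult)
    then have "partial i (in_chart c r) y * in_chart c killing_norm y * in_chart c killing_norm y = 0"
      using eq kn0[OF c y] by (simp add: r field_simps)
    then show ?thesis using kn0[OF c y] by simp
  qed
  have kf3: "in_chart c (killing_fun 3) y = frame_n c y $ 3" if "c \<in> A" for c y
  proof -
    interpret C: nil3_cmc_patch t "chart_image c" "in_chart c \<psi>" "in_chart c N" "2 * H" by (rule cmc_patch[OF that])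
    show ?thesis unfolding killing_fun_chart[OF that] C.u_def by (simp add: killing_def inner_vec_def sum_3)
  qed
  have in_X: "kappa c y \<in> topspace X" if "c \<in> A" "y \<in> chart_image c" for c y
    using kappa_in[OF that] chart_subset[OF that(1)] by blast
  obtain c y where c: "c \<in> A" and y: "y \<in> chart_image c" and crit: "\<forall>i. partial i (in_chart c \<psi>) y $ 1 = 0"
    using component_critical_point[of 1] by blast
  interpret C: nil3_patch t "chart_image c" "in_chart c \<psi>" "in_chart c N" by (rule patch[OF c])
  have "cross3 (C.a 1 y) (C.a 2 y) $ 3 = 0"
    using crit by (simp add: C.a_def cross_components)
  then have "C.n y $ 3 = 0" using C.cross_a[OF y] C.rho_nonzero[OF y] by simp
  then have r0: "r (kappa c y) = 0"
    using kf3[OF c, of y] by (simp add: r_def in_chart_kappa)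
  have vanish: "frame_n d z $ 3 = 0" if d: "d \<in> A" and z: "z \<in> chart_image d" for d z
  proof -
    have "r (kappa d z) = 0"
      using locally_constant_imp_constant[OF smooth_r zero in_X[OF d z] in_X[OF c y]] r0 by simp
    then show ?thesis using kn0[OF d z] kf3[OF d, of z] by (simp add: r_def in_chart_kappa)
  qed
  obtain d z where d: "d \<in> A" and z: "z \<in> chart_image d" and crit3: "\<forall>i. partial i (in_chart d \<psi>) z $ 3 = 0"
    using component_critical_point[of 3] by blast
  interpret D: nil3_patch t "chart_image d" "in_chart d \<psi>" "in_chart d N" by (rule patch[OF d])
  let ?n = "D.n z"
  have n3: "?n $ 3 = 0" by (rule vanish[OF d z])
  define x where "x i = partial i (in_chart d \<psi>) z" for i :: 2
  \<comment> \<open>The coordinate of \<open>x i\<close> along the normal rotated by a quarter turn,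
    the only horizontal direction orthogonal to a horizontal normal.\<close>
  define l where "l i = ?n $ 1 * x i $ 2 - ?n $ 2 * x i $ 1" for i
  have n1: "(?n $ 1)\<^sup>2 + (?n $ 2)\<^sup>2 = 1"
    using D.unit[OF z] n3 by (simp add: inner_vec_def sum_3 power2_eq_square)
  have perp: "?n $ 1 * x i $ 1 + ?n $ 2 * x i $ 2 = 0" for i
    using D.perp[OF z, of i] n3 by (simp add: D.a_def x_def inner_vec_def sum_3)
  have "x i $ 1 = - l i * ?n $ 2" "x i $ 2 = l i * ?n $ 1" "x i $ 3 = 0" for i
  proof -
    have "x i $ 1 = x i $ 1 * ((?n $ 1)\<^sup>2 + (?n $ 2)\<^sup>2) - ?n $ 1 * (?n $ 1 * x i $ 1 + ?n $ 2 * x i $ 2)"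
      unfolding n1 perp by simp
    then show "x i $ 1 = - l i * ?n $ 2" by (simp add: l_def power2_eq_square algebra_simps)
    have "x i $ 2 = x i $ 2 * ((?n $ 1)\<^sup>2 + (?n $ 2)\<^sup>2) - ?n $ 2 * (?n $ 1 * x i $ 1 + ?n $ 2 * x i $ 2)"
      unfolding n1 perp by simp
    then show "x i $ 2 = l i * ?n $ 1" by (simp add: l_def power2_eq_square algebra_simps)
    show "x i $ 3 = 0" using crit3 by (simp add: x_def)
  qed
  note x = this
  \<comment> \<open>Both coordinate fields are multiples of one vector, against the immersion
    property.\<close>
  have a: "D.a i z = l i *\<^sub>R nil3_frame t (in_chart d \<psi> z) (vector [- ?n $ 2, ?n $ 1, 0])" for i
    by (simp add: D.a_def x_def[symmetric] vec_eq_iff forall_3 x algebra_simps)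
  have "l 2 *\<^sub>R D.a 1 z + (- l 1) *\<^sub>R D.a 2 z = 0" unfolding a by simp
  from D.frame_independent[OF z this] have "l 1 = 0" by simp
  then have "1 *\<^sub>R D.a 1 z + 0 *\<^sub>R D.a 2 z = 0" unfolding a by simp
  from D.frame_independent[OF z this] show False by simp
qed

end

theorem corollary3p8:
  fixes \<tau> :: real
  assumes "\<tau> \<noteq> 0"
  shows "(\<nexists>(X :: 'a topology) A \<psi> N H.
            compact_two_sided_cmc_surface (nil3_metric \<tau>) X A \<psi> N H \<and>
            strongly_stable (nil3_metric \<tau>) X A \<psi> N \<and> H\<^sup>2 \<ge> \<tau>\<^sup>2) \<and>
         (\<forall>(X :: 'a topology) A \<psi> N H g.
            compact_two_sided_cmc_surface (nil3_metric \<tau>) X A \<psi> N H \<and>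
            strongly_stable (nil3_metric \<tau>) X A \<psi> N \<and> H\<^sup>2 < \<tau>\<^sup>2 \<and> has_genus X g \<longrightarrow>
            area (nil3_metric \<tau>) X A \<psi> * \<bar>H\<^sup>2 - \<tau>\<^sup>2\<bar> > 2 * pi * (real g - 1))"
proof -
  have "\<not> strongly_stable (nil3_metric \<tau>) X A \<psi> N"
    if "compact_two_sided_cmc_surface (nil3_metric \<tau>) X A \<psi> N H" for X :: "'a topology" and A \<psi> N H
    using that by (rule nil3_surface.not_strongly_stable[OF nil3_surface.intro])
  then show ?thesis by blast
qed

end
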